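(* Let $\boldsymbol{X}=(X_k)_{k\in\mathbb{Z}}\subset\mathcal{H}$ be a centered, $L^4$-$m$-approximable process, with representation $X_k=f(\varepsilon_k,\varepsilon_{k-1},\dots)$, $k\in\mathbb{Z}$. Then, for each $h\in\mathbb{Z}$ and $m,N\in\mathbb{N}$ with $|h|\leq N-m$, and with $\kappa'=\max\{1,m+|h|-1\}$, it holds $$\frac{N-|h|-m+1}{m^2(2\kappa'-1)}\,\mathbb{E}\big\|\hat{\mathscr{C}}^h_{\boldsymbol{X}^{[m]}}-\mathscr{C}^h_{\boldsymbol{X}^{[m]}}\big\|_{\mathcal{S}}^2\leq\tilde{\tau}_{\boldsymbol{X}}(h,m),$$ where $0\leq\tilde{\tau}_{\boldsymbol{X}}(h,m)<\infty$ is given by $$\tilde{\tau}_{\boldsymbol{X}}(h,m)=\nu_4^4(X_1)+\frac{4}{2\kappa'-1}\,\nu_4^3(X_1)\sum_{k\geq\kappa'}\nu_4\big(X_k-X_k^{(k)}\big).$$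
   Context: $\mathbb{N}=\{1,2,\dots\}$, $\mathbb{N}_0=\mathbb{N}\cup\{0\}$. $\mathcal{H}$ is a real separable Hilbert space. For a Hilbert-space-valued random variable $Z$ and $p\geq1$, $\nu_p(Z)=(\mathbb{E}\|Z\|^p)^{1/p}$, and $L^p_{\mathcal{H}}$ is the space of (classes of) $\mathcal{H}$-valued random variables with $\nu_p(Z)<\infty$. A process is centered if all its elements have expectation (Bochner integral) $0$. The Cartesian product $\mathcal{H}^m$ is a Hilbert space with inner product $\langle\boldsymbol{x},\boldsymbol{y}\rangle=\sum_{i=1}^m\langle x_i,y_i\rangle$. $\|\cdot\|_{\mathcal{S}}$ is the Hilbert–Schmidt norm. For elements $x,y$ of two Hilbert spaces, $x\otimes y=\langle x,\cdot\rangle y$. For square-integrable $X,Y$, the cross-covariance operator is $\mathscr{C}_{X,Y}=\mathbb{E}\big[(X-\mathbb{E}X)\otimes(Y-\mathbb{E}Y)\big]$. $L^p$-$m$-approximability ($p\geq1$): a process $(X_k)_{k\in\mathbb{Z}}\subset\mathcal{H}$ is $L^p$-$m$-approximable if for each $k$ it holds $X_k\in L^p_{\mathcal{H}}$ and $X_k=f(\varepsilon_k,\varepsilon_{k-1},\dots)$, where $(\varepsilon_k)_{k\in\mathbb{Z}}$ is an i.i.d. process in a measurable space $S$ and $f\colon S^\infty\to\mathcal{H}$ is measurable, such that $\sum_{m=1}^\infty\nu_p(X_m-X_m^{(m)})<\infty$, where $X_k^{(\ell)}=f(\varepsilon_k,\dots,\varepsilon_{k-\ell+1},\varepsilon^{(\ell)}_{k-\ell},\varepsilon^{(\ell)}_{k-\ell-1},\dots)$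 for $k\in\mathbb{Z}$, $\ell\in\mathbb{N}_0$, and $(\varepsilon_k^{(\ell)})_k$ are independent copies of $(\varepsilon_k)_k$. For $m\in\mathbb{N}$, the process $\boldsymbol{X}^{[m]}=(X_k^{[m]})_{k\in\mathbb{Z}}\subset\mathcal{H}^m$ is defined by $X_k^{[m]}=(X_k,X_{k-1},\dots,X_{k-m+1})^\top$. Its lag-$h$-covariance operator is $\mathscr{C}^h_{\boldsymbol{X}^{[m]}}=\mathscr{C}_{X_0^{[m]},X_h^{[m]}}$, and its estimator based on a sample $X_1,\dots,X_N$ is $$\hat{\mathscr{C}}^h_{\boldsymbol{X}^{[m]}}=\frac{1}{N-|h|-m+1}\sum_{k=\max\{m,m-h\}}^{\min\{N,N-h\}}X_k^{[m]}\otimes X_{k+h}^{[m]}.$$ *)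

theory Defs
  imports "HOL-Probability.Probability"
begin

section \<open>Hilbert-space-valued random variables\<close>

text \<open>Norms and moments take values in \<^typ>\<open>ennreal\<close>, so that infinite values are represented as such
  rather than by a default value.\<close>

text \<open>The power \<open>x\<^sup>a\<close>, meant for exponents \<open>a > 0\<close>.\<close>

definition epowr :: "ennreal \<Rightarrow> real \<Rightarrow> ennreal" where
  "epowr x a = (if x = \<top> then \<top> else ennreal (enn2real x powr a))"

definition nu :: "'w measure \<Rightarrow> real \<Rightarrow> ('w \<Rightarrow> 'a::real_normed_vector) \<Rightarrow> ennreal" where
  "nu M p Z = epowr (\<integral>\<^sup>+\<omega>. ennreal (norm (Z \<omega>) powr p) \<partial>M) (1 / p)"

definition in_Lp :: "'w measure \<Rightarrow> real \<Rightarrow> ('w \<Rightarrow> 'a::real_normed_vector) \<Rightarrow> bool" where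
  "in_Lp M p Z \<longleftrightarrow> Z \<in> borel_measurable M \<and> nu M p Z < \<top>"

definition centered ::
  "'w measure \<Rightarrow> (int \<Rightarrow> 'w \<Rightarrow> 'a::{real_inner, banach, second_countable_topology}) \<Rightarrow> bool" where
  "centered M X \<longleftrightarrow> (\<forall>k. integrable M (X k) \<and> integral\<^sup>L M (X k) = 0)"

text \<open>The library states the Bochner integral only for second countable spaces, which the space of
  bounded operators is not in infinite dimension. This is
  the same definition without that restriction: Borel functions that are approximated in mean by
  simple functions.\<close>

definition has_Bochner_integral ::
  "'w measure \<Rightarrow> ('w \<Rightarrow> 'b::real_normed_vector) \<Rightarrow> 'b \<Rightarrow> bool" where
  "has_Bochner_integral M F T \<longleftrightarrow> F \<in> borel_measurable M \<and>
    (\<exists>s. (\<forall>i. Bochner_Integration.simple_bochner_integrable M (s i)) \<and>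
         (\<lambda>i::nat. \<integral>\<^sup>+\<omega>. ennreal (norm (F \<omega> - s i \<omega>)) \<partial>M) \<longlonglongrightarrow> 0 \<and>
         (\<lambda>i. Bochner_Integration.simple_bochner_integral M (s i)) \<longlonglongrightarrow> T)"

lemma has_Bochner_integral_iff_library:
  fixes F :: "'w \<Rightarrow> 'b::{real_normed_vector, second_countable_topology}"
  shows "has_Bochner_integral M F T \<longleftrightarrow> has_bochner_integral M F T"
  unfolding has_Bochner_integral_def has_bochner_integral.simps by auto

definition Bochner_integral :: "'w measure \<Rightarrow> ('w \<Rightarrow> 'b::real_normed_vector) \<Rightarrow> 'b" where
  "Bochner_integral M F = (THE T. has_Bochner_integral M F T)"


section \<open>Operators\<close>

lift_definition tensor_op :: "'a::real_inner \<Rightarrow> 'b::real_normed_vector \<Rightarrow> 'a \<Rightarrow>\<^sub>L 'b"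
  is "\<lambda>x y z. (x \<bullet> z) *\<^sub>R y"
  by (rule bounded_linear_scaleR_const[OF bounded_linear_inner_right])

definition orthonormal_basis :: "'a::real_inner set \<Rightarrow> bool" where
  "orthonormal_basis B \<longleftrightarrow>
     pairwise orthogonal B \<and> (\<forall>e\<in>B. norm e = 1) \<and> closure (span B) = UNIV"

text \<open>On a Hilbert space the value does not depend on the orthonormal basis chosen; it is \<open>\<top>\<close> if
  \<open>T\<close> is not a Hilbert-Schmidt operator.\<close>

definition hs_norm :: "('a::real_inner \<Rightarrow>\<^sub>L 'b::real_normed_vector) \<Rightarrow> ennreal" where
  "hs_norm T =
     epowr (\<Sum>\<^sub>\<infinity>e\<in>(SOME B. orthonormal_basis B). ennreal ((norm (blinfun_apply T e))\<^sup>2)) (1 / 2)"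

definition cross_cov :: "'w measure
    \<Rightarrow> ('w \<Rightarrow> 'a::{real_inner, banach, second_countable_topology})
    \<Rightarrow> ('w \<Rightarrow> 'b::{real_inner, banach, second_countable_topology}) \<Rightarrow> 'a \<Rightarrow>\<^sub>L 'b" where
  "cross_cov M X Y =
     Bochner_integral M (\<lambda>\<omega>. tensor_op (X \<omega> - integral\<^sup>L M X) (Y \<omega> - integral\<^sup>L M Y))"


section \<open>Approximable processes\<close>

definition iid_process :: "'w measure \<Rightarrow> 's measure \<Rightarrow> (int \<Rightarrow> 'w \<Rightarrow> 's) \<Rightarrow> bool" where
  "iid_process M S \<epsilon> \<longleftrightarrow>
     prob_space.indep_vars M (\<lambda>_. S) \<epsilon> UNIV \<and> (\<forall>k. distr M S (\<epsilon> k) = distr M S (\<epsilon> 0))"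

text \<open>The processes \<open>\<epsilon>, \<epsilon>' 0, \<epsilon>' 1, \<dots>\<close>, as random elements of the product space \<open>S\<^sup>\<int>\<close>, are
  independent and have the same law.\<close>

definition independent_copies ::
  "'w measure \<Rightarrow> 's measure \<Rightarrow> (int \<Rightarrow> 'w \<Rightarrow> 's) \<Rightarrow> (nat \<Rightarrow> int \<Rightarrow> 'w \<Rightarrow> 's) \<Rightarrow> bool" where
  "independent_copies M S \<epsilon> \<epsilon>' \<longleftrightarrow>
     prob_space.indep_vars M (\<lambda>_. PiM UNIV (\<lambda>_. S))
       (\<lambda>i \<omega> k. (case i of 0 \<Rightarrow> \<epsilon> | Suc l \<Rightarrow> \<epsilon>' l) k \<omega>) UNIV \<and>
     (\<forall>l. distr M (PiM UNIV (\<lambda>_. S)) (\<lambda>\<omega> k. \<epsilon>' l k \<omega>) =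
          distr M (PiM UNIV (\<lambda>_. S)) (\<lambda>\<omega> k. \<epsilon> k \<omega>))"

text \<open>\<open>coupled f \<epsilon> \<epsilon>' k l\<close> is \<open>X\<^sub>k\<^bsup>(l)\<^esup>\<close>: the innovations \<open>\<epsilon>\<^sub>k, \<dots>, \<epsilon>\<^bsub>k-l+1\<^esub>\<close> are kept and
  all earlier ones are taken from the \<open>l\<close>-th copy.\<close>

definition coupled :: "((nat \<Rightarrow> 's) \<Rightarrow> 'a) \<Rightarrow> (int \<Rightarrow> 'w \<Rightarrow> 's) \<Rightarrow> (nat \<Rightarrow> int \<Rightarrow> 'w \<Rightarrow> 's)
    \<Rightarrow> int \<Rightarrow> nat \<Rightarrow> 'w \<Rightarrow> 'a" where
  "coupled f \<epsilon> \<epsilon>' k l \<omega> =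
     f (\<lambda>j. if j < l then \<epsilon> (k - int j) \<omega> else \<epsilon>' l (k - int j) \<omega>)"

text \<open>The representation \<open>(S, f, \<epsilon>, \<epsilon>')\<close> is a parameter, since \<open>X\<^sub>k\<^bsup>(l)\<^esup>\<close> depends on it.
  Elements of \<open>L\<^sup>p\<close> are classes, hence \<open>X\<^sub>k = f (\<epsilon>\<^sub>k, \<epsilon>\<^bsub>k-1\<^esub>, \<dots>)\<close> is only required almost surely.\<close>

definition Lp_m_approximable :: "'w measure \<Rightarrow> real \<Rightarrow> 's measure \<Rightarrow> ((nat \<Rightarrow> 's) \<Rightarrow> 'a)
    \<Rightarrow> (int \<Rightarrow> 'w \<Rightarrow> 's) \<Rightarrow> (nat \<Rightarrow> int \<Rightarrow> 'w \<Rightarrow> 's)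
    \<Rightarrow> (int \<Rightarrow> 'w \<Rightarrow> 'a::{real_inner, banach, second_countable_topology}) \<Rightarrow> bool" where
  "Lp_m_approximable M p S f \<epsilon> \<epsilon>' X \<longleftrightarrow>
     iid_process M S \<epsilon> \<and> independent_copies M S \<epsilon> \<epsilon>' \<and>
     f \<in> borel_measurable (PiM UNIV (\<lambda>_. S)) \<and>
     (\<forall>k. in_Lp M p (X k) \<and> (AE \<omega> in M. X k \<omega> = f (\<lambda>j. \<epsilon> (k - int j) \<omega>))) \<and>
     (\<Sum>\<^sub>\<infinity>m\<in>{1..}. nu M p (\<lambda>\<omega>. X (int m) \<omega> - coupled f \<epsilon> \<epsilon>' (int m) m \<omega>)) < \<top>"


section \<open>Lagged covariance operators of the stacked process\<close>

instance vec :: ("{metric_space, second_countable_topology}", finite) second_countable_topology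
proof
  obtain B :: "'a set set" where B: "countable B" "topological_basis B"
    using ex_countable_basis by blast
  define C where
    "C = (\<lambda>F. {x :: ('a, 'b) vec. \<forall>i. x $ i \<in> F i}) ` (PiE (UNIV :: 'b set) (\<lambda>_. B))"
  have "countable C"
    unfolding C_def using B(1) by (intro countable_image countable_PiE) auto
  moreover have "topological_basis C"
  proof (rule topological_basisI)
    fix U assume "U \<in> C"
    then show "open U"
      unfolding C_def using B(2) by (auto intro!: open_vector_box topological_basis_open)
  next
    fix U :: "('a, 'b) vec set" and x assume U: "open U" "x \<in> U"
    then obtain A where A: "\<And>i. open (A i) \<and> x $ i \<in> A i"
      and AU: "\<And>y. (\<forall>i. y $ i \<in> A i) \<Longrightarrow> y \<in> U"
      unfolding open_vec_def by metis
    have "\<exists>b\<in>B. x $ i \<in> b \<and> b \<subseteq> A i" for i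
      using A[of i] topological_basisE[OF B(2)] by metis
    then obtain F where F: "\<And>i. F i \<in> B \<and> x $ i \<in> F i \<and> F i \<subseteq> A i"
      by metis
    define V where "V = {y :: ('a, 'b) vec. \<forall>i. y $ i \<in> F i}"
    have "V \<in> C"
      unfolding V_def C_def using F by (intro imageI) auto
    moreover have "x \<in> V"
      unfolding V_def using F by blast
    moreover have "V \<subseteq> U"
      unfolding V_def using F AU by blast
    ultimately show "\<exists>V\<in>C. x \<in> V \<and> V \<subseteq> U"
      by (intro bexI[of _ V] conjI)
  qed
  ultimately show "\<exists>B :: ('a, 'b) vec set set. countable B \<and> open = generate_topology B"
    by (intro exI[of _ C] conjI topological_basis_imp_subbasis)
qed

text \<open>The power \<open>\<H>\<^sup>m\<close> is \<^typ>\<open>('a, 'n) vec\<close> with \<open>m = CARD('n)\<close>. The linear order on the index type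
  numbers the components: the one at index \<open>i\<close> has position \<open>card {j. j < i} \<in> {0, \<dots>, m - 1}\<close>.\<close>

definition stacked :: "(int \<Rightarrow> 'w \<Rightarrow> 'a) \<Rightarrow> int \<Rightarrow> 'w \<Rightarrow> ('a, 'n::{finite, linorder}) vec" where
  "stacked X k \<omega> = (\<chi> i. X (k - int (card {j. j < i})) \<omega>)"

definition lag_cov :: "'w measure
    \<Rightarrow> (int \<Rightarrow> 'w \<Rightarrow> 'a::{real_inner, banach, second_countable_topology}) \<Rightarrow> int
    \<Rightarrow> ('a, 'n::{finite, linorder}) vec \<Rightarrow>\<^sub>L ('a, 'n) vec" where
  "lag_cov M X h = cross_cov M (stacked X 0) (stacked X h)"

definition lag_cov_est :: "(int \<Rightarrow> 'w \<Rightarrow> 'a::{real_inner, banach, second_countable_topology})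
    \<Rightarrow> nat \<Rightarrow> int \<Rightarrow> 'w \<Rightarrow> ('a, 'n::{finite, linorder}) vec \<Rightarrow>\<^sub>L ('a, 'n) vec" where
  "lag_cov_est X N h \<omega> =
     (let m = int CARD('n) in
      (1 / real_of_int (int N - \<bar>h\<bar> - m + 1)) *\<^sub>R
        (\<Sum>k\<in>{max m (m - h)..min (int N) (int N - h)}.
           tensor_op (stacked X k \<omega>) (stacked X (k + h) \<omega>)))"

definition kappa' :: "int \<Rightarrow> nat \<Rightarrow> nat" where
  "kappa' h m = nat (max 1 (int m + \<bar>h\<bar> - 1))"

definition tau :: "'w measure \<Rightarrow> ((nat \<Rightarrow> 's) \<Rightarrow> 'a) \<Rightarrow> (int \<Rightarrow> 'w \<Rightarrow> 's)
    \<Rightarrow> (nat \<Rightarrow> int \<Rightarrow> 'w \<Rightarrow> 's) \<Rightarrow> (int \<Rightarrow> 'w \<Rightarrow> 'a::real_normed_vector) \<Rightarrow> int \<Rightarrow> nat \<Rightarrow> ennreal" where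
  "tau M f \<epsilon> \<epsilon>' X h m =
     nu M 4 (X 1) ^ 4 +
     ennreal (4 / (2 * real (kappa' h m) - 1)) * nu M 4 (X 1) ^ 3 *
       (\<Sum>\<^sub>\<infinity>k\<in>{kappa' h m..}. nu M 4 (\<lambda>\<omega>. X (int k) \<omega> - coupled f \<epsilon> \<epsilon>' (int k) k \<omega>))"

end

theory Submission
  imports Defs "HOL-Probability.Probability"
begin

text \<open>
  Rescale so that \<open>\<nu>\<^sub>4(X\<^sub>1) = 1\<close>, write \<open>\<kappa>\<close> for \<open>\<kappa>'\<close>, \<open>n\<close> for the number of summands of the estimator
  and \<open>\<delta>\<^sub>k\<close> for \<open>\<nu>\<^sub>4(X\<^sub>k - X\<^sub>k\<^bsup>(k)\<^esup>)\<close>. An operator on \<open>\<H>\<^sup>m\<close> consists of \<open>m\<^sup>2\<close> blocks, and its squared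
  Hilbert-Schmidt norm is the sum of those of the blocks. Each block of the estimation error is, up to
  taking adjoints, the mean of \<open>n\<close> consecutive terms of the stationary sequence
  \<open>P\<^sub>t = X\<^sub>t \<otimes> X\<^bsub>t+d\<^esub> - E[X\<^sub>t \<otimes> X\<^bsub>t+d\<^esub>]\<close> for some lag \<open>0 \<le> d \<le> \<kappa>\<close>. With
  \<open>c\<^sub>j = E\<langle>P\<^sub>0, P\<^sub>j\<rangle>\<close> and \<open>c'\<^sub>j = (1 - j/n) c\<^sub>j\<close> for \<open>j < n\<close>, its second moment is
  \<open>(c\<^sub>0 + 2 \<Sum>\<^sub>j c'\<^sub>j) / n\<close>, and the theorem says that
  \<open>c\<^sub>0 + 2 \<Sum>\<^bsub>1\<le>j<n\<^esub> c'\<^sub>j \<le> 2\<kappa> - 1 + 4 \<Sum>\<^bsub>k\<ge>\<kappa>\<^esub> \<delta>\<^sub>k\<close>.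
  The lags below \<open>\<kappa>\<close> contribute at most \<open>2\<kappa> - 1\<close> because \<open>c\<^sub>j \<le> 1\<close>. For \<open>j \<ge> \<kappa>\<close> one would like
  \<open>c\<^sub>j \<le> 2 \<delta>\<^sub>j\<close>, but \<open>P\<^sub>j\<close> contains \<open>X\<^sub>j\<close> besides \<open>X\<^bsub>j+d\<^esub>\<close>, and coupling only makes \<open>X\<^sub>j\<close> independent of
  \<open>P\<^sub>0\<close> up to \<open>\<delta>\<^bsub>j-d\<^esub>\<close>. The sum over all lags is nevertheless within the bound, for three reasons.

  \<^item> \<^emph>\<open>Conditional expectations are better than couplings.\<close> Let \<open>D2\<^sub>j\<close> and \<open>D4\<^sub>j\<close> be the second and fourth
    moment norms of \<open>X\<close> minus its conditional expectation given its \<open>j\<close> latest innovations. Then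
    \<open>D4\<^sub>j + D2\<^sub>j \<le> \<surd>2 \<delta>\<^sub>j\<close> (\<open>D4_D2_delta\<close>). Replacing \<open>X\<^bsub>j+d\<^esub>\<close> by a function \<open>y\<close> of the innovations after
    time \<open>d\<close> costs \<open>D4\<^sub>j\<close>. In what remains only the interaction part of \<open>X\<^sub>j\<close> survives, that
    is, \<open>X\<^sub>j\<close> minus its conditional expectations given the innovations up to \<open>d\<close> and given those after
    \<open>d\<close>. Since \<open>P\<^sub>0\<close> and \<open>y\<close> are independent, the expectation of the product is at
    most the product of three \<open>L\<^sup>2\<close> norms. This gives \<open>cov_bound\<close>, and the same idea applied to \<open>P\<^sub>0\<close> itself
    bounds one of the factors (\<open>pp_bound\<close>).

  \<^item> \<^emph>\<open>Autocovariances are positive definite.\<close> If \<open>c'\<^sub>k\<close> is small for a lag \<open>k\<close> with \<open>\<kappa> \<le> k < 2\<kappa> - 1\<close>, then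
    \<open>c'\<^sub>i\<close> and \<open>c'\<^bsub>k-i\<^esub>\<close> cannot both be close to \<open>1\<close> for \<open>i\<close> near \<open>k/2\<close> (\<open>wcov_triangle\<close>). Hence the estimate
    \<open>2\<kappa> - 1\<close> for the lags below \<open>\<kappa>\<close> is wasteful by \<open>\<Sum>\<^sub>k (34/105 - 12/35 c'\<^sub>k)\<close> at least (\<open>savings\<close>).

  \<^item> \<^emph>\<open>Lags can pay for each other.\<close> Adding these savings to the bounds above leaves a real inequality
    for each lag. It needs \<open>34/105\<close> for most lags below \<open>\<kappa> + d\<close>, but \<open>68/105\<close> for those above \<open>2d\<close>; these are
    compensated by the lags between \<open>\<kappa> + d\<close> and \<open>2\<kappa> - 2\<close>, of which there are as many and which
    need nothing. A lag \<open>k \<ge> \<kappa> + d\<close> has to pay for a multiple of \<open>D2\<^bsub>k-d\<^esub>\<close>, which lag \<open>k - d\<close> has set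
    aside (\<open>lag_sum\<close>). For \<open>d = \<kappa>\<close> only the lags \<open>\<kappa>\<close> and \<open>2\<kappa> - 1\<close> are special.

  The innovations are realised as the coordinates of a product space, on which a conditional expectation
  is an integral over resampled coordinates. The given process is carried there by the law of its
  innovations.
\<close>


section \<open>Functions of the innovations\<close>

text \<open>A new sequence of innovations that agrees with \<open>x\<close> at the times in
  \<open>A\<close> and is taken from \<open>y\<close>, in the integrals below an independent copy, at the
  other times.\<close>

definition splice :: "int set \<Rightarrow> (int \<Rightarrow> 's) \<Rightarrow> (int \<Rightarrow> 's) \<Rightarrow> int \<Rightarrow> 's" where
  "splice A x y = (\<lambda>k. if k \<in> A then x k else y k)"

lemma splice_splice: "splice B (splice A x y) z = splice (A \<inter> B) x (splice B y z)"
  by (auto simp: splice_def fun_eq_iff)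

text \<open>Measurability with respect to the innovations at the times in \<open>A\<close>, in a form
  without null sets.\<close>

definition dep_on :: "int set \<Rightarrow> ((int \<Rightarrow> 's) \<Rightarrow> 'b) \<Rightarrow> bool" where
  "dep_on A F \<longleftrightarrow> (\<forall>x y. F (splice A x y) = F x)"

lemma dep_onD: "dep_on A F \<Longrightarrow> F (splice A x y) = F x"
  by (simp add: dep_on_def)

lemma dep_on_eqI: "dep_on A F \<Longrightarrow> (\<And>k. k \<in> A \<Longrightarrow> x k = y k) \<Longrightarrow> F x = F y"
proof -
  assume F: "dep_on A F" and eq: "\<And>k. k \<in> A \<Longrightarrow> x k = y k"
  have "splice A x y = y" using eq by (auto simp: splice_def)
  then show "F x = F y" using dep_onD[OF F, of x y] by simp
qed

lemma dep_on_mono: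
  assumes F: "dep_on A F" and "A \<subseteq> B" shows "dep_on B F"
  unfolding dep_on_def
proof (intro allI)
  fix x y show "F (splice B x y) = F x"
    by (rule dep_on_eqI[OF F]) (use \<open>A \<subseteq> B\<close> in \<open>auto simp: splice_def\<close>)
qed

lemma dep_on_comp2: "dep_on A F \<Longrightarrow> dep_on A G \<Longrightarrow> dep_on A (\<lambda>x. h (F x) (G x))"
  by (simp add: dep_on_def)

lemma dep_on_comp: "dep_on A F \<Longrightarrow> dep_on A (\<lambda>x. h (F x))"
  by (simp add: dep_on_def)

lemma dep_on_const: "dep_on A (\<lambda>x. c)"
  by (simp add: dep_on_def)

lemma dep_on_sum:
  assumes "\<And>i. i \<in> S \<Longrightarrow> dep_on A (F i)"
  shows "dep_on A (\<lambda>x. \<Sum>i\<in>S. F i x)"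
  unfolding dep_on_def using assms by (intro allI sum.cong refl dep_onD)

section \<open>Moments\<close>

lemma integral_Cauchy_Schwarz:
  fixes f g :: "'a \<Rightarrow> real"
  assumes [measurable]: "f \<in> borel_measurable M" "g \<in> borel_measurable M"
    and f: "integrable M (\<lambda>x. (f x)\<^sup>2)" and g: "integrable M (\<lambda>x. (g x)\<^sup>2)"
  shows "integrable M (\<lambda>x. f x * g x)"
    and "(\<integral>x. abs (f x * g x) \<partial>M) \<le> sqrt (\<integral>x. (f x)\<^sup>2 \<partial>M) * sqrt (\<integral>x. (g x)\<^sup>2 \<partial>M)"
proof -
  show i: "integrable M (\<lambda>x. f x * g x)"
  proof (rule Bochner_Integration.integrable_bound[of M "\<lambda>x. (f x)\<^sup>2 + (g x)\<^sup>2"])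
    show "AE x in M. norm (f x * g x) \<le> norm ((f x)\<^sup>2 + (g x)\<^sup>2)"
    proof (rule AE_I2)
      fix x
      have "2 * \<bar>f x\<bar> * \<bar>g x\<bar> \<le> (f x)\<^sup>2 + (g x)\<^sup>2"
        using sum_squares_bound[of "\<bar>f x\<bar>" "\<bar>g x\<bar>"] by simp
      moreover have "0 \<le> \<bar>f x\<bar> * \<bar>g x\<bar>" by simp
      ultimately show "norm (f x * g x) \<le> norm ((f x)\<^sup>2 + (g x)\<^sup>2)"
        unfolding real_norm_def abs_mult by linarith
    qed
  qed (use f g in auto)
  have "(ennreal (\<integral>x. abs (f x * g x) \<partial>M))\<^sup>2 = (\<integral>\<^sup>+x. ennreal (abs (f x)) * ennreal (abs (g x)) \<partial>M)\<^sup>2"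
    using integrable_abs[OF i] by (simp add: nn_integral_eq_integral abs_mult flip: ennreal_mult)
  also have "\<dots> \<le> (\<integral>\<^sup>+x. (ennreal (abs (f x)))\<^sup>2 \<partial>M) * (\<integral>\<^sup>+x. (ennreal (abs (g x)))\<^sup>2 \<partial>M)"
    by (rule Cauchy_Schwarz_nn_integral) auto
  also have "\<dots> = (\<integral>\<^sup>+x. ennreal ((f x)\<^sup>2) \<partial>M) * (\<integral>\<^sup>+x. ennreal ((g x)\<^sup>2) \<partial>M)"
    by (simp add: ennreal_power)
  also have "\<dots> = ennreal ((\<integral>x. (f x)\<^sup>2 \<partial>M) * (\<integral>x. (g x)\<^sup>2 \<partial>M))"
    using f g by (simp add: nn_integral_eq_integral ennreal_mult)
  finally have "(\<integral>x. abs (f x * g x) \<partial>M)\<^sup>2 \<le> (\<integral>x. (f x)\<^sup>2 \<partial>M) * (\<integral>x. (g x)\<^sup>2 \<partial>M)"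
    by (simp add: ennreal_power)
  from real_le_rsqrt[OF this]
  show "(\<integral>x. abs (f x * g x) \<partial>M) \<le> sqrt (\<integral>x. (f x)\<^sup>2 \<partial>M) * sqrt (\<integral>x. (g x)\<^sup>2 \<partial>M)"
    unfolding real_sqrt_mult .
qed

lemma integral_square_le:
  fixes f :: "'a \<Rightarrow> real"
  assumes "prob_space M" "f \<in> borel_measurable M" "integrable M (\<lambda>x. (f x)\<^sup>2)"
  shows "integrable M f" "(\<integral>x. f x \<partial>M)\<^sup>2 \<le> (\<integral>x. (f x)\<^sup>2 \<partial>M)"
proof -
  interpret prob_space M by fact
  have "integrable M (\<lambda>x. f x * 1)"
    by (rule integral_Cauchy_Schwarz) (use assms in auto)
  then show i: "integrable M f" by simp
  have "0 \<le> (\<integral>x. (f x - (\<integral>x. f x \<partial>M))\<^sup>2 \<partial>M)" by simp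
  also have "\<dots> = (\<integral>x. (f x)\<^sup>2 - 2 * (\<integral>x. f x \<partial>M) * f x + (\<integral>x. f x \<partial>M)\<^sup>2 \<partial>M)"
    by (intro Bochner_Integration.integral_cong) (auto simp: power2_eq_square algebra_simps)
  also have "\<dots> = (\<integral>x. (f x)\<^sup>2 \<partial>M) - (\<integral>x. f x \<partial>M)\<^sup>2"
    using i assms by (simp add: prob_space power2_eq_square)
  finally show "(\<integral>x. f x \<partial>M)\<^sup>2 \<le> (\<integral>x. (f x)\<^sup>2 \<partial>M)" by simp
qed

definition Lk :: "nat \<Rightarrow> 'a measure \<Rightarrow> ('a \<Rightarrow> 'b::real_normed_vector) \<Rightarrow> bool" where
  "Lk k M F \<longleftrightarrow> F \<in> borel_measurable M \<and> integrable M (\<lambda>x. norm (F x) ^ k)"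

lemma norm_add_pow2: fixes a b :: "'b::real_normed_vector"
  shows "norm (a + b) ^ 2 \<le> 2 * norm a ^ 2 + 2 * norm b ^ 2"
proof -
  have "norm (a + b) ^ 2 \<le> (norm a + norm b)^2"
    by (intro power_mono norm_triangle_ineq) auto
  also have "\<dots> \<le> 2 * norm a ^ 2 + 2 * norm b ^ 2"
    using sum_squares_bound[of "norm a" "norm b"] by (simp add: power2_sum)
  finally show ?thesis .
qed

lemma norm_add_pow4: fixes a b :: "'b::real_normed_vector"
  shows "norm (a + b) ^ 4 \<le> 8 * norm a ^ 4 + 8 * norm b ^ 4"
proof -
  have "norm (a + b) ^ 4 = (norm (a+b)^2)^2" by (simp flip: power_mult)
  also have "\<dots> \<le> (2 * norm a ^ 2 + 2 * norm b ^ 2)^2"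
    by (intro power_mono norm_add_pow2) auto
  also have "\<dots> \<le> 2 * (2 * norm a ^ 2)^2 + 2 * (2 * norm b ^ 2)^2"
    using norm_add_pow2[of "2 * norm a ^ 2" "2 * norm b ^ 2"] by simp
  also have "\<dots> = 8 * norm a ^ 4 + 8 * norm b ^ 4"
    by (simp add: power_mult_distrib flip: power_mult)
  finally show ?thesis .
qed

lemma L2_add:
  fixes F G :: "'a \<Rightarrow> 'b::{real_normed_vector, second_countable_topology}"
  assumes "Lk 2 M F" "Lk 2 M G" shows "Lk 2 M (\<lambda>x. F x + G x)"
  unfolding Lk_def
proof
  show m: "(\<lambda>x. F x + G x) \<in> borel_measurable M" using assms by (auto simp: Lk_def)
  show "integrable M (\<lambda>x. norm (F x + G x) ^ 2)"
  proof (rule Bochner_Integration.integrable_bound)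
    show "integrable M (\<lambda>x. 2 * norm (F x)^2 + 2 * norm (G x)^2)"
      using assms by (auto simp: Lk_def)
    show "(\<lambda>x. norm (F x + G x) ^ 2) \<in> borel_measurable M" using m by measurable
    show "AE x in M. norm (norm (F x + G x) ^ 2) \<le> norm (2 * norm (F x)^2 + 2 * norm (G x)^2)"
      by (rule AE_I2) (simp add: norm_add_pow2)
  qed
qed

lemma L4_add:
  fixes F G :: "'a \<Rightarrow> 'b::{real_normed_vector, second_countable_topology}"
  assumes "Lk 4 M F" "Lk 4 M G" shows "Lk 4 M (\<lambda>x. F x + G x)"
  unfolding Lk_def
proof
  show m: "(\<lambda>x. F x + G x) \<in> borel_measurable M" using assms by (auto simp: Lk_def)
  show "integrable M (\<lambda>x. norm (F x + G x) ^ 4)"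
  proof (rule Bochner_Integration.integrable_bound)
    show "integrable M (\<lambda>x. 8 * norm (F x)^4 + 8 * norm (G x)^4)"
      using assms by (auto simp: Lk_def)
    show "(\<lambda>x. norm (F x + G x) ^ 4) \<in> borel_measurable M" using m by measurable
    show "AE x in M. norm (norm (F x + G x) ^ 4) \<le> norm (8 * norm (F x)^4 + 8 * norm (G x)^4)"
      by (rule AE_I2) (simp add: norm_add_pow4)
  qed
qed

lemma Lk_uminus: "Lk k M F \<Longrightarrow> Lk k M (\<lambda>x. - F x)"
  for F :: "'a \<Rightarrow> 'b::{real_normed_vector, second_countable_topology}"
  by (auto simp: Lk_def)

lemma L2_diff: "Lk 2 M F \<Longrightarrow> Lk 2 M G \<Longrightarrow> Lk 2 M (\<lambda>x. F x - G x)"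
  for F :: "'a \<Rightarrow> 'b::{real_normed_vector, second_countable_topology}"
  using L2_add[OF _ Lk_uminus, of M F G] by simp

lemma L4_diff: "Lk 4 M F \<Longrightarrow> Lk 4 M G \<Longrightarrow> Lk 4 M (\<lambda>x. F x - G x)"
  for F :: "'a \<Rightarrow> 'b::{real_normed_vector, second_countable_topology}"
  using L4_add[OF _ Lk_uminus, of M F G] by simp

lemma L4_L2: assumes "finite_measure M" "Lk 4 M F" shows "Lk 2 M F"
  unfolding Lk_def
proof
  interpret finite_measure M by fact
  show m: "F \<in> borel_measurable M" using assms by (auto simp: Lk_def)
  show "integrable M (\<lambda>x. norm (F x) ^ 2)"
  proof (rule Bochner_Integration.integrable_bound[of M "\<lambda>x. norm (F x)^4 + 1"])
    have "t ^ 2 \<le> t ^ 4 + 1" for t :: real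
    proof -
      have "2 * t^2 \<le> t^4 + 1" using sum_squares_bound[of "t^2" 1] by (simp flip: power_mult)
      then show ?thesis using zero_le_power2[of t] by linarith
    qed
    then show "AE x in M. norm (norm (F x) ^ 2) \<le> norm (norm (F x)^4 + 1)" by auto
  qed (use assms m in \<open>auto simp: Lk_def\<close>)
qed

lemma L2_integrable:
  fixes F :: "'a \<Rightarrow> 'b::{banach, second_countable_topology}"
  assumes "finite_measure M" "Lk 2 M F" shows "integrable M F"
proof -
  interpret finite_measure M by fact
  have m: "F \<in> borel_measurable M" using assms by (auto simp: Lk_def)
  show ?thesis
  proof (rule Bochner_Integration.integrable_bound[of M "\<lambda>x. norm (F x)^2 + 1"])
    have "\<bar>t\<bar> \<le> t ^ 2 + 1" for t :: real
    proof -
      have "2 * \<bar>t\<bar> \<le> t^2 + 1" using sum_squares_bound[of "\<bar>t\<bar>" 1] by simp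
      then show ?thesis by linarith
    qed
    from this[of "norm (F _)"] show "AE x in M. norm (F x) \<le> norm (norm (F x)^2 + 1)"
      by auto
  qed (use assms m in \<open>auto simp: Lk_def\<close>)
qed

lemma Lk_const: "finite_measure M \<Longrightarrow> Lk k M (\<lambda>x. c)"
  by (simp add: Lk_def finite_measure.integrable_const)

lemma L4_mult_L2:
  fixes f g :: "'a \<Rightarrow> real"
  assumes "Lk 4 M f" "Lk 4 M g" shows "Lk 2 M (\<lambda>x. f x * g x)"
proof -
  have "integrable M (\<lambda>x. (f x)\<^sup>2 * (g x)\<^sup>2)"
    by (rule integral_Cauchy_Schwarz) (use assms in \<open>auto simp: Lk_def simp flip: power_mult\<close>)
  then show ?thesis
    using assms by (auto simp: Lk_def power_mult_distrib)
qed

lemma Lk_norm: "Lk k M F \<Longrightarrow> Lk k M (\<lambda>x. norm (F x))"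
  by (auto simp: Lk_def)

lemma L4_scaleR_L2:
  fixes F :: "'a \<Rightarrow> 'b::{real_normed_vector, second_countable_topology}"
  assumes "Lk 4 M f" "Lk 4 M F" shows "Lk 2 M (\<lambda>x. f x *\<^sub>R F x)"
  using L4_mult_L2[OF Lk_norm[OF assms(1)] Lk_norm[OF assms(2)]] assms
  by (auto simp: Lk_def power_mult_distrib)

lemma L2_mult_integrable:
  fixes f g :: "'a \<Rightarrow> real"
  assumes "Lk 2 M f" "Lk 2 M g" shows "integrable M (\<lambda>x. f x * g x)"
  by (rule integral_Cauchy_Schwarz) (use assms in \<open>auto simp: Lk_def\<close>)

lemma L2_inner_integrable:
  fixes F G :: "'a \<Rightarrow> 'b::{real_inner, second_countable_topology}"
  assumes "Lk 2 M F" "Lk 2 M G" shows "integrable M (\<lambda>x. F x \<bullet> G x)"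
  by (rule Bochner_Integration.integrable_bound[OF L2_mult_integrable[OF Lk_norm[OF assms(1)] Lk_norm[OF assms(2)]]])
    (use assms Cauchy_Schwarz_ineq2 in \<open>auto simp: Lk_def\<close>)

text \<open>The norm of \<open>L\<^sup>2\<close>; it is meaningful only together with \<open>Lk 2 M
  F\<close>.\<close>

definition nrm2 :: "'a measure \<Rightarrow> ('a \<Rightarrow> 'b::real_normed_vector) \<Rightarrow> real" where
  "nrm2 M F = sqrt (\<integral>x. norm (F x) ^ 2 \<partial>M)"

lemma nrm2_nonneg: "0 \<le> nrm2 M F" by (simp add: nrm2_def)
lemma nrm2_sq: "(nrm2 M F)\<^sup>2 = (\<integral>x. norm (F x) ^ 2 \<partial>M)" by (simp add: nrm2_def)

lemma CS_bound:
  fixes f :: "'a \<Rightarrow> real"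
  assumes "Lk 2 M g" "Lk 2 M h" "f \<in> borel_measurable M" "\<And>x. \<bar>f x\<bar> \<le> \<bar>g x\<bar> * \<bar>h x\<bar>"
  shows "integrable M f" "(\<integral>x. f x \<partial>M) \<le> nrm2 M g * nrm2 M (h :: _ \<Rightarrow> real)"
proof -
  have i: "integrable M (\<lambda>x. g x * h x)" by (rule L2_mult_integrable) fact+
  show i': "integrable M f"
    by (rule Bochner_Integration.integrable_bound[OF i]) (use assms in \<open>auto simp: abs_mult\<close>)
  have "(\<integral>x. f x \<partial>M) \<le> (\<integral>x. abs (g x * h x) \<partial>M)"
    using i' integrable_abs[OF i] assms(4)
    by (intro integral_mono) (auto simp: abs_mult intro: order_trans[OF abs_ge_self])
  also have "\<dots> \<le> nrm2 M g * nrm2 M h"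
    using integral_Cauchy_Schwarz(2)[of g M h] assms by (auto simp: Lk_def nrm2_def)
  finally show "(\<integral>x. f x \<partial>M) \<le> nrm2 M g * nrm2 M h" .
qed

section \<open>Independent innovations and resampling\<close>

locale iid_space =
  fixes D :: "'s measure"
  assumes prob_D: "prob_space D"
begin

definition Om :: "(int \<Rightarrow> 's) measure" where "Om = PiM UNIV (\<lambda>_. D)"

sublocale Om: prob_space Om
  unfolding Om_def by (intro prob_space_PiM prob_D)

abbreviation expectation :: "((int \<Rightarrow> 's) \<Rightarrow> 'b::{banach, second_countable_topology}) \<Rightarrow> 'b"
    (binder \<open>\<E>\<close> 10) where
  "expectation F \<equiv> integral\<^sup>L Om F"

sublocale OO: pair_sigma_finite Om Om
  by unfold_locales

lemma space_Om: "space Om = (\<Pi>\<^sub>E i\<in>UNIV. space D)"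
  by (simp add: Om_def space_PiM)

lemma splice_measurable [measurable]:
  "(\<lambda>p. splice A (fst p) (snd p)) \<in> Om \<Otimes>\<^sub>M Om \<rightarrow>\<^sub>M Om"
  unfolding Om_def splice_def
proof (rule measurable_PiM_single')
  show "(\<lambda>p k. if k \<in> A then fst p k else snd p k) \<in>
      space (PiM UNIV (\<lambda>_. D) \<Otimes>\<^sub>M PiM UNIV (\<lambda>_. D)) \<rightarrow> (\<Pi>\<^sub>E i\<in>UNIV. space D)"
    by (auto simp: space_pair_measure space_PiM PiE_def Pi_def)
  fix k :: int
  show "(\<lambda>p. if k \<in> A then fst p k else snd p k) \<in>
      PiM UNIV (\<lambda>_. D) \<Otimes>\<^sub>M PiM UNIV (\<lambda>_. D) \<rightarrow>\<^sub>M D"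
    by (cases "k \<in> A") (simp_all, measurable)
qed

lemma splice_measurable' [measurable]: "x \<in> space Om \<Longrightarrow> (\<lambda>y. splice A x y) \<in> Om \<rightarrow>\<^sub>M Om"
  using measurable_compose[OF measurable_Pair1'[of x Om Om] splice_measurable[of A]] by simp

text \<open>Resampling some coordinates of an i.i.d. sequence does not change its law. All properties of
  conditional expectations below are consequences of this and of Fubini's theorem.\<close>

lemma distr_splice: "distr (Om \<Otimes>\<^sub>M Om) Om (\<lambda>p. splice A (fst p) (snd p)) = Om"
proof -
  interpret D: prob_space D by (rule prob_D)
  let ?s = "\<lambda>p. splice A (fst p) (snd p) :: int \<Rightarrow> 's"
  have "Om = distr (Om \<Otimes>\<^sub>M Om) Om ?s"
    unfolding Om_def
  proof (rule measure_eqI_PiM_infinite)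
    fix J :: "int set" and E assume J: "finite J" and E: "\<And>i. i \<in> J \<Longrightarrow> E i \<in> sets D"
    let ?emb = "\<lambda>J. prod_emb UNIV (\<lambda>_. D) J (Pi\<^sub>E J E)"
    have emb: "?emb J = {x \<in> space Om. \<forall>i\<in>J. x i \<in> E i}" for J
      by (auto simp: prod_emb_def Om_def space_PiM PiE_iff)
    have sets: "?emb J' \<in> sets Om" if "J' \<subseteq> J" for J'
      unfolding Om_def using J E that by (intro sets_PiM_I) (auto dest: finite_subset)
    have "emeasure (distr (Om \<Otimes>\<^sub>M Om) Om ?s) (?emb J)
        = emeasure (Om \<Otimes>\<^sub>M Om) (?s -` ?emb J \<inter> space (Om \<Otimes>\<^sub>M Om))"
      using sets[of J] by (intro emeasure_distr) auto
    also have "?s -` ?emb J \<inter> space (Om \<Otimes>\<^sub>M Om) = ?emb (J \<inter> A) \<times> ?emb (J - A)"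
      unfolding emb by (auto simp: splice_def space_pair_measure space_Om PiE_iff split: if_splits)
    also have "emeasure (Om \<Otimes>\<^sub>M Om) \<dots> = emeasure Om (?emb (J \<inter> A)) * emeasure Om (?emb (J - A))"
      by (intro Om.emeasure_pair_measure_Times sets) auto
    also have "\<dots> = (\<Prod>i\<in>J \<inter> A. emeasure D (E i)) * (\<Prod>i\<in>J - A. emeasure D (E i))"
      unfolding Om_def using J E by (subst (1 2) emeasure_PiM_emb) (auto simp: prob_D)
    also have "\<dots> = (\<Prod>i\<in>J. emeasure D (E i))"
      using J by (subst prod.union_disjoint[symmetric]) (auto intro!: prod.cong)
    also have "\<dots> = emeasure Om (?emb J)"
      unfolding Om_def using J E by (subst emeasure_PiM_emb) (auto simp: prob_D)
    finally show "emeasure (PiM UNIV (\<lambda>_. D)) (?emb J) =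
        emeasure (distr (PiM UNIV (\<lambda>_. D) \<Otimes>\<^sub>M PiM UNIV (\<lambda>_. D)) (PiM UNIV (\<lambda>_. D)) ?s) (?emb J)"
      by (simp add: Om_def)
  next
    show "finite_measure (PiM UNIV (\<lambda>_::int. D))"
      using Om.finite_measure_axioms by (simp add: Om_def)
  qed (simp_all add: Om_def)
  then show ?thesis by simp
qed

lemma integrable_splice:
  fixes F :: "(int \<Rightarrow> 's) \<Rightarrow> 'b::{banach, second_countable_topology}"
  assumes "integrable Om F"
  shows "integrable (Om \<Otimes>\<^sub>M Om) (\<lambda>p. F (splice A (fst p) (snd p)))"
    and "(\<integral>p. F (splice A (fst p) (snd p)) \<partial>(Om \<Otimes>\<^sub>M Om)) = integral\<^sup>L Om F"
proof -
  have m: "F \<in> borel_measurable Om" using assms by simp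
  have *: "integrable (distr (Om \<Otimes>\<^sub>M Om) Om (\<lambda>p. splice A (fst p) (snd p))) F"
    using assms by (simp only: distr_splice)
  show "integrable (Om \<Otimes>\<^sub>M Om) (\<lambda>p. F (splice A (fst p) (snd p)))"
    using integrable_distr[OF splice_measurable *] .
  show "(\<integral>p. F (splice A (fst p) (snd p)) \<partial>(Om \<Otimes>\<^sub>M Om)) = integral\<^sup>L Om F"
    using integral_distr[OF splice_measurable m, of A] by (simp only: distr_splice)
qed

lemma AE_integrable_splice:
  fixes F :: "(int \<Rightarrow> 's) \<Rightarrow> 'b::{banach, second_countable_topology}"
  assumes "integrable Om F"
  shows "AE x in Om. integrable Om (\<lambda>y. F (splice A x y))"
  using OO.AE_integrable_fst'[OF integrable_splice(1)[OF assms, of A]] by simp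

text \<open>The conditional expectation of \<open>F\<close> given the innovations at the times in
  \<open>A\<close>. As a concrete function of these innovations it depends on nothing else
  everywhere, not just almost everywhere.\<close>

definition ce :: "int set \<Rightarrow> ((int \<Rightarrow> 's) \<Rightarrow> 'b::{banach, second_countable_topology})
    \<Rightarrow> (int \<Rightarrow> 's) \<Rightarrow> 'b" where
  "ce A F x = (\<E> y. F (splice A x y))"

lemma ce_measurable [measurable]:
  assumes [measurable]: "F \<in> borel_measurable Om" shows "ce A F \<in> borel_measurable Om"
proof -
  have "(\<lambda>p. F (splice A (fst p) (snd p))) \<in> borel_measurable (Om \<Otimes>\<^sub>M Om)"
    by measurable
  then have "(\<lambda>(x, y). F (splice A x y)) \<in> borel_measurable (Om \<Otimes>\<^sub>M Om)"
    by (simp add: case_prod_unfold)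
  from Om.borel_measurable_lebesgue_integral[OF this] show ?thesis
    by (simp add: ce_def[abs_def])
qed

lemma ce_integrable:
  assumes "integrable Om F"
  shows "integrable Om (ce A F)" and "integral\<^sup>L Om (ce A F) = integral\<^sup>L Om F"
proof -
  note i = integrable_splice[OF assms, of A]
  show "integrable Om (ce A F)"
    using OO.integrable_fst'[OF i(1)] by (simp add: ce_def[abs_def])
  show "integral\<^sup>L Om (ce A F) = integral\<^sup>L Om F"
    using OO.integral_fst'[OF i(1)] i(2) by (simp add: ce_def[abs_def])
qed

lemma dep_on_ce: "dep_on A (ce A F)"
proof -
  have "splice A (splice A x y) z = splice A x z" for x y z :: "int \<Rightarrow> 's"
    by (auto simp: splice_def)
  then show ?thesis by (simp add: dep_on_def ce_def)
qed

text \<open>The coordinates on which \<open>F\<close> does not depend need not be conditioned on.\<close>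

lemma ce_of_dep:
  assumes "dep_on B F" shows "ce A F = ce (A \<inter> B) F"
proof
  fix x show "ce A F x = ce (A \<inter> B) F x"
    unfolding ce_def
    by (intro Bochner_Integration.integral_cong refl dep_on_eqI[OF assms]) (auto simp: splice_def)
qed

lemma dep_on_ce_of_dep: "dep_on B F \<Longrightarrow> dep_on (A \<inter> B) (ce A F)"
  by (subst ce_of_dep) (auto intro: dep_on_ce)

lemma ce_empty: "ce {} F x = integral\<^sup>L Om F"
  by (simp add: ce_def splice_def)

lemma ce_disjoint: "dep_on B F \<Longrightarrow> A \<inter> B = {} \<Longrightarrow> ce A F x = integral\<^sup>L Om F"
  by (subst ce_of_dep) (auto simp: ce_empty)

lemma ce_diff:
  assumes "integrable Om F" "integrable Om G"
  shows "AE x in Om. ce A (\<lambda>x. F x - G x) x = ce A F x - ce A G x"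
  using AE_integrable_splice[OF assms(1), of A] AE_integrable_splice[OF assms(2), of A]
  by eventually_elim (simp add: ce_def)

text \<open>The tower property, for arbitrary sets of times because the innovations are independent:
  resampling outside of \<open>B\<close> and then outside of \<open>A\<close> is resampling outside
  of \<open>A \<inter> B\<close>.\<close>

lemma ce_ce:
  assumes F: "integrable Om F"
  shows "AE x in Om. ce A (ce B F) x = ce (A \<inter> B) F x"
  using AE_integrable_splice[OF F, of "A \<inter> B"]
proof eventually_elim
  fix x assume G: "integrable Om (\<lambda>w. F (splice (A \<inter> B) x w))"
  have "ce A (ce B F) x = (\<E> y. \<E> z. F (splice (A \<inter> B) x (splice B y z)))"
    by (simp add: ce_def splice_splice)
  also have "\<dots> = (\<integral>p. F (splice (A \<inter> B) x (splice B (fst p) (snd p))) \<partial>(Om \<Otimes>\<^sub>M Om))"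
    using OO.integral_fst'[OF integrable_splice(1)[OF G, of B]] by simp
  also have "\<dots> = (\<E> w. F (splice (A \<inter> B) x w))"
    by (rule integrable_splice(2)[OF G])
  finally show "ce A (ce B F) x = ce (A \<inter> B) F x" by (simp add: ce_def)
qed

text \<open>A factor that is known given the conditioning can be pulled out of the conditional
  expectation. The product is an arbitrary bounded bilinear map, so that the same lemma serves
  scalars and vectors.\<close>

lemma ce_module:
  fixes F :: "(int \<Rightarrow> 's) \<Rightarrow> 'b::{banach, second_countable_topology}"
    and pr :: "'c::real_normed_vector \<Rightarrow> 'b \<Rightarrow> 'd::{banach, second_countable_topology}"
  assumes pr: "bounded_bilinear pr" and g: "dep_on A g"
    and i: "integrable Om (\<lambda>x. pr (g x) (F x))" and F: "integrable Om F"
    and m': "(\<lambda>x. pr (g x) (ce A F x)) \<in> borel_measurable Om"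
  shows "AE x in Om. ce A (\<lambda>x. pr (g x) (F x)) x = pr (g x) (ce A F x)"
    and "(\<E> x. pr (g x) (F x)) = (\<E> x. pr (g x) (ce A F x))"
proof -
  show *: "AE x in Om. ce A (\<lambda>x. pr (g x) (F x)) x = pr (g x) (ce A F x)"
    using AE_integrable_splice[OF F, of A]
  proof eventually_elim
    fix x assume "integrable Om (\<lambda>y. F (splice A x y))"
    then show "ce A (\<lambda>x. pr (g x) (F x)) x = pr (g x) (ce A F x)"
      unfolding ce_def dep_onD[OF g]
      by (rule integral_bounded_linear[OF bounded_bilinear.bounded_linear_right[OF pr]])
  qed
  have m: "ce A (\<lambda>x. pr (g x) (F x)) \<in> borel_measurable Om"
    using i by (intro ce_measurable) simp
  have "(\<E> x. pr (g x) (F x)) = integral\<^sup>L Om (ce A (\<lambda>x. pr (g x) (F x)))"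
    using ce_integrable(2)[OF i] by simp
  also have "\<dots> = (\<E> x. pr (g x) (ce A F x))"
    by (rule integral_cong_AE[OF m m' *])
  finally show "(\<E> x. pr (g x) (F x)) = (\<E> x. pr (g x) (ce A F x))" .
qed

lemma indep_integral:
  fixes f g :: "(int \<Rightarrow> 's) \<Rightarrow> real"
  assumes f: "dep_on A f" "integrable Om f" and g: "dep_on B g" "integrable Om g" and AB: "A \<inter> B = {}"
  shows "integrable Om (\<lambda>x. f x * g x)"
    and "(\<E> x. f x * g x) = integral\<^sup>L Om f * integral\<^sup>L Om g"
proof -
  have [measurable]: "f \<in> borel_measurable Om" "g \<in> borel_measurable Om" using f g by auto
  have eq: "f (splice A x y) * g (splice A x y) = f x * g y" for x y
  proof -
    have "g (splice A x y) = g y" by (rule dep_on_eqI[OF g(1)]) (use AB in \<open>auto simp: splice_def\<close>)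
    then show ?thesis by (simp add: dep_onD[OF f(1)])
  qed
  have i: "integrable (Om \<Otimes>\<^sub>M Om) (\<lambda>p. f (fst p) * g (snd p))"
  proof (rule OO.Fubini_integrable)
    show "integrable Om (\<lambda>x. \<E> y. norm (f (fst (x, y)) * g (snd (x, y))))"
      using f(2) by (simp add: abs_mult)
    show "AE x in Om. integrable Om (\<lambda>y. f (fst (x, y)) * g (snd (x, y)))"
      using g(2) by simp
  qed measurable
  have "integrable (distr (Om \<Otimes>\<^sub>M Om) Om (\<lambda>p. splice A (fst p) (snd p))) (\<lambda>x. f x * g x)"
    by (subst integrable_distr_eq) (use i in \<open>auto simp: eq\<close>)
  then show fg: "integrable Om (\<lambda>x. f x * g x)" by (simp only: distr_splice)
  have "(\<E> x. f x * g x) = (\<integral>p. f (fst p) * g (snd p) \<partial>(Om \<Otimes>\<^sub>M Om))"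
    using integrable_splice(2)[OF fg, of A] by (simp add: eq)
  also have "\<dots> = (\<E> x. \<E> y. f x * g y)"
    using OO.integral_fst'[OF i] by simp
  finally show "(\<E> x. f x * g x) = integral\<^sup>L Om f * integral\<^sup>L Om g" by simp
qed

lemma ce_L2:
  assumes F: "Lk 2 Om F"
  shows "Lk 2 Om (ce A F)" and "nrm2 Om (ce A F) \<le> nrm2 Om F"
proof -
  have m: "F \<in> borel_measurable Om" and i: "integrable Om (\<lambda>x. norm (F x) ^ 2)"
    using F by (auto simp: Lk_def)
  have iF: "integrable Om F" by (rule L2_integrable[OF Om.finite_measure_axioms F])
  have le: "AE x in Om. norm (ce A F x) ^ 2 \<le> ce A (\<lambda>x. norm (F x) ^ 2) x"
    using AE_integrable_splice[OF i, of A] AE_integrable_splice[OF iF, of A]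
  proof eventually_elim
    fix x assume *: "integrable Om (\<lambda>y. norm (F (splice A x y)) ^ 2)" "integrable Om (\<lambda>y. F (splice A x y))"
    have "norm (ce A F x) ^ 2 \<le> (\<E> y. norm (F (splice A x y))) ^ 2"
      unfolding ce_def by (intro power_mono integral_norm_bound) auto
    also have "\<dots> \<le> (\<E> y. norm (F (splice A x y)) ^ 2)"
      by (rule integral_square_le) (use * Om.prob_space_axioms in auto)
    finally show "norm (ce A F x) ^ 2 \<le> ce A (\<lambda>x. norm (F x) ^ 2) x" by (simp add: ce_def)
  qed
  have i2: "integrable Om (\<lambda>x. norm (ce A F x) ^ 2)"
    by (rule Bochner_Integration.integrable_bound[OF ce_integrable(1)[OF i, of A]])
      (use le m in \<open>auto intro: order_trans[OF _ abs_ge_self]\<close>)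
  then show "Lk 2 Om (ce A F)" using m by (simp add: Lk_def ce_measurable)
  have "(\<E> x. norm (ce A F x) ^ 2) \<le> integral\<^sup>L Om (ce A (\<lambda>x. norm (F x) ^ 2))"
    by (intro integral_mono_AE i2 ce_integrable(1)[OF i] le)
  then show "nrm2 Om (ce A F) \<le> nrm2 Om F"
    by (simp add: nrm2_def ce_integrable(2)[OF i])
qed

lemma ce_L4:
  assumes F: "Lk 4 Om F"
  shows "Lk 4 Om (ce A F)"
proof -
  have m: "F \<in> borel_measurable Om" and i: "integrable Om (\<lambda>x. norm (F x) ^ 4)"
    using F by (auto simp: Lk_def)
  have F2: "Lk 2 Om F" by (rule L4_L2[OF Om.finite_measure_axioms F])
  then have i2: "integrable Om (\<lambda>x. norm (F x) ^ 2)" by (simp add: Lk_def)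
  have iF: "integrable Om F" by (rule L2_integrable[OF Om.finite_measure_axioms F2])
  have le: "AE x in Om. norm (ce A F x) ^ 4 \<le> ce A (\<lambda>x. norm (F x) ^ 4) x"
    using AE_integrable_splice[OF i, of A] AE_integrable_splice[OF i2, of A] AE_integrable_splice[OF iF, of A]
  proof eventually_elim
    fix x assume *: "integrable Om (\<lambda>y. norm (F (splice A x y)) ^ 4)"
      "integrable Om (\<lambda>y. norm (F (splice A x y)) ^ 2)" "integrable Om (\<lambda>y. F (splice A x y))"
    have "norm (ce A F x) ^ 2 \<le> (\<E> y. norm (F (splice A x y))) ^ 2"
      unfolding ce_def by (intro power_mono integral_norm_bound) auto
    also have "\<dots> \<le> (\<E> y. norm (F (splice A x y)) ^ 2)"
      by (rule integral_square_le) (use * Om.prob_space_axioms in auto)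
    finally have "(norm (ce A F x) ^ 2) ^ 2 \<le> (\<E> y. norm (F (splice A x y)) ^ 2) ^ 2"
      by (intro power_mono) auto
    also have "\<dots> \<le> (\<E> y. (norm (F (splice A x y)) ^ 2) ^ 2)"
      by (rule integral_square_le) (use * Om.prob_space_axioms in \<open>auto simp flip: power_mult\<close>)
    finally show "norm (ce A F x) ^ 4 \<le> ce A (\<lambda>x. norm (F x) ^ 4) x"
      by (simp add: ce_def flip: power_mult)
  qed
  have "integrable Om (\<lambda>x. norm (ce A F x) ^ 4)"
    by (rule Bochner_Integration.integrable_bound[OF ce_integrable(1)[OF i, of A]])
      (use le m in \<open>auto intro: order_trans[OF _ abs_ge_self]\<close>)
  then show "Lk 4 Om (ce A F)" using m by (simp add: Lk_def ce_measurable)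
qed

lemmas L4_L2' = L4_L2[OF Om.finite_measure_axioms]
lemmas L2_integrable' = L2_integrable[OF Om.finite_measure_axioms]

definition shift :: "int \<Rightarrow> (int \<Rightarrow> 's) \<Rightarrow> int \<Rightarrow> 's" where
  "shift t x = (\<lambda>k. x (k + t))"

lemma distr_shift: "distr Om Om (shift t) = Om"
proof -
  have "distr (PiM UNIV (\<lambda>_::int. D)) (PiM UNIV (\<lambda>_::int. D)) (\<lambda>x. \<lambda>k\<in>UNIV. x (k + t)) = PiM UNIV (\<lambda>_. D)"
    by (rule distr_PiM_reindex[of UNIV "\<lambda>_. D" "\<lambda>k. k + t" UNIV])
      (auto simp: prob_D inj_on_def)
  then show ?thesis by (simp add: Om_def shift_def[abs_def] restrict_UNIV)
qed

lemma shift_measurable [measurable]: "shift t \<in> Om \<rightarrow>\<^sub>M Om"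
  unfolding Om_def shift_def by (rule measurable_PiM_single') (auto simp: space_PiM PiE_def)

lemma shift_splice: "shift t (splice A x y) = splice {k. k + t \<in> A} (shift t x) (shift t y)"
  by (auto simp: shift_def splice_def)

lemma ce_shift:
  assumes [measurable]: "F \<in> borel_measurable Om"
    and x0: "x \<in> space Om"
  shows "ce A (\<lambda>x. F (shift t x)) x = ce {k. k + t \<in> A} F (shift t x)"
proof -
  have x: "shift t x \<in> space Om" using measurable_space[OF shift_measurable x0] .
  have m: "(\<lambda>y. F (splice {k. k + t \<in> A} (shift t x) y)) \<in> borel_measurable Om"
    using x by measurable
  show ?thesis
    unfolding ce_def shift_splice
    using integral_distr[OF shift_measurable m, of t] by (simp only: distr_shift)
qed

lemma integral_shift:
  fixes F :: "(int \<Rightarrow> 's) \<Rightarrow> 'b::{banach, second_countable_topology}"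
  assumes "F \<in> borel_measurable Om"
  shows "(\<E> x. F (shift t x)) = integral\<^sup>L Om F"
    and "integrable Om (\<lambda>x. F (shift t x)) \<longleftrightarrow> integrable Om F"
  using integral_distr[OF shift_measurable assms, of t] integrable_distr_eq[OF shift_measurable assms, of t]
  by (simp_all only: distr_shift)

lemma dep_on_shift: "dep_on A F \<Longrightarrow> dep_on {k. k - t \<in> A} (\<lambda>x. F (shift t x))"
proof -
  assume "dep_on A F"
  moreover have "{k. k + t - t \<in> A} = A" by auto
  ultimately show ?thesis
    unfolding dep_on_def shift_splice mem_Collect_eq by simp
qed

end

section \<open>Families of vectors\<close>

lemma Lk_inner:
  fixes F :: "'a \<Rightarrow> 'b::{real_inner, second_countable_topology}"
  assumes "Lk k M F" shows "Lk k M (\<lambda>x. e \<bullet> F x)"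
  unfolding Lk_def
proof
  show m: "(\<lambda>x. e \<bullet> F x) \<in> borel_measurable M" using assms by (auto simp: Lk_def)
  have "\<bar>e \<bullet> F x\<bar> ^ k \<le> norm e ^ k * norm (F x) ^ k" for x
    unfolding power_mult_distrib[symmetric] by (intro power_mono Cauchy_Schwarz_ineq2) auto
  then have le: "norm (norm (e \<bullet> F x) ^ k) \<le> norm (norm e ^ k * norm (F x) ^ k)" for x
    by (subst (1 2) real_norm_def, subst (1 2) abs_of_nonneg) simp_all
  show "integrable M (\<lambda>x. norm (e \<bullet> F x) ^ k)"
  proof (rule Bochner_Integration.integrable_bound)
    show "integrable M (\<lambda>x. norm e ^ k * norm (F x) ^ k)" using assms by (simp add: Lk_def)
    show "(\<lambda>x. norm (e \<bullet> F x) ^ k) \<in> borel_measurable M" using m by measurable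
    show "AE x in M. norm (norm (e \<bullet> F x) ^ k) \<le> norm (norm e ^ k * norm (F x) ^ k)"
      by (rule AE_I2[OF le])
  qed
qed

lemma nrm2_cong_AE:
  fixes F G :: "'a \<Rightarrow> 'b::{real_normed_vector, second_countable_topology}"
  assumes "F \<in> borel_measurable M" "G \<in> borel_measurable M" "AE x in M. F x = G x"
  shows "nrm2 M F = nrm2 M G"
  unfolding nrm2_def using assms by (intro arg_cong[where f=sqrt] integral_cong_AE) auto

lemma orthonormal_inner_sum:
  fixes K :: "'b::real_inner set"
  assumes K: "finite K" "pairwise orthogonal K" "\<And>k. k \<in> K \<Longrightarrow> norm k = 1" and k: "k \<in> K"
  shows "k \<bullet> (\<Sum>k'\<in>K. a k' *\<^sub>R k') = a k"
proof -
  have "k \<bullet> (\<Sum>k'\<in>K. a k' *\<^sub>R k') = (\<Sum>k'\<in>K. if k' = k then a k else 0)"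
    unfolding inner_sum_right inner_scaleR_right
  proof (rule sum.cong)
    fix k' assume "k' \<in> K"
    then show "a k' * (k \<bullet> k') = (if k' = k then a k else 0)"
      using K k by (auto simp: pairwise_def orthogonal_def dot_square_norm)
  qed simp
  then show ?thesis using K k by simp
qed

lemma bessel:
  fixes v :: "'b::real_inner"
  assumes "finite E" "pairwise orthogonal E" "\<And>e. e \<in> E \<Longrightarrow> norm e = 1"
  shows "(\<Sum>e\<in>E. (e \<bullet> v)\<^sup>2) \<le> norm v ^ 2"
proof -
  define w where "w = (\<Sum>e\<in>E. (e \<bullet> v) *\<^sub>R e)"
  have ew: "e \<bullet> w = e \<bullet> v" if "e \<in> E" for e
    unfolding w_def by (rule orthonormal_inner_sum[OF assms that])
  have "w \<bullet> w = (\<Sum>e\<in>E. (e \<bullet> v) * (e \<bullet> w))"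
    by (subst (1) w_def) (simp add: inner_sum_left)
  also have "\<dots> = (\<Sum>e\<in>E. (e \<bullet> v)\<^sup>2)" by (simp add: ew power2_eq_square)
  finally have ww: "w \<bullet> w = (\<Sum>e\<in>E. (e \<bullet> v)\<^sup>2)" .
  have "w \<bullet> v = (\<Sum>e\<in>E. (e \<bullet> v)\<^sup>2)"
    by (simp add: w_def inner_sum_left power2_eq_square)
  moreover have "0 \<le> (v - w) \<bullet> (v - w)" by simp
  ultimately show ?thesis
    using ww by (simp add: inner_diff inner_commute power2_norm_eq_inner)
qed

text \<open>The norm of \<open>Q\<close> as an operator on the span of the orthonormal set
  \<open>E\<close>, in the Hilbert-Schmidt sense.\<close>

definition fam :: "'i set \<Rightarrow> ('i \<Rightarrow> 'x \<Rightarrow> 'b::real_normed_vector) \<Rightarrow> 'x \<Rightarrow> real" where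
  "fam E Q x = sqrt (\<Sum>e\<in>E. norm (Q e x) ^ 2)"

lemma fam_sq: "(fam E Q x)\<^sup>2 = (\<Sum>e\<in>E. norm (Q e x) ^ 2)"
  by (simp add: fam_def sum_nonneg)

lemma fam_nonneg: "0 \<le> fam E Q x"
  by (simp add: fam_def sum_nonneg)

lemma L2_fam:
  fixes Q :: "'i \<Rightarrow> 'x \<Rightarrow> 'b::{real_normed_vector, second_countable_topology}"
  assumes "\<And>e. e \<in> E \<Longrightarrow> Lk 2 M (Q e)"
  shows "Lk 2 M (fam E Q)" and "(nrm2 M (fam E Q))\<^sup>2 = (\<Sum>e\<in>E. (nrm2 M (Q e))\<^sup>2)"
proof -
  have [measurable]: "e \<in> E \<Longrightarrow> Q e \<in> borel_measurable M" for e using assms by (auto simp: Lk_def)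
  have m: "fam E Q \<in> borel_measurable M"
    unfolding fam_def[abs_def] by measurable
  then show "Lk 2 M (fam E Q)"
    using assms by (auto simp: Lk_def fam_sq)
  show "(nrm2 M (fam E Q))\<^sup>2 = (\<Sum>e\<in>E. (nrm2 M (Q e))\<^sup>2)"
    using assms by (auto simp: nrm2_sq fam_sq Lk_def)
qed

text \<open>The Cauchy-Schwarz inequality for the pairing of the operator \<open>q\<close> with the rank
  one operator \<open>r \<otimes> v\<close>.\<close>

lemma fam_inner_bound:
  fixes q :: "'i \<Rightarrow> 'x \<Rightarrow> 'b::real_inner" and r :: "'i \<Rightarrow> real"
  shows "\<bar>\<Sum>e\<in>E. r e * (q e x \<bullet> v)\<bar> \<le> sqrt (\<Sum>e\<in>E. (r e)\<^sup>2) * (fam E q x * norm v)"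
proof -
  have "\<bar>\<Sum>e\<in>E. r e * (q e x \<bullet> v)\<bar> \<le> (\<Sum>e\<in>E. \<bar>r e\<bar> * \<bar>norm (q e x)\<bar> * norm v)"
  proof (rule order_trans[OF sum_abs sum_mono])
    fix e
    show "\<bar>r e * (q e x \<bullet> v)\<bar> \<le> \<bar>r e\<bar> * \<bar>norm (q e x)\<bar> * norm v"
      using mult_left_mono[OF Cauchy_Schwarz_ineq2[of "q e x" v], of "\<bar>r e\<bar>"]
      by (simp add: abs_mult mult.assoc)
  qed
  also have "\<dots> = (\<Sum>e\<in>E. \<bar>r e\<bar> * \<bar>norm (q e x)\<bar>) * norm v" by (simp add: sum_distrib_right)
  also have "\<dots> \<le> L2_set r E * L2_set (\<lambda>e. norm (q e x)) E * norm v"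
    by (intro mult_right_mono L2_set_mult_ineq) auto
  finally show ?thesis by (simp add: L2_set_def fam_def mult.assoc)
qed

section \<open>Decompositions by conditional expectations\<close>

context iid_space
begin

text \<open>Three factors with a fourth order moment condition would ordinarily need Hoelder's inequality
  with exponents above two. If two of them are independent, second moments suffice.\<close>

lemma CS3:
  fixes a b c f :: "(int \<Rightarrow> 's) \<Rightarrow> real"
  assumes a: "dep_on A a" "Lk 2 Om a" and b: "dep_on B b" "Lk 2 Om b" and AB: "A \<inter> B = {}"
    and c: "Lk 2 Om c" and f: "f \<in> borel_measurable Om" "\<And>x. \<bar>f x\<bar> \<le> \<bar>c x\<bar> * (\<bar>a x\<bar> * \<bar>b x\<bar>)"
  shows "(\<E> x. f x) \<le> nrm2 Om a * nrm2 Om b * nrm2 Om c"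
proof -
  have i: "integrable Om (\<lambda>x. (a x)\<^sup>2 * (b x)\<^sup>2)" "(\<E> x. (a x)\<^sup>2 * (b x)\<^sup>2) = (\<E> x. (a x)\<^sup>2) * (\<E> x. (b x)\<^sup>2)"
    using indep_integral[OF dep_on_comp[OF a(1), of "\<lambda>t. t\<^sup>2"] _ dep_on_comp[OF b(1), of "\<lambda>t. t\<^sup>2"] _ AB] a b
    by (auto simp: Lk_def)
  have m: "a \<in> borel_measurable Om" "b \<in> borel_measurable Om" using a b by (auto simp: Lk_def)
  have ab: "Lk 2 Om (\<lambda>x. a x * b x)"
    using i m by (auto simp: Lk_def power_mult_distrib)
  have n: "nrm2 Om (\<lambda>x. a x * b x) = nrm2 Om a * nrm2 Om b"
    using i(2) by (simp add: nrm2_def power_mult_distrib real_sqrt_mult)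
  have "(\<E> x. f x) \<le> nrm2 Om c * nrm2 Om (\<lambda>x. a x * b x)"
    by (rule CS_bound(2)[OF c ab f(1)]) (use f(2) in \<open>simp add: abs_mult\<close>)
  then show ?thesis by (simp add: n mult.commute)
qed

lemma ce_pyth:
  fixes F :: "(int \<Rightarrow> 's) \<Rightarrow> 'b::{real_inner, banach, second_countable_topology}"
  assumes F: "Lk 2 Om F"
  shows "(nrm2 Om F)\<^sup>2 = (nrm2 Om (ce A F))\<^sup>2 + (nrm2 Om (\<lambda>x. F x - ce A F x))\<^sup>2"
proof -
  let ?c = "ce A F" and ?r = "\<lambda>x. F x - ce A F x"
  have c: "Lk 2 Om ?c" by (rule ce_L2[OF F])
  have r: "Lk 2 Om ?r" by (rule L2_diff[OF F c])
  note i = L2_inner_integrable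
  have "(\<E> x. ?c x \<bullet> F x) = (\<E> x. ?c x \<bullet> ?c x)"
    using F c by (intro ce_module(2)[OF bounded_bilinear_inner dep_on_ce]) (auto intro: i L2_integrable' simp: Lk_def)
  then have 0: "(\<E> x. ?c x \<bullet> ?r x) = 0"
    using i[OF c F] i[OF c c] by (simp add: inner_diff_right)
  have "(nrm2 Om F)\<^sup>2 = (\<E> x. norm (?c x + ?r x)^2)" by (simp add: nrm2_sq)
  also have "\<dots> = (\<E> x. norm (?c x)^2 + norm (?r x)^2 + 2 * (?c x \<bullet> ?r x))"
  proof (intro Bochner_Integration.integral_cong refl)
    fix x show "norm (?c x + ?r x)^2 = norm (?c x)^2 + norm (?r x)^2 + 2 * (?c x \<bullet> ?r x)"
      using dot_norm[of "?c x" "?r x"] by (simp only:) (simp add: field_simps)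
  qed
  also have "\<dots> = (\<E> x. norm (?c x)^2) + (\<E> x. norm (?r x)^2) + 2 * (\<E> x. ?c x \<bullet> ?r x)"
    using c r i[OF c r] by (auto simp: Lk_def)
  finally show ?thesis using 0 by (simp add: nrm2_sq)
qed

lemma nrm2_ce_compl_le:
  fixes F :: "(int \<Rightarrow> 's) \<Rightarrow> 'b::{real_inner, banach, second_countable_topology}"
  assumes "Lk 2 Om F"
  shows "nrm2 Om (\<lambda>x. F x - ce A F x) \<le> nrm2 Om F"
proof (rule power2_le_imp_le)
  show "(nrm2 Om (\<lambda>x. F x - ce A F x))\<^sup>2 \<le> (nrm2 Om F)\<^sup>2"
    using ce_pyth[OF assms, of A] by simp
qed (rule nrm2_nonneg)

text \<open>The interaction of the innovations in \<open>A\<close> with those in \<open>B\<close>: the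
  two conditional expectations are orthogonal, so removing both lowers the squared norm by the sum
  of theirs.\<close>

lemma interaction:
  fixes F :: "(int \<Rightarrow> 's) \<Rightarrow> 'b::{real_inner, banach, second_countable_topology}"
  assumes F: "Lk 2 Om F" and mean: "integral\<^sup>L Om F = 0" and AB: "A \<inter> B = {}"
  shows "(nrm2 Om (\<lambda>x. F x - ce A F x - ce B F x))\<^sup>2
      = (nrm2 Om F)\<^sup>2 - (nrm2 Om (ce A F))\<^sup>2 - (nrm2 Om (ce B F))\<^sup>2"
proof -
  let ?Z = "\<lambda>x. F x - ce A F x"
  have iF: "integrable Om F" by (rule L2_integrable'[OF F])
  have cA: "Lk 2 Om (ce A F)" and cB: "Lk 2 Om (ce B F)" using ce_L2[OF F] by auto
  have Z: "Lk 2 Om ?Z" by (rule L2_diff[OF F cA])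
  have [measurable]: "F \<in> borel_measurable Om" using F by (simp add: Lk_def)
  have "ce B (ce A F) x = 0" for x
    using AB ce_integrable(2)[OF iF, of A] mean
    by (subst ce_disjoint[OF dep_on_ce]) auto
  then have eq: "AE x in Om. ce B ?Z x = ce B F x"
    using ce_diff[OF iF ce_integrable(1)[OF iF, of A], of B] by auto
  have "(nrm2 Om ?Z)\<^sup>2 = (nrm2 Om (ce B F))\<^sup>2 + (nrm2 Om (\<lambda>x. ?Z x - ce B ?Z x))\<^sup>2"
    using ce_pyth[OF Z, of B] nrm2_cong_AE[OF _ _ eq] by simp
  moreover have "nrm2 Om (\<lambda>x. ?Z x - ce B ?Z x) = nrm2 Om (\<lambda>x. ?Z x - ce B F x)"
    using eq by (intro nrm2_cong_AE) auto
  ultimately show ?thesis using ce_pyth[OF F, of A] by simp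
qed

text \<open>Removing a conditional expectation from the interaction commutes with forming it, since
  conditional expectations on different sets of times commute, and \<open>ce B F\<close> is not
  affected by resampling outside of \<open>L \<supseteq> B\<close>.\<close>

lemma interaction_deep:
  fixes K :: "int set" and F :: "(int \<Rightarrow> 's) \<Rightarrow> 'b::{real_inner, banach, second_countable_topology}"
  assumes F: "Lk 2 Om F" and BL: "B \<subseteq> L"
  defines "J \<equiv> (\<lambda>x. F x - ce B F x - ce K F x)"
  shows "nrm2 Om (\<lambda>x. J x - ce L J x) \<le> nrm2 Om (\<lambda>x. F x - ce L F x)"
proof -
  let ?Z = "\<lambda>x. F x - ce L F x"
  have [measurable]: "F \<in> borel_measurable Om" using F by (simp add: Lk_def)
  have iF: "integrable Om F" by (rule L2_integrable'[OF F])
  have L: "Lk 2 Om (ce L F)" by (rule ce_L2[OF F])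
  note ic = ce_integrable(1)[OF iF]
  have iFB: "integrable Om (\<lambda>x. F x - ce B F x)" using iF ic by auto
  have LB: "L \<inter> B = B" using BL by auto
  have "AE x in Om. J x - ce L J x = ?Z x - ce K ?Z x"
    using ce_diff[OF iFB ic[of K], of L] ce_diff[OF iF ic[of B], of L] ce_diff[OF iF ic[of L], of K]
      ce_ce[OF iF, of L B] ce_ce[OF iF, of L K] ce_ce[OF iF, of K L]
    unfolding J_def by eventually_elim (simp add: LB Int_commute[of K L])
  then have "nrm2 Om (\<lambda>x. J x - ce L J x) = nrm2 Om (\<lambda>x. ?Z x - ce K ?Z x)"
    by (intro nrm2_cong_AE) (auto simp: J_def)
  also have "\<dots> \<le> nrm2 Om ?Z" by (intro nrm2_ce_compl_le L2_diff F L)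
  finally show ?thesis .
qed

lemma integral_inner_dep_disjoint:
  fixes g F :: "(int \<Rightarrow> 's) \<Rightarrow> 'b::{real_inner, banach, second_countable_topology}"
  assumes g: "dep_on A g" "Lk 2 Om g" "integral\<^sup>L Om g = 0" and F: "dep_on B F" "Lk 2 Om F"
    and AB: "A \<inter> B = {}"
  shows "(\<E> x. g x \<bullet> F x) = 0"
proof -
  have "(\<E> x. g x \<bullet> F x) = (\<E> x. g x \<bullet> ce A F x)"
    using g F by (intro ce_module(2)[OF bounded_bilinear_inner g(1)] L2_inner_integrable L2_integrable')
      (auto simp: Lk_def)
  also have "\<dots> = (\<E> x. g x \<bullet> integral\<^sup>L Om F)"
    using ce_disjoint[OF F(1) AB] by simp
  also have "\<dots> = integral\<^sup>L Om g \<bullet> integral\<^sup>L Om F"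
    using L2_integrable'[OF g(2)] by (intro integral_inner_left) simp
  finally show ?thesis using g by simp
qed

lemma ce_inner_eq:
  fixes g F F' :: "(int \<Rightarrow> 's) \<Rightarrow> 'b::{real_inner, banach, second_countable_topology}"
  assumes g: "dep_on A g" "g \<in> borel_measurable Om"
    and i: "integrable Om (\<lambda>x. g x \<bullet> F x)" and F: "integrable Om F"
    and F': "F' \<in> borel_measurable Om" "AE x in Om. ce A F x = F' x"
  shows "(\<E> x. g x \<bullet> F x) = (\<E> x. g x \<bullet> F' x)"
proof -
  have [measurable]: "F \<in> borel_measurable Om" "g \<in> borel_measurable Om" "F' \<in> borel_measurable Om"
    using F g F' by auto
  have "(\<E> x. g x \<bullet> F x) = (\<E> x. g x \<bullet> ce A F x)"
    by (intro ce_module(2)[OF bounded_bilinear_inner g(1)] i F) measurable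
  also have "\<dots> = (\<E> x. g x \<bullet> F' x)"
    using F'(2) by (intro integral_cong_AE) auto
  finally show ?thesis .
qed

end

section \<open>The normalised process and its lagged products\<close>

text \<open>A centered process \<open>X\<^sub>t\<close> with \<open>\<nu>\<^sub>4(X\<^sub>t) \<le> 1\<close>, given by a function \<open>\<phi>\<close> of the innovations up to time \<open>0\<close>. The finite
  orthonormal set \<open>E\<close> stands for an orthonormal basis: the first tensor factor of \<open>X\<^sub>t \<otimes> X\<^bsub>t+d\<^esub>\<close> is expanded in
  \<open>E\<close>, the second one is left as a vector.\<close>

locale stat_process = iid_space D
  for D :: "'s measure" +
  fixes \<phi> :: "(int \<Rightarrow> 's) \<Rightarrow> 'a::{real_inner, banach, second_countable_topology}"
    and E :: "'a set"
  assumes phi_L4: "Lk 4 Om \<phi>" and phi_dep: "dep_on {..0} \<phi>"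
    and phi_mean: "integral\<^sup>L Om \<phi> = 0" and phi_bound: "(\<E> x. norm (\<phi> x) ^ 4) \<le> 1"
    and E: "finite E" "pairwise orthogonal E" "\<And>e. e \<in> E \<Longrightarrow> norm e = 1"
begin

definition X :: "int \<Rightarrow> (int \<Rightarrow> 's) \<Rightarrow> 'a" where "X t x = \<phi> (shift t x)"
text \<open>\<open>lo j\<close> and \<open>hi j\<close> measure how much of \<open>X\<close> is explained by its \<open>j\<close> latest innovations and by all others;
  \<open>D2 j\<close> and \<open>D4 j\<close> measure what the \<open>j\<close> latest innovations leave unexplained.\<close>

definition lo :: "int \<Rightarrow> real" where "lo j = nrm2 Om (ce {-j<..} \<phi>)"
definition hi :: "int \<Rightarrow> real" where "hi j = nrm2 Om (ce {..-j} \<phi>)"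
definition D2 :: "int \<Rightarrow> real" where "D2 j = nrm2 Om (\<lambda>x. \<phi> x - ce {-j<..} \<phi> x)"
definition D4 :: "int \<Rightarrow> real" where "D4 j = root 4 (\<E> x. norm (\<phi> x - ce {-j<..} \<phi> x) ^ 4)"

lemma phi_meas [measurable]: "\<phi> \<in> borel_measurable Om"
  using phi_L4 by (simp add: Lk_def)

lemma X_meas [measurable]: "X t \<in> borel_measurable Om"
  unfolding X_def[abs_def] by measurable

lemma X_L4: "Lk 4 Om (X t)"
  using phi_L4 integral_shift(2)[of "\<lambda>x. norm (\<phi> x) ^ 4" t]
  by (simp add: Lk_def) (simp add: X_def)

lemma X_L2: "Lk 2 Om (X t)" by (rule L4_L2'[OF X_L4])

lemma X_integrable: "integrable Om (X t)" by (rule L2_integrable'[OF X_L2])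

lemma X_dep: "dep_on {..t} (X t)"
proof -
  have "{k. k - t \<in> {..0}} = {..t}" by auto
  then show ?thesis using dep_on_shift[OF phi_dep, of t] by (simp add: X_def[abs_def])
qed

lemma X_mean: "integral\<^sup>L Om (X t) = 0"
  using integral_shift(1)[OF phi_meas, of t] phi_mean by (simp add: X_def[abs_def])

lemma X_bound4: "(\<E> x. norm (X t x) ^ 4) \<le> 1"
  using integral_shift(1)[of "\<lambda>x. norm (\<phi> x) ^ 4" t] phi_bound by (simp add: X_def[abs_def])

lemma X_nrm2: "(nrm2 Om (X t))\<^sup>2 \<le> 1"
proof -
  have "(\<E> x. norm (X t x) ^ 2)\<^sup>2 \<le> (\<E> x. (norm (X t x) ^ 2)\<^sup>2)"
    by (rule integral_square_le(2)) (use X_L4[of t] Om.prob_space_axioms in \<open>auto simp: Lk_def simp flip: power_mult\<close>)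
  also have "\<dots> \<le> 1" using X_bound4[of t] by (simp flip: power_mult)
  finally have "(nrm2 Om (X t))\<^sup>2 ^ 2 \<le> 1 ^ 2" by (simp add: nrm2_sq)
  then show ?thesis by (rule power2_le_imp_le) simp
qed

lemma X_nrm2': "nrm2 Om (X t) \<le> 1"
  using X_nrm2[of t] nrm2_nonneg[of Om "X t"] by (simp add: power_le_one_iff)

lemma nrm2_shift:
  fixes H :: "(int \<Rightarrow> 's) \<Rightarrow> 'b::{real_normed_vector, second_countable_topology}"
  assumes [measurable]: "H \<in> borel_measurable Om"
  shows "nrm2 Om (\<lambda>x. H (shift t x)) = nrm2 Om H"
  using integral_shift(1)[of "\<lambda>x. norm (H x) ^ 2" t] by (simp add: nrm2_def)

lemma nrm2_cong_space: "(\<And>x. x \<in> space M \<Longrightarrow> F x = G x) \<Longrightarrow> nrm2 M F = nrm2 M G"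
  unfolding nrm2_def by (intro arg_cong[where f=sqrt] Bochner_Integration.integral_cong) auto

lemma nrm2_ce_X: "nrm2 Om (ce A (X t)) = nrm2 Om (ce {k. k + t \<in> A} \<phi>)"
proof -
  have "nrm2 Om (ce A (X t)) = nrm2 Om (\<lambda>x. ce {k. k + t \<in> A} \<phi> (shift t x))"
    by (intro nrm2_cong_space) (simp add: X_def[abs_def] ce_shift)
  then show ?thesis by (subst (asm) nrm2_shift) auto
qed

lemma nrm2_compl_X: "nrm2 Om (\<lambda>x. X t x - ce A (X t) x) = nrm2 Om (\<lambda>x. \<phi> x - ce {k. k + t \<in> A} \<phi> x)"
proof -
  have "nrm2 Om (\<lambda>x. X t x - ce A (X t) x)
      = nrm2 Om (\<lambda>x. (\<lambda>x. \<phi> x - ce {k. k + t \<in> A} \<phi> x) (shift t x))"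
    by (intro nrm2_cong_space) (simp add: X_def[abs_def] ce_shift)
  then show ?thesis by (subst (asm) nrm2_shift) auto
qed

lemma X_lo: "nrm2 Om (ce {t - j<..} (X t)) = lo j"
proof -
  have "{k. k + t \<in> {t - j<..}} = {-j<..}" by auto
  then show ?thesis by (simp only: nrm2_ce_X lo_def)
qed

lemma X_hi: "nrm2 Om (ce {..t - j} (X t)) = hi j"
proof -
  have "{k. k + t \<in> {..t - j}} = {..-j}" by auto
  then show ?thesis by (simp only: nrm2_ce_X hi_def)
qed

lemma X_D2: "nrm2 Om (\<lambda>x. X t x - ce {t - j<..} (X t) x) = D2 j"
proof -
  have "{k. k + t \<in> {t - j<..}} = {-j<..}" by auto
  then show ?thesis by (simp only: nrm2_compl_X D2_def)
qed

lemma X_D4: "root 4 (\<E> x. norm (X t x - ce {t - j<..} (X t) x) ^ 4) = D4 j"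
proof -
  have s: "{k. k + t \<in> {t - j<..}} = {-j<..}" by auto
  have "(\<E> x. norm (X t x - ce {t - j<..} (X t) x) ^ 4)
      = (\<E> x. (\<lambda>x. norm (\<phi> x - ce {-j<..} \<phi> x) ^ 4) (shift t x))"
    by (intro Bochner_Integration.integral_cong refl) (simp add: X_def[abs_def] ce_shift greaterThan_def)
  also have "\<dots> = (\<E> x. norm (\<phi> x - ce {-j<..} \<phi> x) ^ 4)"
    by (rule integral_shift(1)) measurable
  finally show ?thesis by (simp add: D4_def)
qed

text \<open>\<open>P d e\<close> is \<open>X\<^sub>0 \<otimes> X\<^sub>d\<close> applied to \<open>e\<close>. The innovations in \<open>{0<..d}\<close> enter \<open>X\<^sub>d\<close> but not \<open>X\<^sub>0\<close>. What
  they explain of the centered product is \<open>Q\<close>, the rest is \<open>R\<close>, and \<open>pp\<close>, \<open>ss\<close> are the norms of these orthogonal parts.\<close>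

definition P :: "int \<Rightarrow> 'a \<Rightarrow> (int \<Rightarrow> 's) \<Rightarrow> 'a" where
  "P d e x = (e \<bullet> X 0 x) *\<^sub>R X d x"
definition Cm :: "int \<Rightarrow> 'a \<Rightarrow> 'a" where "Cm d e = integral\<^sup>L Om (P d e)"
definition Q :: "int \<Rightarrow> 'a \<Rightarrow> (int \<Rightarrow> 's) \<Rightarrow> 'a" where
  "Q d e x = ce {0<..d} (P d e) x - Cm d e"
definition R :: "int \<Rightarrow> 'a \<Rightarrow> (int \<Rightarrow> 's) \<Rightarrow> 'a" where
  "R d e x = P d e x - ce {0<..d} (P d e) x"
definition pp :: "int \<Rightarrow> real" where "pp d = nrm2 Om (fam E (Q d))"
definition ss :: "int \<Rightarrow> real" where "ss d = nrm2 Om (fam E (R d))"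
definition cov :: "int \<Rightarrow> int \<Rightarrow> real" where
  "cov d j = (\<Sum>e\<in>E. (\<E> x. P d e x \<bullet> ((e \<bullet> X j x) *\<^sub>R X (j + d) x)) - norm (Cm d e) ^ 2)"

lemma P_L2: "Lk 2 Om (P d e)"
  unfolding P_def[abs_def] by (rule L4_scaleR_L2[OF Lk_inner[OF X_L4] X_L4])

lemma P_meas [measurable]: "P d e \<in> borel_measurable Om" using P_L2 by (simp add: Lk_def)

lemma P_integrable: "integrable Om (P d e)" by (rule L2_integrable'[OF P_L2])

lemma Lk_const': "Lk k Om (\<lambda>x. c)" by (rule Lk_const[OF Om.finite_measure_axioms])

lemma Q_L2: "Lk 2 Om (Q d e)"
  unfolding Q_def[abs_def] by (intro L2_diff ce_L2(1) P_L2 Lk_const')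

lemma R_L2: "Lk 2 Om (R d e)"
  unfolding R_def[abs_def] by (intro L2_diff ce_L2(1) P_L2)

lemma Q_meas [measurable]: "Q d e \<in> borel_measurable Om" using Q_L2 by (simp add: Lk_def)
lemma R_meas [measurable]: "R d e \<in> borel_measurable Om" using R_L2 by (simp add: Lk_def)

lemma Q_mean: "integral\<^sup>L Om (Q d e) = 0"
proof -
  have "integral\<^sup>L Om (Q d e) = integral\<^sup>L Om (ce {0<..d} (P d e)) - Cm d e"
    unfolding Q_def[abs_def] using ce_integrable(1)[OF P_integrable] by (simp add: Om.prob_space)
  then show ?thesis using ce_integrable(2)[OF P_integrable] by (simp add: Cm_def)
qed

lemma Q_dep: "dep_on {0<..d} (Q d e)"
  unfolding Q_def[abs_def] by (rule dep_on_comp[where h="\<lambda>t. t - Cm d e", OF dep_on_ce])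

lemma P_dep: assumes "0 \<le> d" shows "dep_on {..d} (P d e)"
  unfolding P_def[abs_def]
  by (rule dep_on_comp2[where h="\<lambda>u v. (e \<bullet> u) *\<^sub>R v" and F="X 0" and G="X d"])
    (use assms in \<open>auto intro: dep_on_mono[OF X_dep]\<close>)

lemma R_dep: assumes "0 \<le> d" shows "dep_on {..d} (R d e)"
  unfolding R_def[abs_def]
  by (rule dep_on_comp2[where h="(-)"]) (auto intro: P_dep assms dep_on_mono[OF dep_on_ce])

lemma fam_coord_le: "sqrt (\<Sum>e\<in>E. (e \<bullet> v)\<^sup>2) \<le> norm v"
  using bessel[OF E, of v] by (intro real_le_lsqrt) (auto simp: sum_nonneg)

text \<open>By Bessel's inequality, the Hilbert-Schmidt norm of \<open>X\<^sub>0 \<otimes>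
  X\<^sub>d\<close> restricted to the span of \<open>E\<close> is at most the product of the norms,
  whose second moment is at most \<open>1\<close> by the fourth moments.\<close>

lemma PC_norm: "(\<Sum>e\<in>E. (nrm2 Om (\<lambda>x. P d e x - Cm d e))\<^sup>2) \<le> 1"
  and pp_ss: "(pp d)\<^sup>2 + (ss d)\<^sup>2 = (\<Sum>e\<in>E. (nrm2 Om (\<lambda>x. P d e x - Cm d e))\<^sup>2)"
proof -
  have var: "(nrm2 Om (\<lambda>x. F x - integral\<^sup>L Om F))\<^sup>2 = (nrm2 Om F)\<^sup>2 - norm (integral\<^sup>L Om F)^2"
    if "Lk 2 Om F" for F :: "_ \<Rightarrow> 'a"
    using ce_pyth[OF that, of "{}"] by (simp add: ce_empty[abs_def] nrm2_sq Om.prob_space)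
  have i4: "integrable Om (\<lambda>x. norm (X 0 x) ^ 2 * norm (X d x) ^ 2)"
    and le4: "(\<E> x. abs (norm (X 0 x) ^ 2 * norm (X d x) ^ 2)) \<le>
      sqrt (\<E> x. (norm (X 0 x) ^ 2)\<^sup>2) * sqrt (\<E> x. (norm (X d x) ^ 2)\<^sup>2)"
    by (rule integral_Cauchy_Schwarz; use X_L4 in \<open>auto simp: Lk_def simp flip: power_mult\<close>)+
  have "(\<Sum>e\<in>E. (nrm2 Om (\<lambda>x. P d e x - Cm d e))\<^sup>2) \<le> (\<Sum>e\<in>E. (nrm2 Om (P d e))\<^sup>2)"
    by (rule sum_mono) (simp add: Cm_def var[OF P_L2])
  also have "\<dots> = (\<E> x. (\<Sum>e\<in>E. norm (P d e x) ^ 2))"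
    using P_L2 by (simp add: nrm2_sq Lk_def)
  also have "\<dots> \<le> (\<E> x. norm (X 0 x) ^ 2 * norm (X d x) ^ 2)"
  proof (rule integral_mono)
    show "integrable Om (\<lambda>x. \<Sum>e\<in>E. norm (P d e x) ^ 2)" using P_L2 by (simp add: Lk_def)
    fix x
    have "(\<Sum>e\<in>E. norm (P d e x) ^ 2) = (\<Sum>e\<in>E. (e \<bullet> X 0 x)\<^sup>2) * norm (X d x)^2"
      by (simp add: P_def power_mult_distrib sum_distrib_right)
    also have "\<dots> \<le> norm (X 0 x) ^ 2 * norm (X d x) ^ 2"
      by (intro mult_right_mono bessel E) auto
    finally show "(\<Sum>e\<in>E. norm (P d e x) ^ 2) \<le> norm (X 0 x) ^ 2 * norm (X d x) ^ 2" .
  qed (rule i4)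
  also have "\<dots> \<le> 1"
  proof -
    have "sqrt (\<E> x. (norm (X t x) ^ 2)\<^sup>2) \<le> 1" for t
      using X_bound4[of t] by (simp flip: power_mult)
    then have "sqrt (\<E> x. (norm (X 0 x) ^ 2)\<^sup>2) * sqrt (\<E> x. (norm (X d x) ^ 2)\<^sup>2) \<le> 1"
      by (intro mult_le_one) auto
    then show ?thesis using le4 by (simp add: abs_mult)
  qed
  finally show "(\<Sum>e\<in>E. (nrm2 Om (\<lambda>x. P d e x - Cm d e))\<^sup>2) \<le> 1" .
  have "(pp d)\<^sup>2 + (ss d)\<^sup>2 = (\<Sum>e\<in>E. (nrm2 Om (Q d e))\<^sup>2 + (nrm2 Om (R d e))\<^sup>2)"
    unfolding pp_def ss_def using L2_fam(2)[where Q="Q d" and E=E, OF Q_L2] L2_fam(2)[where Q="R d" and E=E, OF R_L2]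
    by (simp add: sum.distrib)
  also have "\<dots> = (\<Sum>e\<in>E. (nrm2 Om (\<lambda>x. P d e x - Cm d e))\<^sup>2)"
  proof (rule sum.cong[OF refl])
    fix e
    have "(nrm2 Om (Q d e))\<^sup>2 = (nrm2 Om (ce {0<..d} (P d e)))\<^sup>2 - norm (Cm d e)^2"
      using var[OF ce_L2(1)[OF P_L2[of d e], of "{0<..d}"]] ce_integrable(2)[OF P_integrable]
      by (simp add: Q_def[abs_def] Cm_def)
    then show "(nrm2 Om (Q d e))\<^sup>2 + (nrm2 Om (R d e))\<^sup>2 = (nrm2 Om (\<lambda>x. P d e x - Cm d e))\<^sup>2"
      using ce_pyth[OF P_L2[of d e], of "{0<..d}"] var[OF P_L2[of d e]]
      by (simp add: R_def[abs_def] Cm_def)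
  qed
  finally show "(pp d)\<^sup>2 + (ss d)\<^sup>2 = (\<Sum>e\<in>E. (nrm2 Om (\<lambda>x. P d e x - Cm d e))\<^sup>2)" .
qed

lemma pp_ss_le: "(pp d)\<^sup>2 + (ss d)\<^sup>2 \<le> 1"
  using PC_norm pp_ss by simp

lemma lo_mono: assumes "i \<le> j" shows "lo i \<le> lo j"
proof -
  have i: "{-i<..} \<inter> {-j<..} = {-i<..}" using assms by auto
  have "AE x in Om. ce {-i<..} (ce {-j<..} \<phi>) x = ce {-i<..} \<phi> x"
    using ce_ce[OF L2_integrable'[OF L4_L2'[OF phi_L4]], of "{-i<..}" "{-j<..}"] by (simp only: i)
  then have "lo i = nrm2 Om (ce {-i<..} (ce {-j<..} \<phi>))"
    unfolding lo_def by (intro nrm2_cong_AE) auto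
  also have "\<dots> \<le> lo j"
    unfolding lo_def by (intro ce_L2 L4_L2' phi_L4)
  finally show ?thesis .
qed

lemma hi_antimono: assumes "i \<le> j" shows "hi j \<le> hi i"
proof -
  have i: "{..-j} \<inter> {..-i} = {..-j}" using assms by auto
  have "AE x in Om. ce {..-j} (ce {..-i} \<phi>) x = ce {..-j} \<phi> x"
    using ce_ce[OF L2_integrable'[OF L4_L2'[OF phi_L4]], of "{..-j}" "{..-i}"] by (simp only: i)
  then have "hi j = nrm2 Om (ce {..-j} (ce {..-i} \<phi>))"
    unfolding hi_def by (intro nrm2_cong_AE) auto
  also have "\<dots> \<le> hi i"
    unfolding hi_def by (intro ce_L2 L4_L2' phi_L4)
  finally show ?thesis .
qed

text \<open>The innovations that are at least \<open>j\<close> steps old are independent of the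
  \<open>j\<close> latest ones, so they see of \<open>X\<close> only what those leave unexplained.\<close>

lemma hi_le_D2: "hi j \<le> D2 j"
proof -
  note F = L4_L2'[OF phi_L4] and iF = L2_integrable'[OF L4_L2'[OF phi_L4]]
  let ?Z = "\<lambda>x. \<phi> x - ce {-j<..} \<phi> x"
  have i: "{..-j} \<inter> {-j<..} = {}" by auto
  have "ce {..-j} (ce {-j<..} \<phi>) x = 0" for x
    by (subst ce_disjoint[OF dep_on_ce i]) (simp add: ce_integrable(2)[OF iF] phi_mean)
  then have "AE x in Om. ce {..-j} ?Z x = ce {..-j} \<phi> x"
    using ce_diff[OF iF ce_integrable(1)[OF iF, of "{-j<..}"], of "{..-j}"] by simp
  then have "hi j = nrm2 Om (ce {..-j} ?Z)"
    unfolding hi_def by (intro nrm2_cong_AE) auto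
  also have "\<dots> \<le> D2 j"
    unfolding D2_def by (intro ce_L2 L2_diff F)
  finally show ?thesis .
qed


section \<open>The covariance at one lag\<close>

lemma fam_dep:
  assumes "\<And>e. dep_on A (F e)" shows "dep_on A (fam E F)"
proof -
  have "dep_on A (\<lambda>x. \<Sum>e\<in>E. norm (F e x) ^ 2)"
    by (intro dep_on_sum dep_on_comp[where h="\<lambda>v. norm v ^ 2", OF assms])
  then show ?thesis unfolding fam_def[abs_def] by (rule dep_on_comp)
qed

lemma mult_abs_le: "0 \<le> (n::real) \<Longrightarrow> 0 \<le> f \<Longrightarrow> 0 \<le> v \<Longrightarrow> a \<le> n \<Longrightarrow> a * (f * v) \<le> n * f * v"
  by (simp add: mult_right_mono mult.assoc)

text \<open>All terms that survive in \<open>pp_bound\<close> and \<open>cov_bound\<close> have this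
  form, with \<open>q\<close> independent of one of the two other factors.\<close>

lemma tri_bound:
  fixes Y F :: "(int \<Rightarrow> 's) \<Rightarrow> 'a" and q :: "'a \<Rightarrow> (int \<Rightarrow> 's) \<Rightarrow> 'a"
  assumes q: "\<And>e. dep_on A (q e)" "\<And>e. Lk 2 Om (q e)" and AB: "A \<inter> B = {}"
    and F: "Lk 4 Om F" and Y: "Lk 4 Om Y"
    and dep: "dep_on B F \<or> dep_on B Y"
  shows "(\<Sum>e\<in>E. \<E> x. q e x \<bullet> ((e \<bullet> F x) *\<^sub>R Y x)) \<le> nrm2 Om (fam E q) * (nrm2 Om F * nrm2 Om Y)"
proof -
  have [measurable]: "F \<in> borel_measurable Om" "Y \<in> borel_measurable Om" "q e \<in> borel_measurable Om" for e
    using F Y q by (auto simp: Lk_def)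
  let ?f = "\<lambda>x. \<Sum>e\<in>E. q e x \<bullet> ((e \<bullet> F x) *\<^sub>R Y x)"
  have le: "\<bar>?f x\<bar> \<le> norm (F x) * fam E q x * norm (Y x)" for x
  proof -
    have "\<bar>?f x\<bar> = \<bar>\<Sum>e\<in>E. (e \<bullet> F x) * (q e x \<bullet> Y x)\<bar>" by simp
    also have "\<dots> \<le> sqrt (\<Sum>e\<in>E. (e \<bullet> F x)\<^sup>2) * (fam E q x * norm (Y x))"
      by (rule fam_inner_bound)
    also have "\<dots> \<le> norm (F x) * fam E q x * norm (Y x)"
      by (rule mult_abs_le[OF _ fam_nonneg _ fam_coord_le]) auto
    finally show ?thesis .
  qed
  have "(\<Sum>e\<in>E. \<E> x. q e x \<bullet> ((e \<bullet> F x) *\<^sub>R Y x)) = (\<E> x. ?f x)"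
    by (rule Bochner_Integration.integral_sum[symmetric])
      (intro L2_inner_integrable q L4_scaleR_L2 Lk_inner F Y)
  also have "\<dots> \<le> nrm2 Om (fam E q) * (nrm2 Om F * nrm2 Om Y)"
    using dep
  proof
    assume F': "dep_on B F"
    have "(\<E> x. ?f x) \<le> nrm2 Om (fam E q) * nrm2 Om (\<lambda>x. norm (F x)) * nrm2 Om (\<lambda>x. norm (Y x))"
    proof (rule CS3[where A=A and B=B])
      show "dep_on B (\<lambda>x. norm (F x))" by (rule dep_on_comp[OF F'])
      show "\<And>x. \<bar>?f x\<bar> \<le> \<bar>norm (Y x)\<bar> * (\<bar>fam E q x\<bar> * \<bar>norm (F x)\<bar>)"
        using le fam_nonneg[of E q] by (simp add: ac_simps)
    qed (use L4_L2'[OF F] L4_L2'[OF Y] AB in \<open>auto intro: fam_dep q L2_fam Lk_norm simp del: disjoint_iff\<close>)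
    then show ?thesis by (simp add: nrm2_def mult.assoc)
  next
    assume Y': "dep_on B Y"
    have "(\<E> x. ?f x) \<le> nrm2 Om (fam E q) * nrm2 Om (\<lambda>x. norm (Y x)) * nrm2 Om (\<lambda>x. norm (F x))"
    proof (rule CS3[where A=A and B=B])
      show "dep_on B (\<lambda>x. norm (Y x))" by (rule dep_on_comp[OF Y'])
      show "\<And>x. \<bar>?f x\<bar> \<le> \<bar>norm (F x)\<bar> * (\<bar>fam E q x\<bar> * \<bar>norm (Y x)\<bar>)"
        using le fam_nonneg[of E q] by (simp add: ac_simps)
    qed (use L4_L2'[OF F] L4_L2'[OF Y] AB in \<open>auto intro: fam_dep q L2_fam Lk_norm simp del: disjoint_iff\<close>)
    then show ?thesis by (simp add: nrm2_def ac_simps)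
  qed
  finally show ?thesis .
qed

lemma nrm2_compl_sq:
  fixes F :: "(int \<Rightarrow> 's) \<Rightarrow> 'a"
  assumes "Lk 2 Om F" shows "(nrm2 Om (\<lambda>x. F x - ce A F x))\<^sup>2 = (nrm2 Om F)\<^sup>2 - (nrm2 Om (ce A F))\<^sup>2"
  using ce_pyth[OF assms, of A] by simp

lemma scaleR_inner_swap: "q \<bullet> ((e \<bullet> u) *\<^sub>R y) = ((q \<bullet> y) *\<^sub>R e) \<bullet> u"
  for q y e u :: 'a by simp

text \<open>The fresh innovations see of \<open>X\<^sub>0 \<otimes> X\<^sub>d\<close> only the
  interaction \<open>W\<close> of them with the past inside \<open>X\<^sub>d\<close>: the part of
  \<open>X\<^sub>d\<close> that is a function of the fresh innovations is multiplied by
  \<open>X\<^sub>0\<close>, which has mean zero given those, and the part that is a function of the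
  past is independent of \<open>Q\<close>. Both \<open>X\<^sub>0\<close> and \<open>W\<close> are
  then split by whether the innovations after \<open>d - j\<close> explain them; mixed terms vanish,
  and the unexplained part of \<open>W\<close> is at most \<open>D2 j\<close>.\<close>

lemma pp_bound:
  assumes d: "0 \<le> d" "d \<le> j"
  shows "\<exists>w1 w2. 0 \<le> w1 \<and> 0 \<le> w2 \<and> w1\<^sup>2 + w2\<^sup>2 \<le> 1 - (hi d)\<^sup>2 - (lo d)\<^sup>2 \<and> w2 \<le> D2 j \<and>
    (pp d)\<^sup>2 \<le> w1\<^sup>2 + w2\<^sup>2 \<and> pp d \<le> lo (j - d) * w1 + sqrt (1 - (lo (j - d))\<^sup>2) * w2"
proof -
  define G :: "int set" where "G = {0<..d}"
  define L :: "int set" where "L = {d - j<..}"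
  have GL: "G \<subseteq> L" and G0: "G \<inter> {..0} = {}" using d by (auto simp: G_def L_def)
  define W where "W = (\<lambda>x. X d x - ce G (X d) x - ce {..0} (X d) x)"
  define W' where "W' = ce L W"
  define W2 where "W2 = (\<lambda>x. W x - W' x)"
  define U where "U = ce L (X 0)"
  define U2 where "U2 = (\<lambda>x. X 0 x - U x)"
  have W4: "Lk 4 Om W" unfolding W_def by (intro L4_diff ce_L4 X_L4)
  then have W'4: "Lk 4 Om W'" and W24: "Lk 4 Om W2" unfolding W'_def W2_def by (auto intro: L4_diff ce_L4)
  have U4: "Lk 4 Om U" and U24: "Lk 4 Om U2" unfolding U_def U2_def by (auto intro: L4_diff ce_L4 X_L4)
  note m = X_L4 W4 W'4 W24 U4 U24
  have [measurable]: "W \<in> borel_measurable Om" "W' \<in> borel_measurable Om" "W2 \<in> borel_measurable Om"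
      "U \<in> borel_measurable Om" "U2 \<in> borel_measurable Om"
    using m by (auto simp: Lk_def)
  have QG: "dep_on G (Q d e)" for e unfolding G_def by (rule Q_dep)
  have QL: "dep_on L (Q d e)" for e by (rule dep_on_mono[OF QG GL])
  have iQ: "integrable Om (\<lambda>x. Q d e x \<bullet> ((e' \<bullet> F x) *\<^sub>R Y x))"
    if "Lk 4 Om F" "Lk 4 Om Y" for e e' :: 'a and F Y
    by (intro L2_inner_integrable Q_L2 L4_scaleR_L2 Lk_inner that)
  have Gd: "ce G (X d) = ce {d - d<..} (X d)"
    using ce_of_dep[OF X_dep[of d], of "{0<..}"] by (simp add: G_def greaterThanAtMost_def)
  have UdA: "dep_on {..0} U" "dep_on {..0} U2"
  proof -
    have "dep_on (L \<inter> {..0}) U" unfolding U_def by (rule dep_on_ce_of_dep[OF X_dep])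
    then show U: "dep_on {..0} U" by (rule dep_on_mono) auto
    show "dep_on {..0} U2" unfolding U2_def by (rule dep_on_comp2[where h="(-)", OF X_dep U])
  qed
  define w1 w2 where "w1 = nrm2 Om W'" and "w2 = nrm2 Om W2"
  have w12: "w1\<^sup>2 + w2\<^sup>2 = (nrm2 Om W)\<^sup>2"
    unfolding w1_def w2_def W2_def W'_def using ce_pyth[OF L4_L2'[OF W4], of L] by simp
  have W_le: "(nrm2 Om W)\<^sup>2 \<le> 1 - (hi d)\<^sup>2 - (lo d)\<^sup>2"
    using interaction[OF X_L2 X_mean G0, of d] X_nrm2[of d] X_hi[of d d] X_lo[of d d]
    by (simp add: W_def Gd)
  have w2_le: "w2 \<le> D2 j"
    using interaction_deep[OF X_L2[of d] GL, of "{..0}"] X_D2[of d j]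
    by (simp add: w2_def W2_def W'_def W_def L_def)
  have sq: "(pp d)\<^sup>2 = (\<Sum>e\<in>E. \<E> x. Q d e x \<bullet> ((e \<bullet> X 0 x) *\<^sub>R W x))"
  proof -
    have "(pp d)\<^sup>2 = (\<Sum>e\<in>E. \<E> x. Q d e x \<bullet> Q d e x)"
      unfolding pp_def using L2_fam(2)[where Q="Q d" and E=E, OF Q_L2]
      by (simp add: nrm2_sq power2_norm_eq_inner)
    also have "\<dots> = (\<Sum>e\<in>E. \<E> x. Q d e x \<bullet> ((e \<bullet> X 0 x) *\<^sub>R W x))"
    proof (rule sum.cong[OF refl])
      fix e
      have i: "integrable Om (\<lambda>x. Q d e x \<bullet> P d e x)" "integrable Om (\<lambda>x. Q d e x \<bullet> ce G (P d e) x)"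
          "integrable Om (\<lambda>x. Q d e x \<bullet> Cm d e)"
        by (intro L2_inner_integrable Q_L2 P_L2 ce_L2(1) Lk_const')+
      have "(\<E> x. Q d e x \<bullet> Q d e x) = (\<E> x. Q d e x \<bullet> ce G (P d e) x) - (\<E> x. Q d e x \<bullet> Cm d e)"
        using i by (subst (2) Q_def) (simp add: inner_diff_right G_def)
      also have "(\<E> x. Q d e x \<bullet> Cm d e) = 0"
        using Q_mean L2_integrable'[OF Q_L2] by simp
      also have "(\<E> x. Q d e x \<bullet> ce G (P d e) x) = (\<E> x. Q d e x \<bullet> P d e x)"
        by (rule ce_inner_eq[OF QG Q_meas i(1) P_integrable, symmetric]) auto
      also have "(\<E> x. Q d e x \<bullet> P d e x)
          = (\<E> x. Q d e x \<bullet> ((e \<bullet> X 0 x) *\<^sub>R W x) + Q d e x \<bullet> ((e \<bullet> X 0 x) *\<^sub>R ce G (X d) x)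
             + Q d e x \<bullet> ((e \<bullet> X 0 x) *\<^sub>R ce {..0} (X d) x))"
        by (intro Bochner_Integration.integral_cong refl) (simp add: P_def W_def inner_diff_right algebra_simps)
      also have "\<dots> = (\<E> x. Q d e x \<bullet> ((e \<bullet> X 0 x) *\<^sub>R W x))
          + (\<E> x. Q d e x \<bullet> ((e \<bullet> X 0 x) *\<^sub>R ce G (X d) x))
          + (\<E> x. Q d e x \<bullet> ((e \<bullet> X 0 x) *\<^sub>R ce {..0} (X d) x))"
      proof -
        note iQ[OF X_L4[of 0] W4, of e e] iQ[OF X_L4[of 0] ce_L4[OF X_L4[of d], of G], of e e]
          iQ[OF X_L4[of 0] ce_L4[OF X_L4[of d], of "{..0}"], of e e]
        then show ?thesis by simp
      qed
      also have "(\<E> x. Q d e x \<bullet> ((e \<bullet> X 0 x) *\<^sub>R ce {..0} (X d) x)) = 0"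
      proof (rule integral_inner_dep_disjoint[OF QG Q_L2 Q_mean _ _ G0])
        show "dep_on {..0} (\<lambda>x. (e \<bullet> X 0 x) *\<^sub>R ce {..0} (X d) x)"
          by (rule dep_on_comp2[where h="\<lambda>u v. (e \<bullet> u) *\<^sub>R v", OF X_dep dep_on_ce])
      qed (intro L4_scaleR_L2 Lk_inner X_L4 ce_L4)
      also have "(\<E> x. Q d e x \<bullet> ((e \<bullet> X 0 x) *\<^sub>R ce G (X d) x))
          = (\<E> x. ((Q d e x \<bullet> ce G (X d) x) *\<^sub>R e) \<bullet> X 0 x)"
        by (simp only: scaleR_inner_swap)
      also have "\<dots> = (\<E> x. ((Q d e x \<bullet> ce G (X d) x) *\<^sub>R e) \<bullet> 0)"
      proof (rule ce_inner_eq[where A=G])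
        show "dep_on G (\<lambda>x. (Q d e x \<bullet> ce G (X d) x) *\<^sub>R e)"
          by (rule dep_on_comp2[where h="\<lambda>u v. (u \<bullet> v) *\<^sub>R e", OF QG dep_on_ce])
        show "integrable Om (\<lambda>x. ((Q d e x \<bullet> ce G (X d) x) *\<^sub>R e) \<bullet> X 0 x)"
          unfolding scaleR_inner_swap[symmetric] by (intro iQ X_L4 ce_L4)
        show "AE x in Om. ce G (X 0) x = 0"
          using ce_disjoint[OF X_dep[of 0] G0] X_mean[of 0] by simp
      qed (auto intro: X_integrable)
      finally show "(\<E> x. Q d e x \<bullet> Q d e x) = (\<E> x. Q d e x \<bullet> ((e \<bullet> X 0 x) *\<^sub>R W x))"
        by simp
    qed
    finally show ?thesis .
  qed
  \<comment> \<open>the mixed terms \<open>(U2, W')\<close> and \<open>(U, W2)\<close> vanish\<close>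
  have split: "(\<Sum>e\<in>E. \<E> x. Q d e x \<bullet> ((e \<bullet> X 0 x) *\<^sub>R W x)) =
     (\<Sum>e\<in>E. \<E> x. Q d e x \<bullet> ((e \<bullet> U x) *\<^sub>R W' x)) + (\<Sum>e\<in>E. \<E> x. Q d e x \<bullet> ((e \<bullet> U2 x) *\<^sub>R W2 x))"
    unfolding sum.distrib[symmetric]
  proof (rule sum.cong[OF refl])
    fix e
    have "(\<E> x. Q d e x \<bullet> ((e \<bullet> X 0 x) *\<^sub>R W x)) =
      (\<E> x. Q d e x \<bullet> ((e \<bullet> X 0 x) *\<^sub>R W' x) + Q d e x \<bullet> ((e \<bullet> U x) *\<^sub>R W2 x) + Q d e x \<bullet> ((e \<bullet> U2 x) *\<^sub>R W2 x))"
      by (intro Bochner_Integration.integral_cong refl) (simp add: W2_def U2_def inner_diff_right algebra_simps)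
    also have "\<dots> = (\<E> x. Q d e x \<bullet> ((e \<bullet> X 0 x) *\<^sub>R W' x)) + (\<E> x. Q d e x \<bullet> ((e \<bullet> U x) *\<^sub>R W2 x))
        + (\<E> x. Q d e x \<bullet> ((e \<bullet> U2 x) *\<^sub>R W2 x))"
      using iQ[OF X_L4[of 0] W'4, of e e] iQ[OF U4 W24, of e e] iQ[OF U24 W24, of e e] by simp
    also have "(\<E> x. Q d e x \<bullet> ((e \<bullet> X 0 x) *\<^sub>R W' x)) = (\<E> x. ((Q d e x \<bullet> W' x) *\<^sub>R e) \<bullet> X 0 x)"
      by (simp only: scaleR_inner_swap)
    also have "\<dots> = (\<E> x. ((Q d e x \<bullet> W' x) *\<^sub>R e) \<bullet> U x)"
    proof (rule ce_inner_eq[where A=L])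
      show "dep_on L (\<lambda>x. (Q d e x \<bullet> W' x) *\<^sub>R e)" unfolding W'_def
        by (rule dep_on_comp2[where h="\<lambda>u v. (u \<bullet> v) *\<^sub>R e", OF QL dep_on_ce])
      show "integrable Om (\<lambda>x. ((Q d e x \<bullet> W' x) *\<^sub>R e) \<bullet> X 0 x)"
        unfolding scaleR_inner_swap[symmetric] by (intro iQ m)
    qed (auto intro: X_integrable simp: U_def)
    also have "\<dots> = (\<E> x. Q d e x \<bullet> ((e \<bullet> U x) *\<^sub>R W' x))"
      by (simp only: scaleR_inner_swap)
    also have "(\<E> x. Q d e x \<bullet> ((e \<bullet> U x) *\<^sub>R W2 x)) = (\<E> x. ((e \<bullet> U x) *\<^sub>R Q d e x) \<bullet> W2 x)"
      by simp
    also have "\<dots> = (\<E> x. ((e \<bullet> U x) *\<^sub>R Q d e x) \<bullet> 0)"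
    proof (rule ce_inner_eq[where A=L])
      show "dep_on L (\<lambda>x. (e \<bullet> U x) *\<^sub>R Q d e x)" unfolding U_def
        by (rule dep_on_comp2[where h="\<lambda>u v. (e \<bullet> u) *\<^sub>R v", OF dep_on_ce QL])
      show "integrable Om (\<lambda>x. ((e \<bullet> U x) *\<^sub>R Q d e x) \<bullet> W2 x)"
        using iQ[OF U4 W24, of e e] by simp
      have iW: "integrable Om W" by (rule L2_integrable'[OF L4_L2'[OF W4]])
      show "AE x in Om. ce L W2 x = 0"
        using ce_diff[OF iW ce_integrable(1)[OF iW, of L], of L] ce_ce[OF iW, of L L]
        unfolding W2_def W'_def by eventually_elim simp
    qed (auto intro: L2_integrable' L4_L2' W24)
    finally show "(\<E> x. Q d e x \<bullet> ((e \<bullet> X 0 x) *\<^sub>R W x)) =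
      (\<E> x. Q d e x \<bullet> ((e \<bullet> U x) *\<^sub>R W' x)) + (\<E> x. Q d e x \<bullet> ((e \<bullet> U2 x) *\<^sub>R W2 x))"
      by simp
  qed
  have nU: "nrm2 Om U = lo (j - d)" using X_lo[of 0 "j - d"] by (simp add: U_def L_def)
  have "(nrm2 Om U2)\<^sup>2 \<le> 1 - (lo (j - d))\<^sup>2"
    unfolding U2_def U_def using nrm2_compl_sq[OF X_L2[of 0], of L] X_nrm2[of 0] nU by (simp add: U_def)
  then have nU2: "nrm2 Om U2 \<le> sqrt (1 - (lo (j - d))\<^sup>2)" by (rule real_le_rsqrt)
  have p0: "0 \<le> pp d" by (simp add: pp_def nrm2_nonneg)
  have "(pp d)\<^sup>2 \<le> pp d * (nrm2 Om U * w1) + pp d * (nrm2 Om U2 * w2)"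
    unfolding sq split unfolding pp_def w1_def w2_def
    by (intro add_mono tri_bound[OF QG Q_L2 G0] m disjI1 UdA)
  also have "\<dots> \<le> pp d * (lo (j - d) * w1) + pp d * (sqrt (1 - (lo (j - d))\<^sup>2) * w2)"
    unfolding nU using nU2 p0 by (intro add_mono mult_left_mono mult_right_mono order_refl) (auto simp: w2_def nrm2_nonneg)
  finally have "pp d * pp d \<le> pp d * (lo (j - d) * w1 + sqrt (1 - (lo (j - d))\<^sup>2) * w2)"
    by (simp add: power2_eq_square algebra_simps)
  moreover have "0 \<le> lo (j - d) * w1 + sqrt (1 - (lo (j - d))\<^sup>2) * w2"
  proof -
    have "0 \<le> 1 - (lo (j - d))\<^sup>2" using \<open>(nrm2 Om U2)\<^sup>2 \<le> _\<close> zero_le_power2[of "nrm2 Om U2"] by linarith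
    then show ?thesis by (auto simp: w1_def w2_def nrm2_nonneg lo_def)
  qed
  ultimately have 1: "pp d \<le> lo (j - d) * w1 + sqrt (1 - (lo (j - d))\<^sup>2) * w2"
    using p0 by (cases "pp d = 0") auto
  have "(pp d)\<^sup>2 \<le> pp d * (nrm2 Om (X 0) * nrm2 Om W)"
    unfolding sq unfolding pp_def
    by (intro tri_bound[OF QG Q_L2 G0] m disjI1 X_dep)
  also have "\<dots> \<le> pp d * (1 * nrm2 Om W)"
    by (intro mult_left_mono mult_right_mono X_nrm2' p0 nrm2_nonneg)
  finally have "pp d \<le> nrm2 Om W"
    using p0 nrm2_nonneg[of Om W] by (cases "pp d = 0") (auto simp: power2_eq_square)
  then have 2: "(pp d)\<^sup>2 \<le> w1\<^sup>2 + w2\<^sup>2" unfolding w12 using p0 by (rule power_mono)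
  show ?thesis
    by (intro exI[of _ w1] exI[of _ w2] conjI 1 2 w2_le) (use w12 W_le in \<open>auto simp: w1_def w2_def nrm2_nonneg\<close>)
qed


lemma X_shift: "X s (shift t x) = X (s + t) x"
  by (simp add: X_def shift_def add_ac)

lemma cov_eq:
  "cov d j = (\<Sum>e\<in>E. \<E> x. (P d e x - Cm d e) \<bullet> ((e \<bullet> X j x) *\<^sub>R X (j + d) x))"
  unfolding cov_def
proof (rule sum.cong[OF refl])
  fix e
  let ?V = "\<lambda>x. (e \<bullet> X j x) *\<^sub>R X (j + d) x"
  have V2: "Lk 2 Om ?V" by (intro L4_scaleR_L2 Lk_inner X_L4)
  have "integral\<^sup>L Om ?V = (\<E> x. P d e (shift j x))"
    by (simp add: P_def X_shift add.commute)
  also have "\<dots> = Cm d e" unfolding Cm_def by (rule integral_shift(1)) simp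
  finally have m: "integral\<^sup>L Om ?V = Cm d e" .
  have "(\<E> x. (P d e x - Cm d e) \<bullet> ?V x) = (\<E> x. P d e x \<bullet> ?V x) - (\<E> x. Cm d e \<bullet> ?V x)"
    unfolding inner_diff_left
    by (intro Bochner_Integration.integral_diff L2_inner_integrable P_L2 V2 Lk_const')
  also have "(\<E> x. Cm d e \<bullet> ?V x) = norm (Cm d e) ^ 2"
    using L2_integrable'[OF V2] m by (simp add: power2_norm_eq_inner del: inner_scaleR_right)
  finally show "(\<E> x. P d e x \<bullet> ?V x) - norm (Cm d e) ^ 2 = (\<E> x. (P d e x - Cm d e) \<bullet> ?V x)" by simp
qed

lemma PC_L2: "Lk 2 Om (\<lambda>x. P d e x - Cm d e)"
  by (intro L2_diff P_L2 Lk_const')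

lemma PC_mean: "integral\<^sup>L Om (\<lambda>x. P d e x - Cm d e) = 0"
  using P_integrable[of d e] by (simp add: Om.prob_space Cm_def)

lemma PC_dep: "0 \<le> d \<Longrightarrow> dep_on {..d} (\<lambda>x. P d e x - Cm d e)"
  by (rule dep_on_comp[where h="\<lambda>t. t - Cm d e", OF P_dep])

lemma D4_nonneg: "0 \<le> D4 j" by (simp add: D4_def)

lemma D2_le_D4: "D2 j \<le> D4 j"
proof -
  let ?r = "\<lambda>x. \<phi> x - ce {-j<..} \<phi> x"
  have r4: "Lk 4 Om ?r" by (intro L4_diff phi_L4 ce_L4)
  have "(D2 j)\<^sup>2 ^ 2 \<le> (\<E> x. (norm (?r x) ^ 2)\<^sup>2)"
    unfolding D2_def nrm2_sq
    by (rule integral_square_le(2)) (use r4 Om.prob_space_axioms in \<open>auto simp: Lk_def simp flip: power_mult\<close>)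
  also have "\<dots> = D4 j ^ 4" unfolding D4_def by (subst real_root_pow_pos2) (auto simp flip: power_mult)
  finally have "D2 j ^ 4 \<le> D4 j ^ 4" by (simp flip: power_mult)
  then show ?thesis using D4_nonneg power_le_imp_le_base[of "D2 j" 3 "D4 j"] by simp
qed

text \<open>The cost of cutting the innovations up to time \<open>d\<close> off
  \<open>X\<^bsub>j+d\<^esub>\<close>, which are at least \<open>j\<close> steps old.\<close>

lemma deep_term:
  "(\<Sum>e\<in>E. \<E> x. (P d e x - Cm d e) \<bullet> ((e \<bullet> X j x) *\<^sub>R (X (j + d) x - ce {d<..} (X (j + d)) x))) \<le> D4 j"
proof -
  let ?r = "\<lambda>x. X (j + d) x - ce {d<..} (X (j + d)) x"
  let ?PC = "\<lambda>e x. P d e x - Cm d e"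
  have r4: "Lk 4 Om ?r" by (intro L4_diff X_L4 ce_L4)
  let ?h = "\<lambda>x. norm (X j x) * norm (?r x)"
  have h2: "Lk 2 Om ?h" by (intro L4_mult_L2 Lk_norm X_L4 r4)
  have "(\<E> x. abs (norm (X j x)^2 * norm (?r x) ^ 2))
      \<le> sqrt (\<E> x. (norm (X j x) ^ 2)\<^sup>2) * sqrt (\<E> x. (norm (?r x) ^ 2)\<^sup>2)"
    by (rule integral_Cauchy_Schwarz(2)) (use X_L4[of j] r4 in \<open>auto simp: Lk_def simp flip: power_mult\<close>)
  also have "\<dots> \<le> 1 * sqrt (\<E> x. (norm (?r x) ^ 2)\<^sup>2)"
    using X_bound4[of j] by (intro mult_right_mono) (auto simp flip: power_mult)
  also have "sqrt (\<E> x. (norm (?r x) ^ 2)\<^sup>2) = (D4 j)\<^sup>2"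
  proof -
    have "(\<E> x. (norm (?r x) ^ 2)\<^sup>2) = D4 j ^ 4"
      unfolding X_D4[of "j + d" j, symmetric] by (subst real_root_pow_pos2) (auto simp flip: power_mult)
    also have "\<dots> = ((D4 j)\<^sup>2)\<^sup>2" by (simp flip: power_mult)
    finally show ?thesis by (simp only: real_sqrt_abs abs_power2)
  qed
  finally have "(nrm2 Om ?h)\<^sup>2 \<le> (D4 j)\<^sup>2" by (simp add: nrm2_sq abs_mult power_mult_distrib)
  then have h: "nrm2 Om ?h \<le> D4 j" using D4_nonneg by (rule power2_le_imp_le)
  have "(nrm2 Om (fam E ?PC))\<^sup>2 \<le> 1" using L2_fam(2)[where Q="?PC" and E=E, OF PC_L2] PC_norm by simp
  then have p: "nrm2 Om (fam E ?PC) \<le> 1" by (simp add: power_le_one_iff nrm2_nonneg)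
  have "(\<Sum>e\<in>E. \<E> x. ?PC e x \<bullet> ((e \<bullet> X j x) *\<^sub>R ?r x))
      = (\<E> x. (\<Sum>e\<in>E. ?PC e x \<bullet> ((e \<bullet> X j x) *\<^sub>R ?r x)))"
    by (rule Bochner_Integration.integral_sum[symmetric]) (intro L2_inner_integrable PC_L2 L4_scaleR_L2 Lk_inner X_L4 r4)
  also have "\<dots> \<le> nrm2 Om (fam E ?PC) * nrm2 Om ?h"
  proof (rule CS_bound(2))
    show "Lk 2 Om (fam E ?PC)" by (rule L2_fam(1)[OF PC_L2])
    fix x
    have "\<bar>\<Sum>e\<in>E. ?PC e x \<bullet> ((e \<bullet> X j x) *\<^sub>R ?r x)\<bar> = \<bar>\<Sum>e\<in>E. (e \<bullet> X j x) * (?PC e x \<bullet> ?r x)\<bar>" by simp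
    also have "\<dots> \<le> sqrt (\<Sum>e\<in>E. (e \<bullet> X j x)\<^sup>2) * (fam E ?PC x * norm (?r x))"
      by (rule fam_inner_bound)
    also have "\<dots> \<le> norm (X j x) * fam E ?PC x * norm (?r x)"
      by (rule mult_abs_le[OF _ fam_nonneg _ fam_coord_le]) auto
    finally show "\<bar>\<Sum>e\<in>E. ?PC e x \<bullet> ((e \<bullet> X j x) *\<^sub>R ?r x)\<bar> \<le> \<bar>fam E ?PC x\<bar> * \<bar>?h x\<bar>"
      by (simp add: ac_simps fam_nonneg abs_mult)
  qed (use h2 in auto)
  also have "\<dots> \<le> 1 * D4 j" by (intro mult_mono p h) (auto simp: nrm2_nonneg)
  finally show ?thesis by simp
qed

text \<open>After the cut, \<open>X\<^bsub>j+d\<^esub>\<close> may be replaced by its conditional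
  expectation \<open>y\<close> given the innovations in \<open>{d<..j}\<close>, as all other factors
  depend on the innovations up to \<open>j\<close>. Its norm \<open>z\<close> is at most \<open>hi
  d\<close>, and zero if \<open>j = d\<close>. The part of \<open>X\<^sub>j\<close> that is a
  function of the innovations up to \<open>d\<close> then meets \<open>y\<close>, which is
  independent of it and of \<open>P\<close> and has mean zero; the part that is a function of
  \<open>{d<..j}\<close> leaves the centered \<open>P\<close> alone. So \<open>X\<^sub>j\<close> may
  be replaced by its interaction part \<open>J\<close>. The part of \<open>J\<close> explained by
  the innovations after \<open>0\<close> has norm \<open>i1\<close> and meets only \<open>Q\<close>,
  the rest has norm \<open>i2\<close> and meets only \<open>R\<close>.\<close>

lemma cov_bound:
  assumes d: "0 \<le> d" "d \<le> j"
  shows "\<exists>i1 i2 z. 0 \<le> i1 \<and> 0 \<le> i2 \<and> 0 \<le> z \<and> z \<le> hi d \<and> (j = d \<longrightarrow> z = 0) \<and>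
    cov d j \<le> D4 j + z * (pp d * i1 + ss d * i2) \<and>
    i1\<^sup>2 + i2\<^sup>2 \<le> 1 - (lo (j - d))\<^sup>2 - (hi (j - d))\<^sup>2 \<and> i2 \<le> D2 j \<and> i1 \<le> D2 (j - d)"
proof -
  define K B L where "K = {..d}" and "B = {d<..j}" and "L = {0::int<..}"
  have BK: "B \<inter> K = {}" "K \<inter> B = {}" and BL: "B \<subseteq> L" using d by (auto simp: K_def B_def L_def)
  let ?PC = "\<lambda>e x. P d e x - Cm d e"
  let ?Z = "X (j + d)"
  define y where "y = ce B ?Z"
  define J where "J = (\<lambda>x. X j x - ce B (X j) x - ce K (X j) x)"
  define J1 where "J1 = ce L J"
  define J2 where "J2 = (\<lambda>x. J x - J1 x)"
  have y4: "Lk 4 Om y" unfolding y_def by (intro ce_L4 X_L4)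
  have J4: "Lk 4 Om J" unfolding J_def by (intro L4_diff ce_L4 X_L4)
  have J14: "Lk 4 Om J1" and J24: "Lk 4 Om J2" unfolding J1_def J2_def using J4 by (auto intro: L4_diff ce_L4)
  note m = X_L4 y4 J4 J14 J24
  have [measurable]: "y \<in> borel_measurable Om" "J \<in> borel_measurable Om"
    "J1 \<in> borel_measurable Om" "J2 \<in> borel_measurable Om"
    using m by (auto simp: Lk_def)
  have yB: "dep_on B y" unfolding y_def by (rule dep_on_ce)
  have y_mean: "integral\<^sup>L Om y = 0"
    unfolding y_def using ce_integrable(2)[OF X_integrable] X_mean by simp
  have PCK: "dep_on K (?PC e)" for e unfolding K_def by (rule PC_dep[OF d(1)])
  have iPC: "integrable Om (\<lambda>x. ?PC e x \<bullet> ((e' \<bullet> F x) *\<^sub>R Y x))"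
    if "Lk 4 Om F" "Lk 4 Om Y" for e e' :: 'a and F Y
    by (intro L2_inner_integrable PC_L2 L4_scaleR_L2 Lk_inner that)
  define z where "z = nrm2 Om y"
  have zhi: "z \<le> hi d"
  proof -
    have i: "B \<inter> {..j} = B" by (auto simp: B_def)
    have "AE x in Om. ce B (ce {..j} ?Z) x = y x"
      using ce_ce[OF X_integrable, of B "{..j}" "j + d"] by (simp add: i y_def)
    then have "z = nrm2 Om (ce B (ce {..j} ?Z))"
      unfolding z_def by (intro nrm2_cong_AE) auto
    also have "\<dots> \<le> nrm2 Om (ce {..j} ?Z)" by (intro ce_L2 X_L2)
    finally show ?thesis using X_hi[of "j + d" d] by simp
  qed
  have z0: "z = 0" if "j = d"
  proof -
    have "y x = 0" for x using that X_mean by (simp add: y_def B_def ce_empty)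
    then show ?thesis by (simp add: z_def nrm2_def)
  qed
  have step1: "cov d j \<le> D4 j + (\<Sum>e\<in>E. \<E> x. ?PC e x \<bullet> ((e \<bullet> X j x) *\<^sub>R ce {d<..} ?Z x))"
  proof -
    have "cov d j = (\<Sum>e\<in>E. (\<E> x. ?PC e x \<bullet> ((e \<bullet> X j x) *\<^sub>R (?Z x - ce {d<..} ?Z x)))
        + (\<E> x. ?PC e x \<bullet> ((e \<bullet> X j x) *\<^sub>R ce {d<..} ?Z x)))"
      unfolding cov_eq
    proof (rule sum.cong[OF refl])
      fix e
      have i: "integrable Om (\<lambda>x. ?PC e x \<bullet> ((e \<bullet> X j x) *\<^sub>R (?Z x - ce {d<..} ?Z x)))"
        "integrable Om (\<lambda>x. ?PC e x \<bullet> ((e \<bullet> X j x) *\<^sub>R ce {d<..} ?Z x))"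
        by (intro iPC X_L4 L4_diff ce_L4)+
      show "(\<E> x. ?PC e x \<bullet> ((e \<bullet> X j x) *\<^sub>R ?Z x)) =
        (\<E> x. ?PC e x \<bullet> ((e \<bullet> X j x) *\<^sub>R (?Z x - ce {d<..} ?Z x)))
        + (\<E> x. ?PC e x \<bullet> ((e \<bullet> X j x) *\<^sub>R ce {d<..} ?Z x))"
        by (subst Bochner_Integration.integral_add[OF i, symmetric])
          (intro Bochner_Integration.integral_cong refl, simp add: inner_diff_right algebra_simps)
    qed
    then show ?thesis using deep_term[of d j] by (simp add: sum.distrib)
  qed
  have step2: "(\<E> x. ?PC e x \<bullet> ((e \<bullet> X j x) *\<^sub>R ce {d<..} ?Z x))
      = (\<E> x. ?PC e x \<bullet> ((e \<bullet> J x) *\<^sub>R y x))" for e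
  proof -
    have "(\<E> x. ?PC e x \<bullet> ((e \<bullet> X j x) *\<^sub>R ce {d<..} ?Z x))
        = (\<E> x. ((e \<bullet> X j x) *\<^sub>R ?PC e x) \<bullet> ce {d<..} ?Z x)" by simp
    also have "\<dots> = (\<E> x. ((e \<bullet> X j x) *\<^sub>R ?PC e x) \<bullet> y x)"
    proof (rule ce_inner_eq[where A="{..j}"])
      show "dep_on {..j} (\<lambda>x. (e \<bullet> X j x) *\<^sub>R ?PC e x)"
        by (rule dep_on_comp2[where h="\<lambda>u v. (e \<bullet> u) *\<^sub>R v", OF X_dep dep_on_mono[OF PC_dep[OF d(1)]]])
          (use d in auto)
      show "integrable Om (\<lambda>x. ((e \<bullet> X j x) *\<^sub>R ?PC e x) \<bullet> ce {d<..} ?Z x)"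
        using iPC[OF X_L4[of j] ce_L4[OF X_L4], of e e] by simp
      have i: "{..j} \<inter> {d<..} = B" by (auto simp: B_def)
      show "AE x in Om. ce {..j} (ce {d<..} ?Z) x = y x"
        using ce_ce[OF X_integrable, of "{..j}" "{d<..}" "j + d"] by (simp add: i y_def)
    qed (auto intro: ce_integrable X_integrable)
    also have "\<dots> = (\<E> x. ?PC e x \<bullet> ((e \<bullet> J x) *\<^sub>R y x) + ?PC e x \<bullet> ((e \<bullet> ce B (X j) x) *\<^sub>R y x)
        + ?PC e x \<bullet> ((e \<bullet> ce K (X j) x) *\<^sub>R y x))"
      by (intro Bochner_Integration.integral_cong refl) (simp add: J_def inner_diff_right algebra_simps)
    also have "\<dots> = (\<E> x. ?PC e x \<bullet> ((e \<bullet> J x) *\<^sub>R y x))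
        + (\<E> x. ?PC e x \<bullet> ((e \<bullet> ce B (X j) x) *\<^sub>R y x))
        + (\<E> x. ?PC e x \<bullet> ((e \<bullet> ce K (X j) x) *\<^sub>R y x))"
      using iPC[OF J4 y4, of e e] iPC[OF ce_L4[OF X_L4] y4, of e e B j] iPC[OF ce_L4[OF X_L4] y4, of e e K j]
      by simp
    also have "(\<E> x. ?PC e x \<bullet> ((e \<bullet> ce B (X j) x) *\<^sub>R y x)) = 0"
    proof (rule integral_inner_dep_disjoint[OF PCK PC_L2 PC_mean _ _ BK(2)])
      show "dep_on B (\<lambda>x. (e \<bullet> ce B (X j) x) *\<^sub>R y x)"
        by (rule dep_on_comp2[where h="\<lambda>u v. (e \<bullet> u) *\<^sub>R v", OF dep_on_ce yB])
    qed (intro L4_scaleR_L2 Lk_inner ce_L4 m)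
    also have "(\<E> x. ?PC e x \<bullet> ((e \<bullet> ce K (X j) x) *\<^sub>R y x))
        = (\<E> x. ((e \<bullet> ce K (X j) x) *\<^sub>R ?PC e x) \<bullet> y x)" by simp
    also have "\<dots> = (\<E> x. ((e \<bullet> ce K (X j) x) *\<^sub>R ?PC e x) \<bullet> 0)"
    proof (rule ce_inner_eq[where A=K])
      show "dep_on K (\<lambda>x. (e \<bullet> ce K (X j) x) *\<^sub>R ?PC e x)"
        by (rule dep_on_comp2[where h="\<lambda>u v. (e \<bullet> u) *\<^sub>R v", OF dep_on_ce PCK])
      show "integrable Om (\<lambda>x. ((e \<bullet> ce K (X j) x) *\<^sub>R ?PC e x) \<bullet> y x)"
        using iPC[OF ce_L4[OF X_L4] y4, of e e K j] by simp
      show "AE x in Om. ce K y x = 0"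
        using ce_disjoint[OF yB BK(2)] y_mean by simp
    qed (auto intro: L2_integrable' L4_L2' y4)
    finally show ?thesis by simp
  qed
  have QR: "?PC e x = Q d e x + R d e x" for e x by (simp add: Q_def R_def)
  have iQ: "integrable Om (\<lambda>x. Q d e x \<bullet> ((e' \<bullet> F x) *\<^sub>R Y x))"
    and iR: "integrable Om (\<lambda>x. R d e x \<bullet> ((e' \<bullet> F x) *\<^sub>R Y x))"
    if "Lk 4 Om F" "Lk 4 Om Y" for e e' :: 'a and F Y
    by (intro L2_inner_integrable Q_L2 R_L2 L4_scaleR_L2 Lk_inner that)+
  have step3: "(\<E> x. ?PC e x \<bullet> ((e \<bullet> J x) *\<^sub>R y x))
     = (\<E> x. Q d e x \<bullet> ((e \<bullet> J1 x) *\<^sub>R y x)) + (\<E> x. R d e x \<bullet> ((e \<bullet> J2 x) *\<^sub>R y x))" for e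
  proof -
    have "(\<E> x. ?PC e x \<bullet> ((e \<bullet> J x) *\<^sub>R y x)) = (\<E> x. Q d e x \<bullet> ((e \<bullet> J x) *\<^sub>R y x)
        + R d e x \<bullet> ((e \<bullet> J2 x) *\<^sub>R y x) + R d e x \<bullet> ((e \<bullet> J1 x) *\<^sub>R y x))"
      by (intro Bochner_Integration.integral_cong refl) (simp add: QR J2_def inner_add_left inner_diff_right algebra_simps)
    also have "\<dots> = (\<E> x. Q d e x \<bullet> ((e \<bullet> J x) *\<^sub>R y x))
        + (\<E> x. R d e x \<bullet> ((e \<bullet> J2 x) *\<^sub>R y x)) + (\<E> x. R d e x \<bullet> ((e \<bullet> J1 x) *\<^sub>R y x))"
      using iQ[OF J4 y4, of e e] iR[OF J24 y4, of e e] iR[OF J14 y4, of e e] by simp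
    also have "(\<E> x. Q d e x \<bullet> ((e \<bullet> J x) *\<^sub>R y x)) = (\<E> x. ((Q d e x \<bullet> y x) *\<^sub>R e) \<bullet> J x)"
      by (simp only: scaleR_inner_swap)
    also have "\<dots> = (\<E> x. ((Q d e x \<bullet> y x) *\<^sub>R e) \<bullet> J1 x)"
    proof (rule ce_inner_eq[where A=L])
      show "dep_on L (\<lambda>x. (Q d e x \<bullet> y x) *\<^sub>R e)"
        by (rule dep_on_comp2[where h="\<lambda>u v. (u \<bullet> v) *\<^sub>R e", OF dep_on_mono[OF Q_dep] dep_on_mono[OF yB BL]])
          (auto simp: L_def)
      show "integrable Om (\<lambda>x. ((Q d e x \<bullet> y x) *\<^sub>R e) \<bullet> J x)"
        unfolding scaleR_inner_swap[symmetric] by (intro iQ m)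
    qed (auto intro: L2_integrable' L4_L2' J4 simp: J1_def)
    also have "\<dots> = (\<E> x. Q d e x \<bullet> ((e \<bullet> J1 x) *\<^sub>R y x))" by (simp only: scaleR_inner_swap)
    also have "(\<E> x. R d e x \<bullet> ((e \<bullet> J1 x) *\<^sub>R y x)) = 0"
    proof -
      let ?g = "\<lambda>x. (e \<bullet> J1 x) *\<^sub>R y x"
      have g2: "Lk 2 Om ?g" by (intro L4_scaleR_L2 Lk_inner m)
      have gL: "dep_on L ?g"
        unfolding J1_def by (rule dep_on_comp2[where h="\<lambda>u v. (e \<bullet> u) *\<^sub>R v", OF dep_on_ce dep_on_mono[OF yB BL]])
      have i: "L \<inter> {..d} = {0<..d}" by (auto simp: L_def)
      have "(\<E> x. ?g x \<bullet> P d e x) = (\<E> x. ?g x \<bullet> ce {0<..d} (P d e) x)"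
      proof (rule ce_inner_eq[OF gL])
        show "AE x in Om. ce L (P d e) x = ce {0<..d} (P d e) x"
          using ce_of_dep[OF P_dep[OF d(1)], of L e] by (simp add: i)
      qed (use g2 in \<open>auto intro: L2_inner_integrable P_L2 P_integrable simp: Lk_def simp del: inner_scaleR_left inner_scaleR_right\<close>)
      moreover have "(\<E> x. R d e x \<bullet> ?g x) = (\<E> x. ?g x \<bullet> P d e x) - (\<E> x. ?g x \<bullet> ce {0<..d} (P d e) x)"
      proof -
        have "(\<E> x. R d e x \<bullet> ?g x) = (\<E> x. ?g x \<bullet> P d e x - ?g x \<bullet> ce {0<..d} (P d e) x)"
          by (intro Bochner_Integration.integral_cong refl) (simp only: R_def inner_commute[of _ "?g _"] inner_diff_right)
        also have "\<dots> = (\<E> x. ?g x \<bullet> P d e x) - (\<E> x. ?g x \<bullet> ce {0<..d} (P d e) x)"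
          by (intro Bochner_Integration.integral_diff L2_inner_integrable g2 P_L2 ce_L2(1))
        finally show ?thesis .
      qed
      ultimately show ?thesis by simp
    qed
    finally show ?thesis by simp
  qed
  have T1: "(\<Sum>e\<in>E. \<E> x. Q d e x \<bullet> ((e \<bullet> J1 x) *\<^sub>R y x)) \<le> pp d * (nrm2 Om J1 * z)"
    unfolding pp_def z_def by (rule tri_bound[OF Q_dep Q_L2 _ J14 y4 disjI2[OF yB]]) (auto simp: B_def)
  have T2: "(\<Sum>e\<in>E. \<E> x. R d e x \<bullet> ((e \<bullet> J2 x) *\<^sub>R y x)) \<le> ss d * (nrm2 Om J2 * z)"
    unfolding ss_def z_def by (rule tri_bound[OF R_dep[OF d(1)] R_L2 _ J24 y4 disjI2[OF yB]]) (auto simp: B_def)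
  have "cov d j \<le> D4 j + ((\<Sum>e\<in>E. \<E> x. Q d e x \<bullet> ((e \<bullet> J1 x) *\<^sub>R y x))
      + (\<Sum>e\<in>E. \<E> x. R d e x \<bullet> ((e \<bullet> J2 x) *\<^sub>R y x)))"
    using step1 by (simp only: step2 step3 sum.distrib)
  also have "\<dots> \<le> D4 j + (pp d * (nrm2 Om J1 * z) + ss d * (nrm2 Om J2 * z))"
    using T1 T2 by simp
  finally have main: "cov d j \<le> D4 j + z * (pp d * nrm2 Om J1 + ss d * nrm2 Om J2)"
    by (simp add: algebra_simps)
  have BX: "ce B (X j) = ce {d<..} (X j)"
  proof -
    have "{d<..} \<inter> {..j} = B" by (auto simp: B_def)
    then show ?thesis using ce_of_dep[OF X_dep[of j], of "{d<..}"] by simp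
  qed
  have loB: "nrm2 Om (ce B (X j)) = lo (j - d)" using X_lo[of j "j - d"] by (simp add: BX)
  have hiK: "nrm2 Om (ce K (X j)) = hi (j - d)" using X_hi[of j "j - d"] by (simp add: K_def)
  have J_sq: "(nrm2 Om J)\<^sup>2 = (nrm2 Om (X j))\<^sup>2 - (lo (j - d))\<^sup>2 - (hi (j - d))\<^sup>2"
    using interaction[OF X_L2 X_mean BK(1), of j] by (simp add: J_def loB hiK)
  have J12: "(nrm2 Om J1)\<^sup>2 + (nrm2 Om J2)\<^sup>2 = (nrm2 Om J)\<^sup>2"
    unfolding J2_def J1_def using ce_pyth[OF L4_L2'[OF J4], of L] by simp
  have i2: "nrm2 Om J2 \<le> D2 j"
    using interaction_deep[OF X_L2[of j] BL, of K] X_D2[of j j]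
    by (simp add: J2_def J1_def J_def L_def)
  have "(nrm2 Om J1)\<^sup>2 \<le> (D2 (j - d))\<^sup>2"
  proof -
    have "(D2 (j - d))\<^sup>2 = (nrm2 Om (X j))\<^sup>2 - (lo (j - d))\<^sup>2"
      using nrm2_compl_sq[OF X_L2[of j], of B] X_D2[of j "j - d"] loB by (simp add: BX)
    then show ?thesis using J_sq J12 zero_le_power2[of "nrm2 Om J2"] zero_le_power2[of "hi (j - d)"] by linarith
  qed
  then have i1: "nrm2 Om J1 \<le> D2 (j - d)"
    by (rule power2_le_imp_le) (simp add: D2_def nrm2_nonneg)
  show ?thesis
    by (intro exI[of _ "nrm2 Om J1"] exI[of _ "nrm2 Om J2"] exI[of _ z] conjI impI zhi z0 main i1 i2)
      (use J12 J_sq X_nrm2[of j] in \<open>auto simp: z_def nrm2_nonneg\<close>)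
qed


section \<open>Conditional expectation against coupling\<close>

text \<open>With \<open>r = \<phi> - E[\<phi> | L]\<close>, the coupling difference is \<open>a -
  b\<close> for two copies \<open>a, b\<close> of \<open>r\<close> that are independent given the
  innovations in \<open>L\<close>, with conditional mean zero. In the expansion of \<open>|a -
  b|\<^sup>4\<close> the terms of odd order in \<open>a\<close> or \<open>b\<close> have expectation
  zero, \<open>(a \<bullet> b)\<^sup>2\<close> is dropped, and \<open>E |a|\<^sup>2 |b|\<^sup>2 = E
  (E[|r|\<^sup>2 | L])\<^sup>2 \<ge> (E |r|\<^sup>2)\<^sup>2\<close>.\<close>

lemma D4_D2_delta:
  "(D4 j) ^ 4 + (D2 j) ^ 4 \<le> (\<integral>p. norm (\<phi> (fst p) - \<phi> (splice {-j<..} (fst p) (snd p))) ^ 4 \<partial>(Om \<Otimes>\<^sub>M Om)) / 2"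
proof -
  define L where "L = {-j<..}"
  define r where "r = (\<lambda>x. \<phi> x - ce L \<phi> x)"
  let ?OO = "Om \<Otimes>\<^sub>M Om"
  let ?a = "\<lambda>p. r (fst p)" and ?b = "\<lambda>p. r (splice L (fst p) (snd p))"
  have r4: "Lk 4 Om r" unfolding r_def by (intro L4_diff phi_L4 ce_L4)
  have r2: "Lk 2 Om r" by (rule L4_L2'[OF r4])
  have [measurable]: "r \<in> borel_measurable Om" using r4 by (simp add: Lk_def)
  have ir: "integrable Om r" by (rule L2_integrable'[OF r2])
  have i4: "integrable Om (\<lambda>x. norm (r x) ^ 4)" and i2: "integrable Om (\<lambda>x. norm (r x) ^ 2)"
    using r4 r2 by (auto simp: Lk_def)
  have f2: "Lk 2 Om (\<lambda>x. norm (r x) ^ 2)"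
    using r4 by (auto simp: Lk_def simp flip: power_mult)
  have phi: "\<phi> (fst p) - \<phi> (splice L (fst p) (snd p)) = ?a p - ?b p" for p
    unfolding r_def by (simp add: dep_onD[OF dep_on_ce])
  have ce_r: "AE x in Om. ce L r x = 0"
  proof -
    have iphi: "integrable Om \<phi>" by (rule L2_integrable'[OF L4_L2'[OF phi_L4]])
    show ?thesis
      unfolding r_def using ce_diff[OF iphi ce_integrable(1)[OF iphi, of L], of L] ce_ce[OF iphi, of L L]
      by eventually_elim simp
  qed
  have D: "(\<E> x. norm (r x) ^ 4) = D4 j ^ 4"
    unfolding D4_def r_def L_def by (subst real_root_pow_pos2) auto
  have UN: "splice UNIV x y = x" for x y :: "int \<Rightarrow> 's" by (simp add: splice_def)
  have ia: "integrable ?OO (\<lambda>p. norm (?a p) ^ 4)" and ea: "(\<integral>p. norm (?a p) ^ 4 \<partial>?OO) = D4 j ^ 4"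
    using integrable_splice[OF i4, of UNIV] D UN by auto
  have ib: "integrable ?OO (\<lambda>p. norm (?b p) ^ 4)" and eb: "(\<integral>p. norm (?b p) ^ 4 \<partial>?OO) = D4 j ^ 4"
    using integrable_splice[OF i4, of L] D by auto
  have young: "s ^ 2 * t ^ 2 \<le> s ^ 4 + t ^ 4" "s ^ 3 * t \<le> s ^ 4 + t ^ 4" if "0 \<le> s" "0 \<le> t" for s t :: real
  proof -
    have 1: "2 * (s^2 * t^2) \<le> s ^ 4 + t ^ 4"
      using sum_squares_bound[of "s^2" "t^2"] by (simp flip: power_mult)
    moreover have "0 \<le> s^2 * t^2" by simp
    ultimately show "s ^ 2 * t ^ 2 \<le> s ^ 4 + t ^ 4" by linarith
    have "2 * (s * t) \<le> s^2 + t^2" using sum_squares_bound[of s t] by simp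
    then have "s^2 * (2 * (s * t)) \<le> s^2 * (s^2 + t^2)" by (rule mult_left_mono) simp
    then have "2 * (s ^ 3 * t) \<le> s ^ 4 + s^2 * t^2" by (simp add: power2_eq_square eval_nat_numeral algebra_simps)
    then show "s ^ 3 * t \<le> s ^ 4 + t ^ 4" using 1 that zero_le_power[of s 4] zero_le_power[of t 4] by linarith
  qed
  have iab: "integrable ?OO (\<lambda>p. norm (?a p) ^ 2 * norm (?b p) ^ 2)"
    by (rule Bochner_Integration.integrable_bound[OF Bochner_Integration.integrable_add[OF ia ib]])
      (auto simp: young(1))
  have pw: "norm (norm u ^ 2 * (u \<bullet> v)) \<le> norm (norm u ^ 4 + norm v ^ 4)" for u v :: 'a
  proof -
    have "norm (norm u ^ 2 * (u \<bullet> v)) \<le> norm u ^ 2 * (norm u * norm v)"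
      by (simp add: abs_mult Cauchy_Schwarz_ineq2 mult_left_mono)
    also have "\<dots> = norm u ^ 3 * norm v" by (simp add: eval_nat_numeral)
    also have "\<dots> \<le> norm u ^ 4 + norm v ^ 4" by (rule young(2)) auto
    finally show ?thesis by simp
  qed
  have ic: "integrable ?OO (\<lambda>p. norm (?a p) ^ 2 * (?a p \<bullet> ?b p))"
    by (rule Bochner_Integration.integrable_bound[OF Bochner_Integration.integrable_add[OF ia ib]])
      (measurable, rule AE_I2, rule pw)
  have ic': "integrable ?OO (\<lambda>p. norm (?b p) ^ 2 * (?a p \<bullet> ?b p))"
    unfolding inner_commute[of "?a _"]
    by (rule Bochner_Integration.integrable_bound[OF Bochner_Integration.integrable_add[OF ib ia]])
      (measurable, rule AE_I2, rule pw)
  have eab: "D2 j ^ 4 \<le> (\<integral>p. norm (?a p) ^ 2 * norm (?b p) ^ 2 \<partial>?OO)"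
  proof -
    let ?f = "\<lambda>x. norm (r x) ^ 2"
    have c2: "Lk 2 Om (ce L ?f)" by (rule ce_L2[OF f2])
    have "(\<integral>p. ?f (fst p) * ?f (splice L (fst p) (snd p)) \<partial>?OO) = (\<E> x. ?f x * ce L ?f x)"
      using OO.integral_fst'[OF iab] by (simp add: ce_def)
    also have "\<dots> = (\<E> x. ce L ?f x * ?f x)" by (simp add: mult.commute)
    also have "\<dots> = (\<E> x. ce L ?f x * ce L ?f x)"
      by (rule ce_module(2)[OF bounded_bilinear_mult dep_on_ce])
        (use f2 c2 i2 in \<open>auto intro: L2_mult_integrable simp: Lk_def\<close>)
    also have "\<dots> \<ge> (\<E> x. ce L ?f x)\<^sup>2"
      using integral_square_le(2)[OF Om.prob_space_axioms, of "ce L ?f"] c2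
      by (auto simp: Lk_def power2_eq_square)
    finally have "(\<E> x. ?f x)\<^sup>2 \<le> (\<integral>p. ?f (fst p) * ?f (splice L (fst p) (snd p)) \<partial>?OO)"
      by (simp add: ce_integrable(2)[OF i2])
    moreover have "(\<E> x. ?f x) = (D2 j)\<^sup>2" by (simp add: D2_def nrm2_sq r_def L_def)
    ultimately show ?thesis by (simp flip: power_mult)
  qed
  have ec: "(\<integral>p. norm (?a p) ^ 2 * (?a p \<bullet> ?b p) \<partial>?OO) = 0"
  proof -
    have "(\<integral>p. norm (?a p) ^ 2 * (?a p \<bullet> ?b p) \<partial>?OO) = (\<E> x. \<E> y. norm (r x) ^ 2 * (r x \<bullet> r (splice L x y)))"
      using OO.integral_fst'[OF ic] by simp
    also have "\<dots> = (\<E> x. 0)"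
    proof (rule integral_cong_AE)
      show "AE x in Om. (\<E> y. norm (r x) ^ 2 * (r x \<bullet> r (splice L x y))) = 0"
        using AE_integrable_splice[OF ir, of L] ce_r
        by eventually_elim (simp add: ce_def)
      show "(\<lambda>x. \<E> y. norm (r x) ^ 2 * (r x \<bullet> r (splice L x y))) \<in> borel_measurable Om"
        using OO.integrable_fst'[OF ic] by auto
    qed simp
    finally show ?thesis by simp
  qed
  have ec': "(\<integral>p. norm (?b p) ^ 2 * (?a p \<bullet> ?b p) \<partial>?OO) = 0"
  proof -
    let ?h = "\<lambda>x. norm (r x) ^ 2 *\<^sub>R r x"
    have i3: "integrable Om ?h"
    proof (rule Bochner_Integration.integrable_bound[OF Bochner_Integration.integrable_add[OF i4 Om.integrable_const[of 1]]])
      show "AE x in Om. norm (?h x) \<le> norm (norm (r x) ^ 4 + 1)"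
      proof (rule AE_I2)
        fix x
        have "norm (?h x) = norm (r x) ^ 3" by (simp add: eval_nat_numeral)
        then show "norm (?h x) \<le> norm (norm (r x) ^ 4 + 1)" using young(2)[of "norm (r x)" 1] by simp
      qed
    qed simp
    have AEh: "AE x in Om. (\<E> y. norm (r (splice L x y)) ^ 2 * (r x \<bullet> r (splice L x y))) = ce L ?h x \<bullet> r x"
      using AE_integrable_splice[OF i3, of L]
    proof eventually_elim
      fix x assume i: "integrable Om (\<lambda>y. ?h (splice L x y))"
      have "(\<E> y. norm (r (splice L x y)) ^ 2 * (r x \<bullet> r (splice L x y))) = (\<E> y. r x \<bullet> ?h (splice L x y))"
        by simp
      also have "\<dots> = r x \<bullet> ce L ?h x" unfolding ce_def using i by (intro integral_inner_right) simp
      finally show "(\<E> y. norm (r (splice L x y)) ^ 2 * (r x \<bullet> r (splice L x y))) = ce L ?h x \<bullet> r x"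
        by (simp add: inner_commute)
    qed
    have ih: "integrable Om (\<lambda>x. \<E> y. norm (r (splice L x y)) ^ 2 * (r x \<bullet> r (splice L x y)))"
      using OO.integrable_fst'[OF ic'] by simp
    have i: "integrable Om (\<lambda>x. ce L ?h x \<bullet> r x)"
      by (rule integrable_cong_AE_imp[OF ih _ AEh]) measurable
    have "(\<integral>p. norm (?b p) ^ 2 * (?a p \<bullet> ?b p) \<partial>?OO) = (\<E> x. \<E> y. norm (r (splice L x y)) ^ 2 * (r x \<bullet> r (splice L x y)))"
      using OO.integral_fst'[OF ic'] by simp
    also have "\<dots> = (\<E> x. ce L ?h x \<bullet> r x)"
      using ih AEh by (intro integral_cong_AE) auto
    also have "\<dots> = (\<E> x. ce L ?h x \<bullet> 0)"
      by (rule ce_inner_eq[OF dep_on_ce _ i ir _ ce_r]) auto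
    finally show ?thesis by simp
  qed
  have pt: "norm (a - b) ^ 4 \<ge> norm a ^ 4 + norm b ^ 4 + 2 * (norm a ^ 2 * norm b ^ 2)
      - 4 * (norm a ^ 2 * (a \<bullet> b)) - 4 * (norm b ^ 2 * (a \<bullet> b))" for a b :: 'a
  proof -
    have "norm (a - b) ^ 2 = norm a ^ 2 + norm b ^ 2 - 2 * (a \<bullet> b)"
      by (simp add: power2_norm_eq_inner inner_diff inner_commute)
    then have "norm (a - b) ^ 4 = (norm a ^ 2 + norm b ^ 2 - 2 * (a \<bullet> b))^2"
      by (metis mult_2_right numeral_Bit0 power_add power2_eq_square)
    also have "\<dots> = norm a ^ 4 + norm b ^ 4 + 2 * (norm a ^ 2 * norm b ^ 2)
      - 4 * (norm a ^ 2 * (a \<bullet> b)) - 4 * (norm b ^ 2 * (a \<bullet> b)) + 4 * (a \<bullet> b)^2"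
      by (simp add: power2_eq_square eval_nat_numeral algebra_simps)
    finally show ?thesis using zero_le_power2[of "a \<bullet> b"] by linarith
  qed
  have iD: "integrable ?OO (\<lambda>p. norm (?a p - ?b p) ^ 4)"
  proof (rule Bochner_Integration.integrable_bound[of _ "\<lambda>p. 8 * norm (?a p) ^ 4 + 8 * norm (?b p) ^ 4"])
    show "integrable ?OO (\<lambda>p. 8 * norm (?a p) ^ 4 + 8 * norm (?b p) ^ 4)" using ia ib by simp
    show "AE p in ?OO. norm (norm (?a p - ?b p) ^ 4) \<le> norm (8 * norm (?a p) ^ 4 + 8 * norm (?b p) ^ 4)"
      using norm_add_pow4[of "?a _" "- ?b _"] by auto
  qed measurable
  have "2 * (D4 j ^ 4 + D2 j ^ 4) \<le> (\<integral>p. norm (?a p) ^ 4 \<partial>?OO) + (\<integral>p. norm (?b p) ^ 4 \<partial>?OO)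
      + 2 * (\<integral>p. norm (?a p) ^ 2 * norm (?b p) ^ 2 \<partial>?OO) - 4 * (\<integral>p. norm (?a p) ^ 2 * (?a p \<bullet> ?b p) \<partial>?OO)
      - 4 * (\<integral>p. norm (?b p) ^ 2 * (?a p \<bullet> ?b p) \<partial>?OO)"
    unfolding ea eb ec ec' using eab by simp
  also have "\<dots> = (\<integral>p. norm (?a p) ^ 4 + norm (?b p) ^ 4 + 2 * (norm (?a p) ^ 2 * norm (?b p) ^ 2)
      - 4 * (norm (?a p) ^ 2 * (?a p \<bullet> ?b p)) - 4 * (norm (?b p) ^ 2 * (?a p \<bullet> ?b p)) \<partial>?OO)"
    using ia ib iab ic ic' by simp
  also have "\<dots> \<le> (\<integral>p. norm (?a p - ?b p) ^ 4 \<partial>?OO)"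
    using ia ib iab ic ic' by (intro integral_mono iD pt) simp
  finally show ?thesis by (simp add: phi flip: L_def)
qed

end

section \<open>The inequality for one lag\<close>

lemma real_cs2: fixes a b c d :: real shows "a * c + b * d \<le> sqrt (a\<^sup>2 + b\<^sup>2) * sqrt (c\<^sup>2 + d\<^sup>2)"
proof -
  have "(a * c + b * d)\<^sup>2 \<le> (a\<^sup>2 + b\<^sup>2) * (c\<^sup>2 + d\<^sup>2)"
    using zero_le_power2[of "a * d - b * c"] by (simp add: power2_eq_square algebra_simps)
  then show ?thesis by (metis real_le_rsqrt real_sqrt_mult)
qed

lemma half_product: fixes a b :: real assumes "a\<^sup>2 + b\<^sup>2 \<le> 1" shows "a * b \<le> 1 / 2"
  using assms sum_squares_bound[of a b] by linarith

text \<open>For fixed \<open>z\<close> and \<open>J\<close> the left-hand side is maximised: \<open>s =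
  \<surd>(1 - p\<^sup>2)\<close> is the worst case, and then also \<open>i2 = e\<close> if \<open>p
  e \<le> s\<close>; otherwise \<open>z\<close> is at most \<open>e\<close>. The resulting function
  of \<open>p\<close> is concave. If it is increasing up to the end point \<open>p = U\<close>, its
  value there is the first alternative for \<open>V\<close>; if not, \<open>z \<le> 0.8\<close> and
  crude bounds on \<open>V\<close> are enough. The term \<open>p e\<close> on the left is the amount
  set aside for the lag \<open>k + d\<close>.\<close>

lemma saturate:
  fixes z p s i1 i2 J e :: real
  assumes nn: "0 \<le> z" "0 \<le> p" "0 \<le> s" "0 \<le> i1" "0 \<le> i2" "0 \<le> J" and ps: "p\<^sup>2 + s\<^sup>2 \<le> 1"
    and zp: "z\<^sup>2 + p\<^sup>2 \<le> 1" and i: "i1\<^sup>2 + i2\<^sup>2 \<le> J\<^sup>2" and J1: "J \<le> 1" and i2: "i2 \<le> e" and e: "e \<le> 0.4502"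
  defines "l \<equiv> 1 - e / 2" and "U \<equiv> sqrt (1 - z\<^sup>2)"
  shows "\<exists>V. z * (p * i1 + s * i2 + p * e) \<le> z * p * J + e * V \<and>
     (V = z\<^sup>2 + l * z * U \<or> V \<le> 1 \<and> V \<le> sqrt 2 * z \<and> z \<le> 0.8)"
proof -
  have e0: "0 \<le> e" using nn i2 by linarith
  define t where "t = sqrt (1 - p\<^sup>2)"
  have z1: "z\<^sup>2 \<le> 1" using zp zero_le_power2[of p] by linarith
  have p1: "p\<^sup>2 \<le> 1" using zp zero_le_power2[of z] by linarith
  have st: "s \<le> t" unfolding t_def using ps by (intro real_le_rsqrt) simp
  have zt: "z \<le> t" unfolding t_def using zp by (intro real_le_rsqrt) simp
  have pU: "p \<le> U" unfolding U_def using zp by (intro real_le_rsqrt) simp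
  have t0: "0 \<le> t" using st nn by linarith
  have tt: "t\<^sup>2 + p\<^sup>2 = 1" unfolding t_def using p1 by simp
  have UU: "U\<^sup>2 + z\<^sup>2 = 1" unfolding U_def using z1 by simp
  have U0: "0 \<le> U" using pU nn by linarith
  have "i2\<^sup>2 \<le> J\<^sup>2" using i zero_le_power2[of i1] by linarith
  then have i2J: "i2 \<le> J" using nn by (auto intro: power2_le_imp_le)
  have i1J: "i1 \<le> J - i2\<^sup>2 / 2"
  proof (rule power2_le_imp_le)
    have "J * i2\<^sup>2 \<le> i2\<^sup>2" using J1 by (simp add: mult_left_le_one_le nn)
    moreover have "(J - i2\<^sup>2 / 2)\<^sup>2 = J\<^sup>2 - J * i2\<^sup>2 + (i2\<^sup>2)\<^sup>2 / 4"
      by (simp add: power2_eq_square field_simps)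
    moreover have "0 \<le> (i2\<^sup>2)\<^sup>2 / 4" by simp
    ultimately show "i1\<^sup>2 \<le> (J - i2\<^sup>2 / 2)\<^sup>2" using i by linarith
    have "i2 * i2 \<le> 1 * J" using i2J J1 nn by (intro mult_mono) auto
    then show "0 \<le> J - i2\<^sup>2 / 2" using nn unfolding power2_eq_square by linarith
  qed
  have l: "0.7 \<le> l" "l \<le> 1" using e e0 by (auto simp: l_def)
  have st2: "t + p \<le> sqrt 2"
    using real_cs2[of 1 t 1 p] tt by simp
  show ?thesis
  proof (cases "p * e \<le> t")
    case False
    have "p \<le> 1" using p1 by (simp add: power_le_one_iff nn)
    then have "p * e \<le> 1 * e" using e0 by (intro mult_right_mono)
    then have ze: "z \<le> e" using False zt by linarith
    have "p * i1 + s * i2 + p * e \<le> p * J + (t + p) * e"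
    proof -
      have "i1 \<le> J" by (rule order_trans[OF i1J]) simp
      then have "p * i1 \<le> p * J" using nn by (intro mult_left_mono)
      moreover have "s * i2 \<le> t * e" using st i2 nn t0 by (intro mult_mono) auto
      ultimately show ?thesis by (simp add: algebra_simps)
    qed
    then have "z * (p * i1 + s * i2 + p * e) \<le> z * (p * J + (t + p) * e)" using nn by (intro mult_left_mono)
    also have "\<dots> \<le> z * p * J + e * (z * (t + p))" by (simp add: algebra_simps)
    finally have 1: "z * (p * i1 + s * i2 + p * e) \<le> z * p * J + e * (z * (t + p))" .
    have 2: "z * (t + p) \<le> sqrt 2 * z" using st2 nn by (simp add: mult.commute mult_left_mono)
    have "sqrt 2 \<le> 2" using real_sqrt_le_mono[of 2 4] by simp
    then have "sqrt 2 * z \<le> 2 * z" using nn by (intro mult_right_mono)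
    moreover have "z \<le> 1 / 2" using ze e by simp
    ultimately have "z * (t + p) \<le> 1" "z \<le> 0.8" using 2 by (linarith, simp)
    then show ?thesis using 1 2 by (intro exI[of _ "z * (t + p)"]) simp
  next
    case True
    have "p * i1 + s * i2 + p * e \<le> p * J + e * (t + l * p)"
    proof -
      have "p * i1 \<le> p * (J - i2\<^sup>2 / 2)" using i1J nn by (intro mult_left_mono)
      moreover have "s * i2 \<le> t * i2" using st nn by (intro mult_right_mono)
      \<comment> \<open>the gain from raising \<open>i2\<close> to \<open>e\<close>\<close>
      moreover have "0 \<le> (e - i2) * (t - p * (e + i2) / 2)"
      proof -
        have "p * i2 \<le> p * e" using i2 nn by (intro mult_left_mono)
        then show ?thesis using i2 True by (intro mult_nonneg_nonneg) (auto simp: algebra_simps)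
      qed
      moreover have "p * (J - i2\<^sup>2 / 2) = p * J - p * i2\<^sup>2 / 2"
        "(e - i2) * (t - p * (e + i2) / 2) = e * t - t * i2 - p * e\<^sup>2 / 2 + p * i2\<^sup>2 / 2"
        "e * (t + l * p) = e * t + p * e - p * e\<^sup>2 / 2"
        by (simp_all add: l_def field_simps power2_eq_square)
      ultimately show ?thesis by linarith
    qed
    then have "z * (p * i1 + s * i2 + p * e) \<le> z * (p * J + e * (t + l * p))" using nn by (intro mult_left_mono)
    also have "\<dots> = z * p * J + e * (z * (t + l * p))" by (simp add: algebra_simps)
    finally have 1: "z * (p * i1 + s * i2 + p * e) \<le> z * p * J + e * (z * (t + l * p))" .
    show ?thesis
    proof (cases "U \<le> l * z")
      case True
      have "t + l * p \<le> z + l * U"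
      proof (cases "z = 0")
        case True
        then have "U = 0" using \<open>U \<le> l * z\<close> U0 by simp
        then show ?thesis using True UU by simp
      next
        case False
        then have z: "0 < z" using nn by simp
        have "(t - z) * (t + z) = (U - p) * (U + p)" using tt UU by (simp add: algebra_simps power2_eq_square)
        moreover have "(t - z) * (2 * z) \<le> (t - z) * (t + z)" using zt by (intro mult_left_mono) auto
        moreover have "(U - p) * (U + p) \<le> (U - p) * (2 * (l * z))" using pU \<open>U \<le> l * z\<close> by (intro mult_left_mono) auto
        ultimately have "(t - z) * (2 * z) \<le> (l * (U - p)) * (2 * z)" by (simp add: algebra_simps)
        then have "t - z \<le> l * (U - p)" using z by simp
        then show ?thesis by (simp add: algebra_simps)
      qed
      then have "z * (t + l * p) \<le> z * (z + l * U)" using nn by (intro mult_left_mono)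
      then have "z * (t + l * p) \<le> z\<^sup>2 + l * z * U" by (simp add: algebra_simps power2_eq_square)
      then have "e * (z * (t + l * p)) \<le> e * (z\<^sup>2 + l * z * U)" using e0 by (intro mult_left_mono)
      then show ?thesis using 1 by (intro exI[of _ "z\<^sup>2 + l * z * U"]) simp
    next
      case False
      have "t + l * p \<le> t + p" using l nn by (simp add: mult_left_le_one_le)
      then have 2: "z * (t + l * p) \<le> sqrt 2 * z" using st2 nn
        by (subst mult.commute[of _ z]) (intro mult_left_mono, auto)
      have "(l * z)\<^sup>2 \<le> U\<^sup>2" using False nn l by (intro power_mono) auto
      then have zl: "(1 + l\<^sup>2) * z\<^sup>2 \<le> 1" using UU by (simp add: power_mult_distrib algebra_simps)
      have "t + l * p \<le> sqrt (1 + l\<^sup>2)" using real_cs2[of 1 t l p] tt by simp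
      then have "z * (t + l * p) \<le> z * sqrt (1 + l\<^sup>2)" using nn by (intro mult_left_mono)
      also have "\<dots> = sqrt ((1 + l\<^sup>2) * z\<^sup>2)" using nn by (simp add: real_sqrt_mult)
      also have "\<dots> \<le> 1" using zl by simp
      finally have 3: "z * (t + l * p) \<le> 1" .
      have "0.7\<^sup>2 \<le> l\<^sup>2" using l by (intro power_mono) auto
      then have "(1 + 0.58) * z\<^sup>2 \<le> (1 + l\<^sup>2) * z\<^sup>2" if "0.58 \<le> l\<^sup>2" using that by (intro mult_right_mono) auto
      moreover have "0.58 \<le> l\<^sup>2"
      proof -
        have "0.7749 \<le> l" using e by (simp add: l_def)
        then have "0.7749\<^sup>2 \<le> l\<^sup>2" by (intro power_mono) auto
        then show ?thesis by (simp add: power2_eq_square)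
      qed
      ultimately have "z\<^sup>2 \<le> 0.8\<^sup>2" using zl by (simp add: power2_eq_square)
      then have "z \<le> 0.8" by (rule power2_le_imp_le) simp
      then show ?thesis using 1 2 3 by (intro exI[of _ "z * (t + l * p)"]) simp
    qed
  qed
qed

lemma affine_le:
  fixes e e1 K0 K1 R B :: real
  assumes "0 \<le> e" "e \<le> e1" "K0 \<le> R" "K0 + e1 * K1 \<le> R + e1 * B"
  shows "K0 + e * K1 \<le> R + e * B"
proof (cases "K1 \<le> B")
  case True
  then have "e * K1 \<le> e * B" using assms by (intro mult_left_mono)
  then show ?thesis using assms by linarith
next
  case False
  then have "e * (K1 - B) \<le> e1 * (K1 - B)" using assms by (intro mult_right_mono) auto
  then show ?thesis using assms by (simp add: algebra_simps)
qed

lemma quadratic_le: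
  fixes b A B C :: real
  assumes "0 < A" "B\<^sup>2 \<le> 4 * A * C" shows "B * b - A * b\<^sup>2 \<le> C"
proof -
  have "0 \<le> (2 * A * b - B)\<^sup>2" by simp
  then have "0 \<le> 4 * A * (C - (B * b - A * b\<^sup>2)) + (B\<^sup>2 - 4 * A * C)"
    by (simp add: power2_eq_square algebra_simps)
  then have "0 \<le> 4 * A * (C - (B * b - A * b\<^sup>2))" using assms by linarith
  then show ?thesis using assms by (simp add: zero_le_mult_iff)
qed

text \<open>The constants are those of \<open>lag_data.good\<close>: \<open>0.138211\<close> is just
  below \<open>34/105 / (82/35)\<close>, and \<open>1.41448\<close> just below \<open>(4 \<surd>2 -
  82/35) / (82/35)\<close>, which is what remains of the budget \<open>2 \<surd>2 (a + e)\<close>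
  after \<open>82/35 a\<close> has been paid, as \<open>e \<le> a\<close>. The expression is concave
  in \<open>e\<close>, so it is bounded by affine functions of \<open>e\<close>, which are compared
  at the ends of two intervals.\<close>

lemma good_scalar:
  fixes z U e V :: real
  assumes z: "0 \<le> z" and U: "0 \<le> U" and zU: "z\<^sup>2 + U\<^sup>2 = 1" and e: "0 \<le> e" "e \<le> 0.4502"
    and V: "V = z\<^sup>2 + (1 - e / 2) * z * U \<or> V \<le> 1 \<and> V \<le> sqrt 2 * z \<and> z \<le> 0.8"
  shows "0.386 * z * U ^ 3 + e * (z * U) + e * V \<le> 0.138211 + e * 1.41448"
proof -
  define b where "b = U\<^sup>2"
  define P where "P = z * U"
  have b: "0 \<le> b" "b \<le> 1" using zU by (auto simp: b_def) (metis add_increasing order_refl zero_le_power2)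
  have zb: "z\<^sup>2 = 1 - b" using zU by (simp add: b_def)
  have P0: "0 \<le> P" using z U by (simp add: P_def)
  have PP: "P\<^sup>2 = (1 - b) * b" by (simp add: P_def power_mult_distrib zb b_def)
  have P2: "P \<le> 1 / 2" unfolding P_def using zU by (intro half_product) simp
  \<comment> \<open>tangent to the square root of \<open>b (1 - b)\<close> at \<open>0.48\<^sup>2\<close>\<close>
  have P3: "P \<le> 0.24 + 1.041667 * (b * (1 - b))"
  proof -
    have "0 \<le> (P - 0.48)\<^sup>2" by simp
    then have "0.96 * P \<le> P\<^sup>2 + 0.2304" by (simp add: power2_eq_square algebra_simps)
    moreover have "P\<^sup>2 = b * (1 - b)" unfolding PP by simp
    moreover define t where "t = b * (1 - b)"
    moreover have "0 \<le> t" using b by (simp add: t_def)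
    ultimately have "0.96 * P \<le> t + 0.2304" "0 \<le> t" by simp_all
    then show ?thesis unfolding t_def[symmetric] by simp
  qed
  have U3: "0.386 * z * U ^ 3 = 0.386 * P * b"
    by (simp add: P_def b_def eval_nat_numeral)
  have bb: "b * (b * (1 - b)) \<le> b / 4"
  proof -
    have "b * (1 - b) \<le> 1 / 4" using zero_le_power2[of "b - 1/2"] by (simp add: power2_eq_square algebra_simps)
    then have "b * (b * (1 - b)) \<le> b * (1 / 4)" using b by (intro mult_left_mono) auto
    then show ?thesis by simp
  qed
  have K0: "0.386 * P * b \<le> 0.138211"
  proof -
    \<comment> \<open>the cubic \<open>b\<^sup>2 (1 - b)\<close> lies below its tangent at \<open>3/4\<close>\<close>
    have "0 \<le> (b - 3/4)\<^sup>2 * (b + 1/2)" using b by simp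
    also have "\<dots> = 9/32 - 3/16 * b - b * (b * (1 - b))" by (simp add: power2_eq_square field_simps)
    finally have t: "b * (b * (1 - b)) \<le> 0.28125 - 0.1875 * b" by simp
    have "P * b \<le> (0.24 + 1.041667 * (b * (1 - b))) * b" using P3 b by (intro mult_right_mono)
    also have "\<dots> = 0.24 * b + 1.041667 * (b * (b * (1 - b)))" by (simp add: algebra_simps)
    also have "\<dots> \<le> 0.24 * b + 1.041667 * (0.28125 - 0.1875 * b)" using t by simp
    also have "\<dots> \<le> 0.34" using b by (simp add: field_simps)
    finally have "P * b \<le> 0.34" .
    then show ?thesis by simp
  qed
  have m33: "(0.386 * b + 0.66) * P + 0.33 * (1 - b) \<le> 0.6047"
  proof -
    have "(0.386 * b + 0.66) * P + 0.33 * (1 - b) \<le> (0.386 * b + 0.66) * (0.24 + 1.041667 * (b * (1 - b))) + 0.33 * (1 - b)"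
      using P3 b by (intro add_right_mono mult_left_mono) auto
    also have "\<dots> = 0.402083462 * (b * (b * (1 - b))) + 0.68750022 * (b * (1 - b)) + 0.09264 * b + 0.1584 + 0.33 - 0.33 * b"
      by (simp add: field_simps)
    also have "\<dots> \<le> 0.402083462 * (b / 4) + 0.68750022 * (b * (1 - b)) + 0.09264 * b + 0.1584 + 0.33 - 0.33 * b"
      using bb by simp
    also have "\<dots> \<le> 0.4884 + (0.5507 * b - 0.6875 * b\<^sup>2)"
    proof -
      have "0 \<le> b\<^sup>2" by simp
      then show ?thesis using b by (simp add: power2_eq_square field_simps)
    qed
    also have "0.5507 * b - 0.6875 * b\<^sup>2 \<le> 0.1163"
      by (rule quadratic_le) (auto simp: power2_eq_square)
    finally show ?thesis by simp
  qed
  show ?thesis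
  proof (cases "V = z\<^sup>2 + (1 - e / 2) * z * U")
    case True
    have tot: "0.386 * z * U ^ 3 + e * (z * U) + e * V = 0.386 * P * b + e * (1 - b) + (2 * e - e\<^sup>2 / 2) * P"
      unfolding U3 True zb by (simp add: P_def power2_eq_square algebra_simps)
    show ?thesis
    proof (cases "e \<le> 0.33")
      case e33: True
      have k: "0.386 * P * b + 0.33 * ((1 - b) + 2 * P) \<le> 0.138211 + 0.33 * 1.41448"
        using m33 by (simp add: field_simps)
      have "0.386 * P * b + e * ((1 - b) + 2 * P) \<le> 0.138211 + e * 1.41448"
        by (rule affine_le[OF e(1) e33 K0 k])
      moreover have "(2 * e - e\<^sup>2 / 2) * P \<le> 2 * e * P" using P0 by (intro mult_right_mono) auto
      ultimately show ?thesis unfolding tot by (simp add: algebra_simps)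
    next
      case e33: False
      \<comment> \<open>tangent to \<open>e\<^sup>2 / 2\<close> at \<open>0.39\<close>\<close>
      have e2: "0.39 * e - 0.07605 \<le> e\<^sup>2 / 2"
        using zero_le_power2[of "e - 0.39"] by (simp add: power2_eq_square algebra_simps)
      have "(0.386 * b + 0.80088) * P + 0.4502 * (1 - b) \<le> (0.386 * b + 0.80088) * (0.24 + 1.041667 * (b * (1 - b))) + 0.4502 * (1 - b)"
        using P3 b by (intro add_right_mono mult_left_mono) auto
      also have "\<dots> = 0.402083462 * (b * (b * (1 - b))) + 0.83425026696 * (b * (1 - b)) + 0.09264 * b + 0.1922112 + 0.4502 - 0.4502 * b"
        by (simp add: field_simps)
      also have "\<dots> \<le> 0.402083462 * (b / 4) + 0.83425026696 * (b * (1 - b)) + 0.09264 * b + 0.1922112 + 0.4502 - 0.4502 * b"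
        using bb by simp
      also have "\<dots> \<le> 0.6425 + (0.5773 * b - 0.8342 * b\<^sup>2)"
      proof -
        have "0 \<le> b\<^sup>2" by simp
        then show ?thesis using b by (simp add: power2_eq_square field_simps)
      qed
      also have "0.5773 * b - 0.8342 * b\<^sup>2 \<le> 0.13"
        by (rule quadratic_le) (auto simp: power2_eq_square)
      finally have k: "0.386 * P * b + 0.07605 * P + 0.4502 * ((1 - b) + 1.61 * P) \<le> 0.138211 + 0.4502 * 1.41448"
        using P0 by (simp add: field_simps)
      have "0.386 * P * b + e * ((1 - b) + 1.61 * P) + 0.07605 * P \<le> 0.138211 + e * 1.41448"
      proof (cases "(1 - b) + 1.61 * P \<le> 1.41448")
        case True
        then have "e * ((1 - b) + 1.61 * P) \<le> e * 1.41448" using e by (intro mult_left_mono)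
        moreover have "0.386 * P * b + 0.07605 * P + 0.33 * ((1 - b) + 1.61 * P) \<le> 0.138211 + 0.33 * 1.41448"
          using m33 P0 by (simp add: field_simps)
        moreover have "(e - 0.33) * ((1 - b) + 1.61 * P) \<le> (e - 0.33) * 1.41448"
          using True e33 by (intro mult_left_mono) auto
        ultimately show ?thesis by (simp add: field_simps)
      next
        case False
        then have "(0.4502 - e) * 1.41448 \<le> (0.4502 - e) * ((1 - b) + 1.61 * P)"
          using e by (intro mult_left_mono) auto
        then show ?thesis using k by (simp add: field_simps)
      qed
      moreover have "(2 * e - e\<^sup>2 / 2) * P \<le> (1.61 * e + 0.07605) * P" using P0 e2 by (intro mult_right_mono) auto
      ultimately show ?thesis unfolding tot by (simp add: algebra_simps)
    qed
  next
    case False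
    then have V: "V \<le> 1" "V \<le> sqrt 2 * z" using V by auto
    have zb1: "0.386 * P * b \<le> 0.193 * b" using P2 b mult_right_mono[of P "1/2" b] by simp
    show ?thesis
    proof (cases "b \<le> 1 / 2")
      case True
      have "e * P \<le> e * (1 / 2)" "e * V \<le> e * 1" using P2 V e by (intro mult_left_mono; simp)+
      then show ?thesis unfolding U3 P_def[symmetric] using zb1 True e by simp
    next
      case b2: False
      have s2: "sqrt 2 \<le> 1.41422" by (rule real_le_lsqrt) (auto simp: power2_eq_square)
      have "z\<^sup>2 \<le> 0.70711\<^sup>2" using b2 zb by (simp add: power2_eq_square)
      then have z7: "z \<le> 0.70711" by (rule power2_le_imp_le) simp
      have V2: "V \<le> 1.41422 * z" using V(2) mult_right_mono[OF s2 z] by linarith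
      have "0.386 * P * b + 0.4502 * (P + 1.41422 * z) \<le> 0.193 * (1 - z\<^sup>2) + 0.2251 + 0.636682 * z"
        using zb1 P2 zb z by (simp add: field_simps)
      also have "\<dots> \<le> 0.138211 + 0.4502 * 1.41448"
      proof -
        have "0 \<le> (0.70711 - z) * (0.636682 - 0.193 * (0.70711 + z))" using z7 by (intro mult_nonneg_nonneg) auto
        then show ?thesis by (simp add: power2_eq_square field_simps)
      qed
      finally have "0.386 * P * b + 0.4502 * (P + 1.41422 * z) \<le> 0.138211 + 0.4502 * 1.41448" .
      from affine_le[OF e K0 this]
      have "0.386 * P * b + e * (P + 1.41422 * z) \<le> 0.138211 + e * 1.41448" .
      moreover have "e * V \<le> e * (1.41422 * z)" using V2 e by (intro mult_left_mono)
      ultimately show ?thesis unfolding U3 P_def[symmetric] by (simp add: algebra_simps)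
    qed
  qed
qed

text \<open>As \<open>good_scalar\<close>, with twice the constant term. For fixed \<open>e\<close> the
  left-hand side is a quadratic form in \<open>(z, U)\<close>, up to a term linear in
  \<open>z\<close>, and its discriminant is checked.\<close>

lemma bad_scalar:
  fixes z U e V :: real
  assumes z: "0 \<le> z" and U: "0 \<le> U" and zU: "z\<^sup>2 + U\<^sup>2 = 1" and e: "0 \<le> e" "e \<le> 0.378"
    and V: "V = z\<^sup>2 + (1 - e / 2) * z * U \<or> V \<le> 1 \<and> V \<le> sqrt 2 * z \<and> z \<le> 0.8"
  shows "1 / 2 * (z * U) + 1 / 2 * (z * e) + e * V \<le> 0.276422 + e * 1.41448"
proof (cases "V = z\<^sup>2 + (1 - e / 2) * z * U")
  case True
  define k where "k = 1 / 2 + e - e\<^sup>2 / 2"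
  define A where "A = 1.2907 * e"
  define m where "m = 0.276422 + 1.19948 * e"
  \<comment> \<open>makes the linear term quadratic; the square vanishes at \<open>z = 0.86\<close>\<close>
  have z2: "z \<le> 0.5814 * z\<^sup>2 + 0.43"
  proof -
    have "0 \<le> (z - 0.86)\<^sup>2" by simp
    then have "1.72 * z \<le> z\<^sup>2 + 0.7396" by (simp add: power2_eq_square algebra_simps)
    moreover define q where "q = z\<^sup>2"
    moreover have "0 \<le> q" by (simp add: q_def)
    ultimately have "1.72 * z \<le> q + 0.7396" "0 \<le> q" by simp_all
    then show ?thesis unfolding q_def[symmetric] by simp
  qed
  have "1 / 2 * (z * e) \<le> 1 / 2 * ((0.5814 * z\<^sup>2 + 0.43) * e)" using z2 e by (intro mult_left_mono mult_right_mono) auto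
  then have 1: "1 / 2 * (z * U) + 1 / 2 * (z * e) + e * V \<le> k * (z * U) + A * z\<^sup>2 + 0.215 * e"
    unfolding True k_def A_def by (simp add: power2_eq_square algebra_simps)
  have m0: "0 < m" using e by (simp add: m_def)
  have mA: "m - A = 0.276422 - 0.09122 * e" by (simp add: m_def A_def)
  have "k\<^sup>2 \<le> 4 * m * (m - A)"
  proof -
    have "0 \<le> (0.378 - e) * e" using e by simp
    then have q: "e\<^sup>2 \<le> 0.378 * e" by (simp add: power2_eq_square algebra_simps)
    have c: "e\<^sup>2 * e\<^sup>2 / 4 \<le> e * e\<^sup>2"
    proof -
      have "e\<^sup>2 * e \<le> e\<^sup>2 * 4" using e by (intro mult_left_mono) auto
      then have "(e\<^sup>2 * e) * e \<le> (e\<^sup>2 * 4) * e" using e by (intro mult_right_mono)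
      then show ?thesis by (simp add: power2_eq_square algebra_simps)
    qed
    have kk: "k\<^sup>2 = 0.25 + e + e\<^sup>2 / 2 - e * e\<^sup>2 + e\<^sup>2 * e\<^sup>2 / 4"
      by (simp add: k_def power2_eq_square field_simps)
    have mm: "4 * m * (m - A) = 4 * 0.276422 * 0.276422 + 4 * 0.276422 * (1.19948 - 0.09122) * e - 4 * 1.19948 * 0.09122 * e\<^sup>2"
      unfolding mA unfolding m_def by (simp add: power2_eq_square algebra_simps)
    show ?thesis unfolding kk mm using q c e by simp
  qed
  moreover have mA0: "0 < m - A" using e by (simp add: mA)
  ultimately have "k * (z * U) \<le> m * U\<^sup>2 + (m - A) * z\<^sup>2"
  proof -
    assume k2: "k\<^sup>2 \<le> 4 * m * (m - A)"
    have "(k * z)\<^sup>2 \<le> 4 * m * ((m - A) * z\<^sup>2)"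
      using mult_right_mono[OF k2, of "z\<^sup>2"] by (simp add: power_mult_distrib algebra_simps)
    from quadratic_le[OF m0 this, of U] show ?thesis by (simp add: algebra_simps)
  qed
  also have "\<dots> = m * (z\<^sup>2 + U\<^sup>2) - A * z\<^sup>2" by (simp add: algebra_simps)
  finally have "k * (z * U) + A * z\<^sup>2 \<le> m" unfolding zU by simp
  then show ?thesis using 1 by (simp add: m_def)
next
  case False
  then have V: "V \<le> 1" "z \<le> 0.8" using V by auto
  have "z * U \<le> 1 / 2" using zU by (intro half_product) simp
  moreover have "z * e \<le> 0.8 * e" "e * V \<le> e * 1" using V e by (intro mult_right_mono mult_left_mono; simp)+
  ultimately show ?thesis using e by simp
qed

lemma two_sqrt2: "2.8284 \<le> 2 * sqrt (2::real)"
proof -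
  have "1.4142 \<le> sqrt (2::real)" by (rule real_le_rsqrt) (simp add: power2_eq_square)
  then show ?thesis by simp
qed

lemma sqrt2_budget: "0 \<le> x \<Longrightarrow> 2.8284 * x \<le> 2 * sqrt 2 * (x::real)"
  using mult_right_mono[OF two_sqrt2] .

text \<open>The maximum over \<open>N\<close> is attained at \<open>N = U / \<surd>3\<close>, for which
  \<open>361/625\<close> is a rational approximation; \<open>0.386\<close> is just above \<open>2 /
  (3 \<surd>3)\<close>.\<close>

lemma cubic_amgm:
  fixes N U :: real assumes "0 \<le> N" "0 \<le> U" shows "N * (U\<^sup>2 - N\<^sup>2) \<le> 0.386 * U ^ 3"
proof -
  have "0 \<le> (N - 361/625 * U)\<^sup>2 * (N + 722/625 * U)" using assms by simp
  also have "\<dots> = N ^ 3 - 3 * (361/625)\<^sup>2 * (N * U\<^sup>2) + 2 * (361/625) ^ 3 * U ^ 3"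
    by (simp add: power2_eq_square eval_nat_numeral field_simps)
  finally have 1: "3 * (361/625)\<^sup>2 * (N * U\<^sup>2) \<le> N ^ 3 + 2 * (361/625) ^ 3 * U ^ 3" by simp
  have "1 * (N * U\<^sup>2) \<le> 3 * (361/625)\<^sup>2 * (N * U\<^sup>2)" using assms by (intro mult_right_mono) (auto simp: power2_eq_square)
  moreover have "2 * (361/625) ^ 3 * U ^ 3 \<le> 0.386 * U ^ 3" using assms by (intro mult_right_mono) (auto simp: eval_nat_numeral)
  ultimately have "N * U\<^sup>2 - N ^ 3 \<le> 0.386 * U ^ 3" using 1 by linarith
  then show ?thesis by (simp add: power2_eq_square eval_nat_numeral algebra_simps)
qed

lemma weigh:
  fixes a e c h p S R F :: real
  assumes "c \<le> a + F" "F + h * p * e \<le> R + e * 1.41448" "e \<le> a" "0 \<le> e" "82/35 * R \<le> S"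
  shows "82/35 * c + 82/35 * (h * p * e) \<le> S + 2 * sqrt 2 * (a + e)"
proof -
  have "82/35 * c + 82/35 * (h * p * e) \<le> 82/35 * a + 82/35 * (R + e * 1.41448)" using assms by (simp add: field_simps)
  also have "\<dots> \<le> S + 2.8284 * (a + e)" using assms by (simp add: field_simps)
  also have "\<dots> \<le> S + 2 * sqrt 2 * (a + e)" using assms sqrt2_budget[of "a + e"] by simp
  finally show ?thesis .
qed

text \<open>If \<open>e\<close> is at least a certain \<open>e0\<close>, the budget \<open>2 \<surd>2 (a
  + e)\<close> with \<open>a \<ge> e\<close> covers everything by the trivial bounds \<open>c \<le>
  1\<close> and \<open>h p \<le> 1/2\<close>. Here \<open>4.485371\<close> is just below \<open>4
  \<surd>2 - 41/35\<close>.\<close>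

lemma weigh_trivial:
  fixes a e c h p S e0 :: real
  assumes "c \<le> 1" "h * p \<le> 1 / 2" "e \<le> a" "e0 \<le> e" "0 \<le> e0" "82/35 \<le> S + 4.485371 * e0"
  shows "82/35 * c + 82/35 * (h * p * e) \<le> S + 2 * sqrt 2 * (a + e)"
proof -
  have "h * p * e \<le> 1 / 2 * e" using assms by (intro mult_right_mono) auto
  then have "82/35 * c + 82/35 * (h * p * e) \<le> 82/35 + 41/35 * e" using assms by (simp add: field_simps)
  also have "\<dots> \<le> S + 2.8284 * (a + e)" using assms by (simp add: field_simps)
  also have "\<dots> \<le> S + 2 * sqrt 2 * (a + e)" using assms sqrt2_budget[of "a + e"] by simp
  finally show ?thesis .
qed

text \<open>What \<open>cov_bound\<close> and \<open>pp_bound\<close> say about a lag \<open>k\<close>, as a list of real numbers: \<open>c\<close> is the weighted covariance,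
  \<open>a = D4 k\<close>, \<open>e = D2 k\<close>, \<open>h = hi d\<close>, \<open>n = lo d\<close>, \<open>N = lo (k - d)\<close>, \<open>M = hi (k - d)\<close>, \<open>p = pp d\<close> and \<open>s = ss d\<close>. The factor
  \<open>82/35 = 2 + 12/35\<close> is the weight that \<open>c\<close> has once the savings are taken into account, and \<open>82/35 h p e\<close> is set aside
  for the lag \<open>k + d\<close>.\<close>

locale lag_data =
  fixes c a e h p s N n M w1 w2 i1 i2 z :: real
  assumes nn: "0 \<le> e" "0 \<le> h" "0 \<le> p" "0 \<le> s" "0 \<le> N" "0 \<le> n" "0 \<le> M" "0 \<le> w1" "0 \<le> w2" "0 \<le> i1" "0 \<le> i2" "0 \<le> z"
    and c1: "c \<le> 1" and ca: "c \<le> a + z * (p * i1 + s * i2)" and zh: "z \<le> h" and ea: "e \<le> a"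
    and i: "i1\<^sup>2 + i2\<^sup>2 \<le> 1 - N\<^sup>2 - M\<^sup>2" and i2e: "i2 \<le> e" and ps: "p\<^sup>2 + s\<^sup>2 \<le> 1"
    and w: "w1\<^sup>2 + w2\<^sup>2 \<le> 1 - h\<^sup>2 - n\<^sup>2" and w2e: "w2 \<le> e"
    and pw: "p\<^sup>2 \<le> w1\<^sup>2 + w2\<^sup>2" and pN: "p \<le> N * w1 + sqrt (1 - N\<^sup>2) * w2"
begin

lemma hp: "h\<^sup>2 + p\<^sup>2 \<le> 1" using w pw zero_le_power2[of n] by linarith

lemma hp_half: "h * p \<le> 1 / 2" by (rule half_product[OF hp])

lemma ch: "c \<le> a + h * (p * i1 + s * i2)"
proof -
  have "z * (p * i1 + s * i2) \<le> h * (p * i1 + s * i2)" using zh nn by (intro mult_right_mono) auto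
  then show ?thesis using ca by linarith
qed

lemma N1: "N\<^sup>2 \<le> 1" using i zero_le_power2[of i1] zero_le_power2[of i2] zero_le_power2[of M] by linarith

text \<open>The hypotheses hold for \<open>k \<le> 2d\<close>, as \<open>lo\<close> is increasing and
  \<open>hi\<close> is decreasing. They bound the interaction part of \<open>X\<^sub>k\<close> by
  \<open>J\<^sup>2 = 1 - h\<^sup>2 - N\<^sup>2\<close> and also give \<open>p \<le> N J + e\<close>,
  so that \<open>p J\<close> is essentially at most \<open>N (U\<^sup>2 - N\<^sup>2)\<close>.\<close>

lemma good:
  assumes hM: "h \<le> M" and Nn: "N \<le> n"
  shows "82/35 * c + 82/35 * (h * p * e) \<le> 34/105 + 2 * sqrt 2 * (a + e)"
proof (cases "e \<le> 0.4502")
  case False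
  then show ?thesis by (intro weigh_trivial[OF c1 hp_half ea, of "0.4502"]) auto
next
  case True
  define U where "U = sqrt (1 - h\<^sup>2)"
  define J where "J = sqrt (1 - h\<^sup>2 - N\<^sup>2)"
  have h1: "h\<^sup>2 \<le> 1" using hp zero_le_power2[of p] by linarith
  have UU: "h\<^sup>2 + U\<^sup>2 = 1" and U0: "0 \<le> U" using h1 by (auto simp: U_def)
  have hM2: "h\<^sup>2 \<le> M\<^sup>2" and Nn2: "N\<^sup>2 \<le> n\<^sup>2" using hM Nn nn by (auto intro: power_mono)
  have "0 \<le> 1 - h\<^sup>2 - N\<^sup>2" using i hM2 zero_le_power2[of i1] zero_le_power2[of i2] by linarith
  then have J2: "J\<^sup>2 = 1 - h\<^sup>2 - N\<^sup>2" and J0: "0 \<le> J" by (auto simp: J_def)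
  have iJ: "i1\<^sup>2 + i2\<^sup>2 \<le> J\<^sup>2" using i hM2 J2 by linarith
  have "J\<^sup>2 \<le> U\<^sup>2" using J2 UU zero_le_power2[of N] by linarith
  then have JU: "J \<le> U" using U0 by (rule power2_le_imp_le)
  have "U\<^sup>2 \<le> 1" using UU zero_le_power2[of h] by linarith
  then have "U \<le> 1" using U0 by (simp add: power_le_one_iff)
  then have J1: "J \<le> 1" using JU by linarith
  obtain V where V: "h * (p * i1 + s * i2 + p * e) \<le> h * p * J + e * V"
    "V = h\<^sup>2 + (1 - e / 2) * h * U \<or> V \<le> 1 \<and> V \<le> sqrt 2 * h \<and> h \<le> 0.8"
    using saturate[OF nn(2,3,4,10,11) J0 ps hp iJ J1 i2e True] by (auto simp: U_def)
  have pJ: "h * p * J \<le> 0.386 * h * U ^ 3 + e * (h * U)"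
  proof -
    have "w1\<^sup>2 \<le> J\<^sup>2" using w Nn2 J2 zero_le_power2[of w2] by linarith
    then have w1J: "w1 \<le> J" using J0 by (rule power2_le_imp_le)
    have "sqrt (1 - N\<^sup>2) \<le> 1" by simp
    then have "sqrt (1 - N\<^sup>2) * w2 \<le> 1 * e" using w2e nn N1 by (intro mult_mono) auto
    moreover have "N * w1 \<le> N * J" using w1J nn by (intro mult_left_mono)
    ultimately have "p \<le> N * J + e" using pN by linarith
    then have "p * J \<le> (N * J + e) * J" using J0 by (intro mult_right_mono)
    also have "\<dots> = N * (U\<^sup>2 - N\<^sup>2) + e * J"
    proof -
      have "J * J = U\<^sup>2 - N\<^sup>2" using J2 UU by (simp add: power2_eq_square)
      then have "N * (J * J) = N * (U\<^sup>2 - N\<^sup>2)" by simp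
      then show ?thesis by (simp add: algebra_simps)
    qed
    also have "\<dots> \<le> 0.386 * U ^ 3 + e * U"
      using cubic_amgm[OF nn(5) U0] JU nn by (intro add_mono mult_left_mono) auto
    finally have "h * (p * J) \<le> h * (0.386 * U ^ 3 + e * U)" using nn by (intro mult_left_mono)
    then show ?thesis by (simp add: algebra_simps)
  qed
  have "h * (p * i1 + s * i2) + h * p * e \<le> 0.138211 + e * 1.41448"
    using V(1) pJ good_scalar[OF nn(2) U0 UU nn(1) True V(2)] by (simp add: algebra_simps)
  then show ?thesis by (rule weigh[OF ch _ ea nn(1)]) simp
qed

text \<open>Without the comparison of \<open>h\<close> with \<open>M\<close> the bound on \<open>p
  J\<close> is weaker: \<open>N J\<close> and \<open>J\<^sup>2 - 1/2\<close> are \<open>1/2\<close>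
  times the sine and cosine of the same angle, so that \<open>p J \<le> U/2 + e/2\<close>.\<close>

lemma bad: "82/35 * c + 82/35 * (h * p * e) \<le> 68/105 + 2 * sqrt 2 * (a + e)"
proof (cases "e \<le> 0.378")
  case False
  then show ?thesis by (intro weigh_trivial[OF c1 hp_half ea, of "0.378"]) auto
next
  case True
  define U where "U = sqrt (1 - h\<^sup>2)"
  define J where "J = sqrt (1 - N\<^sup>2)"
  have h1: "h\<^sup>2 \<le> 1" using hp zero_le_power2[of p] by linarith
  have UU: "h\<^sup>2 + U\<^sup>2 = 1" and U0: "0 \<le> U" using h1 by (auto simp: U_def)
  have J2: "J\<^sup>2 = 1 - N\<^sup>2" and J0: "0 \<le> J" and J1: "J \<le> 1" using N1 by (auto simp: J_def)
  have iJ: "i1\<^sup>2 + i2\<^sup>2 \<le> J\<^sup>2" using i J2 zero_le_power2[of M] by linarith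
  have e': "e \<le> 0.4502" using True by simp
  obtain V where V: "h * (p * i1 + s * i2 + p * e) \<le> h * p * J + e * V"
    "V = h\<^sup>2 + (1 - e / 2) * h * U \<or> V \<le> 1 \<and> V \<le> sqrt 2 * h \<and> h \<le> 0.8"
    using saturate[OF nn(2,3,4,10,11) J0 ps hp iJ J1 i2e e'] by (auto simp: U_def)
  have pJ: "h * p * J \<le> 1 / 2 * (h * U) + 1 / 2 * (h * e)"
  proof -
    have "p * J \<le> (N * w1 + J * w2) * J" using pN J0 by (intro mult_right_mono) (auto simp: J_def)
    also have "\<dots> = (N * J) * w1 + (J\<^sup>2 - 1 / 2) * w2 + w2 / 2" by (simp add: power2_eq_square algebra_simps)
    also have "(N * J) * w1 + (J\<^sup>2 - 1 / 2) * w2 \<le> sqrt ((N * J)\<^sup>2 + (J\<^sup>2 - 1 / 2)\<^sup>2) * sqrt (w1\<^sup>2 + w2\<^sup>2)"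
      by (rule real_cs2)
    also have "(N * J)\<^sup>2 + (J\<^sup>2 - 1 / 2)\<^sup>2 = (1 / 2)\<^sup>2"
    proof -
      have "N\<^sup>2 = 1 - J\<^sup>2" using J2 by simp
      then have "(N * J)\<^sup>2 + (J\<^sup>2 - 1 / 2)\<^sup>2 = (1 - J\<^sup>2) * J\<^sup>2 + (J\<^sup>2 - 1 / 2)\<^sup>2" by (simp add: power_mult_distrib)
      also have "\<dots> = (1 / 2)\<^sup>2" by (simp add: power2_eq_square field_simps)
      finally show ?thesis .
    qed
    also have "sqrt ((1 / 2)\<^sup>2) * sqrt (w1\<^sup>2 + w2\<^sup>2) \<le> 1 / 2 * U"
    proof -
      have "w1\<^sup>2 + w2\<^sup>2 \<le> 1 - h\<^sup>2" using w zero_le_power2[of n] by linarith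
      then have "sqrt (w1\<^sup>2 + w2\<^sup>2) \<le> U" unfolding U_def by simp
      then show ?thesis by (simp add: real_sqrt_abs)
    qed
    finally have "p * J \<le> 1 / 2 * U + 1 / 2 * e" using w2e by simp
    then have "h * (p * J) \<le> h * (1 / 2 * U + 1 / 2 * e)" using nn by (intro mult_left_mono)
    then show ?thesis by (simp add: algebra_simps)
  qed
  have "h * (p * i1 + s * i2) + h * p * e \<le> 0.276422 + e * 1.41448"
    using V(1) pJ bad_scalar[OF nn(2) U0 UU nn(1) True V(2)] by (simp add: algebra_simps)
  then show ?thesis by (rule weigh[OF ch _ ea nn(1)]) simp
qed

text \<open>Here \<open>i1\<close> is at most \<open>D2 (k - d)\<close>, which is paid by the lag
  \<open>k - d\<close>. The constant \<open>1.20711\<close> is just above \<open>(1 +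
  \<surd>2)/2\<close>, the maximum of \<open>h s + h p\<close>; \<open>0.41422\<close> and
  \<open>2.41422\<close> are \<open>\<surd>2 - 1\<close> and \<open>\<surd>2 + 1\<close>.\<close>

lemma tail:
  assumes i1: "i1 \<le> e'"
  shows "82/35 * (a + h * (p * i1 + s * i2)) + 82/35 * (h * p * e) \<le> 2 * sqrt 2 * (a + e) + 82/35 * (h * p * e')"
proof -
  have "h * s + h * p \<le> 1.20711"
  proof -
    have 1: "2 * (h * s) \<le> h\<^sup>2 + s\<^sup>2" using sum_squares_bound[of h s] by simp
    \<comment> \<open>the square is chosen to vanish at \<open>p = (\<surd>2 - 1) h\<close>\<close>
    have 2: "2 * (h * p) \<le> 0.41422 * h\<^sup>2 + 2.41422 * p\<^sup>2"
    proof -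
      have "0 \<le> (20711/50000 * h - p)\<^sup>2" by simp
      then have "20711/50000 * (2 * (h * p)) \<le> 20711/50000 * (20711/50000 * h\<^sup>2) + p\<^sup>2"
        by (simp add: power2_eq_square algebra_simps)
      moreover have "1 * p\<^sup>2 \<le> (20711/50000 * (120711/50000)) * p\<^sup>2" by (intro mult_right_mono) auto
      moreover have "20711/50000 * (20711/50000 * h\<^sup>2 + 120711/50000 * p\<^sup>2)
          = 20711/50000 * (20711/50000 * h\<^sup>2) + (20711/50000 * (120711/50000)) * p\<^sup>2" by (simp only: distrib_left mult.assoc)
      ultimately have "20711/50000 * (2 * (h * p)) \<le> 20711/50000 * (20711/50000 * h\<^sup>2 + 120711/50000 * p\<^sup>2)"
        by (simp only: mult_1)
      then show ?thesis by simp
    qed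
    have "1.41422 * (h\<^sup>2 + p\<^sup>2) \<le> 1.41422 * 1" using hp by (intro mult_left_mono) auto
    then show ?thesis using 1 2 ps by (simp add: algebra_simps)
  qed
  then have hs: "(h * s + h * p) * e \<le> 1.20711 * e" using nn by (intro mult_right_mono)
  have "h * (p * i1 + s * i2) \<le> h * p * e' + h * s * e"
  proof -
    have "p * i1 + s * i2 \<le> p * e' + s * e" using i1 i2e nn by (intro add_mono mult_left_mono)
    then have "h * (p * i1 + s * i2) \<le> h * (p * e' + s * e)" using nn by (intro mult_left_mono)
    then show ?thesis by (simp add: algebra_simps)
  qed
  then have "82/35 * (a + h * (p * i1 + s * i2)) + 82/35 * (h * p * e)
      \<le> 82/35 * a + 82/35 * ((h * s + h * p) * e) + 82/35 * (h * p * e')" by (simp add: field_simps)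
  also have "\<dots> \<le> 82/35 * a + 82/35 * (1.20711 * e) + 82/35 * (h * p * e')" by (rule add_right_mono, rule add_left_mono, rule mult_left_mono[OF hs]) simp
  also have "\<dots> \<le> 2.8284 * (a + e) + 82/35 * (h * p * e')" using ea nn by simp
  also have "\<dots> \<le> 2 * sqrt 2 * (a + e) + 82/35 * (h * p * e')" using ea nn sqrt2_budget[of "a + e"] by simp
  finally show ?thesis .
qed

text \<open>The lag \<open>k = d\<close>. The surplus of \<open>2 h\<close> is needed for
  \<open>last_mid\<close>.\<close>

lemma diagonal:
  assumes "z = 0" and hD: "h \<le> e"
  shows "82/35 * c + 82/35 * (h * p * e) \<le> 2 * sqrt 2 * (a + e) - 2 * h"
    and "2 * c + 82/35 * (h * p * e) \<le> 2 * sqrt 2 * (a + e)"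
proof -
  have c: "c \<le> a" using ca assms by simp
  have "h * p * e \<le> 1 / 2 * e" using hp_half nn by (intro mult_right_mono)
  then have "82/35 * c + 82/35 * (h * p * e) \<le> 82/35 * a + 41/35 * e" "2 * c + 82/35 * (h * p * e) \<le> 2 * a + 41/35 * e"
    using c by simp_all
  moreover have "82/35 * a + 41/35 * e \<le> 2.8284 * (a + e) - 2 * h" "2 * a + 41/35 * e \<le> 2.8284 * (a + e)"
    using ea hD nn by (simp_all add: field_simps)
  ultimately show "82/35 * c + 82/35 * (h * p * e) \<le> 2 * sqrt 2 * (a + e) - 2 * h"
    "2 * c + 82/35 * (h * p * e) \<le> 2 * sqrt 2 * (a + e)"
    using sqrt2_budget[of "a + e"] ea nn by linarith+
qed

text \<open>Used for the lag \<open>2\<kappa> - 1\<close> when \<open>d = \<kappa>\<close>, which is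
  below \<open>\<kappa> + d\<close> but beyond the range of the savings, so that \<open>c\<close>
  has weight \<open>2\<close>.\<close>

lemma last_mid: "2 * c + 82/35 * (h * p * e) \<le> 2 * sqrt 2 * (a + e) + 2 * h"
proof -
  have "p * i1 + s * i2 \<le> sqrt (p\<^sup>2 + s\<^sup>2) * sqrt (i1\<^sup>2 + i2\<^sup>2)" by (rule real_cs2)
  also have "\<dots> \<le> 1 * 1"
  proof -
    have "i1\<^sup>2 + i2\<^sup>2 \<le> 1" using i zero_le_power2[of N] zero_le_power2[of M] by linarith
    then show ?thesis using ps by (intro mult_mono) auto
  qed
  finally have "h * (p * i1 + s * i2) \<le> h * 1" using nn by (intro mult_left_mono) auto
  moreover have "h * p * e \<le> 1 / 2 * e" using hp_half nn by (intro mult_right_mono)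
  ultimately have "2 * c + 82/35 * (h * p * e) \<le> 2 * a + 41/35 * e + 2 * h" using ch by simp
  also have "\<dots> \<le> 2.8284 * (a + e) + 2 * h" using ea nn by simp
  finally show ?thesis using sqrt2_budget[of "a + e"] ea nn by linarith
qed

end

section \<open>Summation over the lags\<close>

text \<open>Every \<open>a\<close> with \<open>1 < a < K\<close> occurs four times among the halves of
  \<open>2, \<dots>, 2K\<close>, the halves of \<open>k\<close> being rounded down and up.\<close>

lemma halving_sum:
  fixes g :: "nat \<Rightarrow> real"
  assumes "1 \<le> K"
  shows "(\<Sum>k=2..2*K. g (k div 2) + g (k - k div 2)) = 4 * (\<Sum>a=1..K. g a) - g 1 - g K"
  using assms
proof (induction K rule: dec_induct)
  case (step K)
  have "{2..2 * Suc K} = insert (2 * K + 1) (insert (2 * K + 2) {2..2 * K})" using step by auto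
  then have "(\<Sum>k=2..2 * Suc K. g (k div 2) + g (k - k div 2))
      = (\<Sum>k=2..2 * K. g (k div 2) + g (k - k div 2)) + (g K + g (K + 1)) + (g (K + 1) + g (K + 1))"
    by (simp add: algebra_simps)
  then show ?case using step by simp
qed simp

text \<open>The two inequalities are \<open>wcov_triangle\<close> with the parameters \<open>2\<close>
  and \<open>5/3\<close>. They are applied to the halves of \<open>k\<close>, the first one for
  \<open>k \<le> K\<close>, where it bounds the defects \<open>1 - c\<close> by themselves and
  improves the factor from \<open>4\<close> to \<open>7/2\<close>, the second one for \<open>k >
  K\<close>.\<close>

lemma savings:
  fixes c :: "nat \<Rightarrow> real"
  assumes c1: "\<And>j. c j \<le> 1"
    and tri2: "\<And>i j. c i + c j \<le> 3/2 + 1/2 * c (i + j)"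
    and tri: "\<And>i j. c i + c j \<le> 43/30 + 3/5 * c (i + j)"
  shows "(\<Sum>k=K+1..2*K. 34/105 - 12/35 * c k) \<le> 2 * (\<Sum>a=1..K. 1 - c a)"
proof (cases "1 \<le> K")
  case True
  define g where "g a = 1 - c a" for a
  define T where "T = (\<Sum>a=1..K. g a)"
  have g0: "0 \<le> g a" for a using c1[of a] by (simp add: g_def)
  have g2: "1/2 * g k \<le> g (k div 2) + g (k - k div 2)" for k
    using tri2[of "k div 2" "k - k div 2"] by (simp add: g_def)
  have g3: "17/30 - 3/5 * c k \<le> g (k div 2) + g (k - k div 2)" for k
    using tri[of "k div 2" "k - k div 2"] by (simp add: g_def)
  have "{2..2*K} = {2..K} \<union> {K+1..2*K}" using True by auto
  then have "4 * T - g 1 - g K = (\<Sum>k=2..K. g (k div 2) + g (k - k div 2)) + (\<Sum>k=K+1..2*K. g (k div 2) + g (k - k div 2))"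
    unfolding T_def using halving_sum[OF True, of g] by (subst sum.union_disjoint[symmetric]) auto
  moreover have "(\<Sum>k=2..K. 1/2 * g k) \<le> (\<Sum>k=2..K. g (k div 2) + g (k - k div 2))" by (intro sum_mono g2)
  moreover have "(\<Sum>k=K+1..2*K. 17/30 - 3/5 * c k) \<le> (\<Sum>k=K+1..2*K. g (k div 2) + g (k - k div 2))" by (intro sum_mono g3)
  moreover have "(\<Sum>k=2..K. 1/2 * g k) = 1/2 * (T - g 1)"
  proof -
    have "{1..K} = insert 1 {2..K}" using True by auto
    then show ?thesis by (simp add: T_def sum_distrib_left)
  qed
  moreover have "(\<Sum>k=K+1..2*K. 34/105 - 12/35 * c k) = 4/7 * (\<Sum>k=K+1..2*K. 17/30 - 3/5 * c k)"
    unfolding sum_distrib_left by (intro sum.cong) auto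
  moreover have "(\<Sum>a=1..K. 1 - c a) = T" by (simp add: T_def g_def)
  moreover define Q where "Q = (\<Sum>k=K+1..2*K. 17/30 - 3/5 * c k)"
  moreover define A1 where "A1 = (\<Sum>k=2..K. g (k div 2) + g (k - k div 2))"
  moreover define A2 where "A2 = (\<Sum>k=K+1..2*K. g (k div 2) + g (k - k div 2))"
  ultimately have "4 * T - g 1 - g K = A1 + A2" "1/2 * (T - g 1) \<le> A1" "Q \<le> A2"
    and eq: "(\<Sum>k=K+1..2*K. 34/105 - 12/35 * c k) = 4/7 * Q" "(\<Sum>a=1..K. 1 - c a) = T"
    by simp_all
  then have "4/7 * Q \<le> 2 * T" using g0[of 1] g0[of K] by (simp add: field_simps)
  then show ?thesis unfolding eq .
qed simp

text \<open>Here \<open>u k\<close> is the amount that lag \<open>k\<close> sets aside for lag \<open>k +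
  d\<close>, and \<open>v k\<close> the contribution of lag \<open>k\<close> after its share of the
  savings has been subtracted. The constants left over, \<open>bnd k\<close>, sum to at most zero:
  if \<open>d < \<kappa>\<close>, there are at most \<open>\<kappa> - 1 - d\<close> lags below
  \<open>\<kappa> + d\<close> and above \<open>2d\<close>, and exactly as many from \<open>\<kappa>
  + d\<close> to \<open>2\<kappa> - 2\<close>.\<close>

lemma lag_sum:
  fixes c \<delta> u :: "nat \<Rightarrow> real" and \<kappa> d T :: nat
  assumes k1: "1 \<le> \<kappa>" and d: "d \<le> \<kappa>" and T: "2 * \<kappa> \<le> T"
    and c1: "\<And>j. c j \<le> 1" and u0: "\<And>k. 0 \<le> u k" and h0: "0 \<le> (h::real)"
    and tri2: "\<And>i j. c i + c j \<le> 3/2 + 1/2 * c (i + j)"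
    and tri: "\<And>i j. c i + c j \<le> 43/30 + 3/5 * c (i + j)"
    and good: "\<And>k. \<kappa> \<le> k \<Longrightarrow> k \<le> 2 * d \<Longrightarrow> 82/35 * c k + u k \<le> 34/105 + \<delta> k"
    and bad: "\<And>k. \<kappa> \<le> k \<Longrightarrow> 82/35 * c k + u k \<le> 68/105 + \<delta> k"
    and tail: "\<And>k. \<kappa> + d \<le> k \<Longrightarrow> \<exists>b. 0 \<le> b \<and> c k \<le> b \<and> 82/35 * b + u k \<le> \<delta> k + u (k - d)"
    and dk: "d = \<kappa> \<Longrightarrow> 82/35 * c \<kappa> + u \<kappa> \<le> \<delta> \<kappa> - 2 * h" "d = \<kappa> \<Longrightarrow> 2 * c \<kappa> + u \<kappa> \<le> \<delta> \<kappa>"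
      "d = \<kappa> \<Longrightarrow> 2 * c (2 * \<kappa> - 1) + u (2 * \<kappa> - 1) \<le> \<delta> (2 * \<kappa> - 1) + 2 * h"
  shows "c 0 + 2 * (\<Sum>j=1..<T. c j) \<le> 2 * real \<kappa> - 1 + (\<Sum>j=\<kappa>..<T. \<delta> j)"
proof -
  define v where "v k = (if k \<le> 2 * \<kappa> - 2 then 82/35 * c k - 34/105 else 2 * c k)" for k
  define bnd where "bnd k = (if d < \<kappa> then (if k < \<kappa> + d then (if k \<le> 2 * d then 0 else 34/105)
      else if k \<le> 2 * \<kappa> - 2 then - 34/105 else 0)
    else if \<kappa> = 1 then 0 else if k = \<kappa> then - 2 * h else if k = 2 * \<kappa> - 1 then 2 * h else (0::real))" for k
  define tl where "tl k = (if \<kappa> + d \<le> k then u (k - d) else 0)" for k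
  have step: "v k + u k \<le> \<delta> k + bnd k + tl k" if k: "\<kappa> \<le> k" for k
  proof (cases "\<kappa> + d \<le> k")
    case True
    obtain b where b: "0 \<le> b" "c k \<le> b" "82/35 * b + u k \<le> \<delta> k + u (k - d)" using tail[OF True] by blast
    have b0: "bnd k = (if k \<le> 2 * \<kappa> - 2 then - 34/105 else 0)"
      using True d k1 by (auto simp: bnd_def)
    show ?thesis
      unfolding v_def tl_def b0 using True b by (auto split: if_splits)
  next
    case False
    show ?thesis
    proof (cases "d < \<kappa>")
      case True
      then have "k \<le> 2 * \<kappa> - 2" using False by linarith
      then show ?thesis using good[OF k] bad[OF k] True False by (auto simp: v_def bnd_def tl_def)
    next
      case dk': False
      then have dk'': "d = \<kappa>" using d by simp
      consider "\<kappa> = 1" | "\<kappa> \<noteq> 1" "k = \<kappa>" | "\<kappa> \<noteq> 1" "k = 2 * \<kappa> - 1" | "\<kappa> \<noteq> 1" "\<kappa> < k" "k \<le> 2 * \<kappa> - 2"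
        using False k dk'' by linarith
      then show ?thesis
      proof cases
        case 1
        then have "k = \<kappa>" using False k dk'' by simp
        then show ?thesis using dk(2)[OF dk''] 1 dk' dk'' by (simp add: v_def bnd_def tl_def)
      next
        case 2
        then have "k \<le> 2 * \<kappa> - 2" using k1 by linarith
        then show ?thesis using dk(1)[OF dk''] 2 dk' dk'' k1 by (simp add: v_def bnd_def tl_def)
      next
        case 3
        then have "\<not> k \<le> 2 * \<kappa> - 2" "k \<noteq> \<kappa>" using k1 by linarith+
        then show ?thesis using dk(3)[OF dk''] 3 dk' False by (simp add: v_def bnd_def tl_def)
      next
        case 4
        then show ?thesis using good[OF k] dk' dk'' False by (auto simp: v_def bnd_def tl_def)
      qed
    qed
  qed
  have bsum: "(\<Sum>k=\<kappa>..<T. bnd k) \<le> 0"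
  proof (cases "d < \<kappa>")
    case True
    let ?A = "{k \<in> {\<kappa>..<T}. k < \<kappa> + d \<and> \<not> k \<le> 2 * d}" and ?B = "{k \<in> {\<kappa>..<T}. \<not> k < \<kappa> + d \<and> k \<le> 2 * \<kappa> - 2}"
    let ?a = "\<lambda>k. if k < \<kappa> + d \<and> \<not> k \<le> 2 * d then 1 else 0 :: real"
    let ?b = "\<lambda>k. if \<not> k < \<kappa> + d \<and> k \<le> 2 * \<kappa> - 2 then 1 else 0 :: real"
    have "(\<Sum>k=\<kappa>..<T. bnd k) = (\<Sum>k=\<kappa>..<T. 34/105 * (?a k - ?b k))"
      using True by (intro sum.cong refl) (auto simp: bnd_def)
    also have "\<dots> = 34/105 * ((\<Sum>k=\<kappa>..<T. ?a k) - (\<Sum>k=\<kappa>..<T. ?b k))"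
      by (simp only: sum_distrib_left[symmetric] sum_subtractf)
    also have "(\<Sum>k=\<kappa>..<T. ?a k) = real (card ?A)" by (simp add: sum.If_cases Int_def)
    also have "(\<Sum>k=\<kappa>..<T. ?b k) = real (card ?B)" by (simp add: sum.If_cases Int_def)
    finally have "(\<Sum>k=\<kappa>..<T. bnd k) = 34/105 * (real (card ?A) - real (card ?B))" .
    moreover have "card ?A \<le> card ?B"
    proof -
      have "card ?A \<le> card {2 * d + 1..<\<kappa> + d}" by (intro card_mono) auto
      also have "\<dots> = \<kappa> - 1 - d" by simp
      also have "\<dots> = card {\<kappa> + d..<2 * \<kappa> - 1}" by simp
      also have "\<dots> \<le> card ?B" using T by (intro card_mono) auto
      finally show ?thesis .
    qed
    ultimately show ?thesis by simp
  next
    case False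
    show ?thesis
    proof (cases "\<kappa> = 1")
      case True
      then show ?thesis using False by (simp add: bnd_def)
    next
      case k2: False
      have ne: "\<kappa> \<noteq> 2 * \<kappa> - 1" using k1 k2 by linarith
      have "(\<Sum>k=\<kappa>..<T. bnd k) = (\<Sum>k=\<kappa>..<T. (if k = \<kappa> then - 2 * h else 0) + (if k = 2 * \<kappa> - 1 then 2 * h else 0))"
        using False k2 ne by (intro sum.cong) (auto simp: bnd_def)
      also have "\<dots> = 0"
      proof -
        have "\<kappa> \<in> {\<kappa>..<T}" "2 * \<kappa> - 1 \<in> {\<kappa>..<T}" using T k1 by auto
        then show ?thesis by (simp only: sum.distrib sum.delta finite_atLeastLessThan if_True)
      qed
      finally show ?thesis by simp
    qed
  qed
  have tlsum: "(\<Sum>k=\<kappa>..<T. tl k) \<le> (\<Sum>k=\<kappa>..<T. u k)"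
  proof -
    have "(\<Sum>k=\<kappa>..<T. tl k) = (\<Sum>k=\<kappa> + d..<T. u (k - d))"
      by (rule sum.mono_neutral_cong_right) (auto simp: tl_def)
    also have "\<dots> = (\<Sum>k=\<kappa>..<T - d. u k)"
      using T d by (intro sum.reindex_bij_witness[of _ "\<lambda>k. k + d" "\<lambda>k. k - d"]) auto
    also have "\<dots> \<le> (\<Sum>k=\<kappa>..<T. u k)" by (intro sum_mono2) (auto simp: u0)
    finally show ?thesis .
  qed
  have "(\<Sum>k=\<kappa>..<T. v k + u k) \<le> (\<Sum>k=\<kappa>..<T. \<delta> k + bnd k + tl k)" by (intro sum_mono step) auto
  then have main: "(\<Sum>k=\<kappa>..<T. v k) \<le> (\<Sum>k=\<kappa>..<T. \<delta> k)"
    using bsum tlsum by (simp add: sum.distrib)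
  have "(\<Sum>k=\<kappa>-1+1..2*(\<kappa>-1). 34/105 - 12/35 * c k) \<le> 2 * (\<Sum>a=1..\<kappa>-1. 1 - c a)"
    by (rule savings[OF c1 tri2 tri])
  moreover have r: "\<kappa> - 1 + 1 = \<kappa>" "2 * (\<kappa> - 1) = 2 * \<kappa> - 2" "{1..\<kappa> - 1} = {1..<\<kappa>}" using k1 by auto
  ultimately have sav: "(\<Sum>k=\<kappa>..2*\<kappa>-2. 34/105 - 12/35 * c k) \<le> 2 * real (\<kappa> - 1) - 2 * (\<Sum>a=1..<\<kappa>. c a)"
    by (simp add: sum_subtractf)
  have "(\<Sum>k=\<kappa>..<T. v k) = 2 * (\<Sum>k=\<kappa>..<T. c k) - (\<Sum>k=\<kappa>..2*\<kappa>-2. 34/105 - 12/35 * c k)"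
  proof -
    have "(\<Sum>k=\<kappa>..<T. v k) = (\<Sum>k=\<kappa>..<T. 2 * c k - (if k \<le> 2 * \<kappa> - 2 then 34/105 - 12/35 * c k else 0))"
      by (intro sum.cong) (auto simp: v_def)
    also have "\<dots> = 2 * (\<Sum>k=\<kappa>..<T. c k) - (\<Sum>k=\<kappa>..<T. if k \<le> 2 * \<kappa> - 2 then 34/105 - 12/35 * c k else 0)"
      by (simp add: sum_subtractf sum_distrib_left)
    also have "(\<Sum>k=\<kappa>..<T. if k \<le> 2 * \<kappa> - 2 then 34/105 - 12/35 * c k else 0) = (\<Sum>k=\<kappa>..2*\<kappa>-2. 34/105 - 12/35 * c k)"
      using T k1 by (intro sum.mono_neutral_cong_right) auto
    finally show ?thesis .
  qed
  moreover have "(\<Sum>j=1..<T. c j) = (\<Sum>j=1..<\<kappa>. c j) + (\<Sum>j=\<kappa>..<T. c j)"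
    using k1 T by (subst sum.atLeastLessThan_concat) auto
  ultimately show ?thesis using sav main c1[of 0] k1 by (simp add: of_nat_diff algebra_simps)
qed

section \<open>The variance of a block of the estimator\<close>

context stat_process
begin

definition PC :: "int \<Rightarrow> 'a \<Rightarrow> int \<Rightarrow> (int \<Rightarrow> 's) \<Rightarrow> 'a" where
  "PC d e t x = (e \<bullet> X t x) *\<^sub>R X (t + d) x - Cm d e"

lemma PCt_L2: "Lk 2 Om (PC d e t)"
  unfolding PC_def[abs_def] by (intro L2_diff L4_scaleR_L2 Lk_inner X_L4 Lk_const')

lemma PC_shift: "PC d e s (shift t x) = PC d e (s + t) x"
  by (simp add: PC_def X_shift add_ac)

lemma PC_inner: "(\<Sum>e\<in>E. \<E> x. PC d e s x \<bullet> PC d e (s + j) x) = cov d j"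
proof -
  have m: "PC d e t \<in> borel_measurable Om" for e t using PCt_L2 by (simp add: Lk_def)
  have "(\<E> x. PC d e s x \<bullet> PC d e (s + j) x)
      = (\<E> x. (P d e x - Cm d e) \<bullet> ((e \<bullet> X j x) *\<^sub>R X (j + d) x))" for e
  proof -
    have "(\<E> x. PC d e s x \<bullet> PC d e (s + j) x)
        = (\<E> x. (\<lambda>x. PC d e 0 x \<bullet> PC d e j x) (shift s x))"
      by (simp add: PC_shift add_ac)
    also have "\<dots> = (\<E> x. PC d e 0 x \<bullet> PC d e j x)"
      by (rule integral_shift(1)) (use m in measurable)
    also have "\<dots> = (\<E> x. (P d e x - Cm d e) \<bullet> ((e \<bullet> X j x) *\<^sub>R X (j + d) x) - (P d e x - Cm d e) \<bullet> Cm d e)"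
      by (intro Bochner_Integration.integral_cong refl) (simp only: PC_def P_def inner_diff_right add_0)
    also have "\<dots> = (\<E> x. (P d e x - Cm d e) \<bullet> ((e \<bullet> X j x) *\<^sub>R X (j + d) x))
        - (\<E> x. (P d e x - Cm d e) \<bullet> Cm d e)"
      by (intro Bochner_Integration.integral_diff L2_inner_integrable PC_L2 L4_scaleR_L2 Lk_inner X_L4 Lk_const')
    also have "(\<E> x. (P d e x - Cm d e) \<bullet> Cm d e) = 0"
      using PC_mean[of d e] L2_integrable'[OF PC_L2] by simp
    finally show ?thesis by simp
  qed
  then show ?thesis by (simp add: cov_eq)
qed

text \<open>The quadratic form of the autocovariances at the times \<open>0, i, i + j\<close>.\<close>

lemma cov_quadratic:
  "0 \<le> (\<alpha>\<^sup>2 + \<beta>\<^sup>2 + \<gamma>\<^sup>2) * cov d 0 + 2 * \<alpha> * \<beta> * cov d i + 2 * \<beta> * \<gamma> * cov d j + 2 * \<alpha> * \<gamma> * cov d (i + j)"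
proof -
  let ?A = "\<lambda>e. PC d e 0" and ?B = "\<lambda>e. PC d e i" and ?C = "\<lambda>e. PC d e (i + j)"
  note int = L2_inner_integrable[OF PCt_L2 PCt_L2]
  have "0 \<le> (\<Sum>e\<in>E. \<E> x. (\<alpha> *\<^sub>R ?A e x + \<beta> *\<^sub>R ?B e x + \<gamma> *\<^sub>R ?C e x) \<bullet> (\<alpha> *\<^sub>R ?A e x + \<beta> *\<^sub>R ?B e x + \<gamma> *\<^sub>R ?C e x))"
    by (intro sum_nonneg integral_nonneg) simp
  also have "\<dots> = (\<Sum>e\<in>E. \<E> x. \<alpha>\<^sup>2 * (?A e x \<bullet> ?A e x) + \<beta>\<^sup>2 * (?B e x \<bullet> ?B e x) + \<gamma>\<^sup>2 * (?C e x \<bullet> ?C e x)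
      + 2 * \<alpha> * \<beta> * (?A e x \<bullet> ?B e x) + 2 * \<beta> * \<gamma> * (?B e x \<bullet> ?C e x) + 2 * \<alpha> * \<gamma> * (?A e x \<bullet> ?C e x))"
  proof (intro sum.cong refl Bochner_Integration.integral_cong)
    fix e x
    show "(\<alpha> *\<^sub>R ?A e x + \<beta> *\<^sub>R ?B e x + \<gamma> *\<^sub>R ?C e x) \<bullet> (\<alpha> *\<^sub>R ?A e x + \<beta> *\<^sub>R ?B e x + \<gamma> *\<^sub>R ?C e x)
      = \<alpha>\<^sup>2 * (?A e x \<bullet> ?A e x) + \<beta>\<^sup>2 * (?B e x \<bullet> ?B e x) + \<gamma>\<^sup>2 * (?C e x \<bullet> ?C e x)
      + 2 * \<alpha> * \<beta> * (?A e x \<bullet> ?B e x) + 2 * \<beta> * \<gamma> * (?B e x \<bullet> ?C e x) + 2 * \<alpha> * \<gamma> * (?A e x \<bullet> ?C e x)"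
      unfolding inner_add_left inner_add_right inner_scaleR_left inner_scaleR_right
        inner_commute[of "?B e x" "?A e x"] inner_commute[of "?C e x" "?A e x"] inner_commute[of "?C e x" "?B e x"]
      by (simp add: power2_eq_square algebra_simps)
  qed
  also have "\<dots> = \<alpha>\<^sup>2 * (\<Sum>e\<in>E. \<E> x. ?A e x \<bullet> ?A e x) + \<beta>\<^sup>2 * (\<Sum>e\<in>E. \<E> x. ?B e x \<bullet> ?B e x)
      + \<gamma>\<^sup>2 * (\<Sum>e\<in>E. \<E> x. ?C e x \<bullet> ?C e x) + 2 * \<alpha> * \<beta> * (\<Sum>e\<in>E. \<E> x. ?A e x \<bullet> ?B e x)
      + 2 * \<beta> * \<gamma> * (\<Sum>e\<in>E. \<E> x. ?B e x \<bullet> ?C e x) + 2 * \<alpha> * \<gamma> * (\<Sum>e\<in>E. \<E> x. ?A e x \<bullet> ?C e x)"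
    using int by (simp add: sum.distrib sum_distrib_left)
  also have "\<dots> = (\<alpha>\<^sup>2 + \<beta>\<^sup>2 + \<gamma>\<^sup>2) * cov d 0 + 2 * \<alpha> * \<beta> * cov d i + 2 * \<beta> * \<gamma> * cov d j + 2 * \<alpha> * \<gamma> * cov d (i + j)"
    using PC_inner[of d 0 0] PC_inner[of d i 0] PC_inner[of d "i + j" 0]
      PC_inner[of d 0 i] PC_inner[of d i j] PC_inner[of d 0 "i + j"]
    by (simp add: algebra_simps)
  finally show ?thesis .
qed

lemma cov_0_le: "cov d 0 \<le> 1"
proof -
  have "cov d 0 = (\<Sum>e\<in>E. (nrm2 Om (\<lambda>x. P d e x - Cm d e))\<^sup>2)"
    using PC_inner[of d 0 0] by (simp add: nrm2_sq power2_norm_eq_inner PC_def P_def)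
  then show ?thesis using PC_norm by simp
qed

lemma cov_le: "cov d j \<le> 1"
  using cov_quadratic[of 1 "-1" 0 d j 0] cov_0_le[of d] by simp

text \<open>The weights \<open>1 - j/n\<close> of the lags in the variance of a mean of \<open>n\<close>
  terms; they vanish for \<open>j \<ge> n\<close>.\<close>

definition wcov :: "nat \<Rightarrow> int \<Rightarrow> nat \<Rightarrow> real" where
  "wcov n d j = real (n - j) / real n * cov d (int j)"

lemma window_count:
  assumes that: "a \<le> b" "b \<le> k"
  shows "(\<Sum>t\<in>{- int k..int n}. (if 1 \<le> t + int a \<and> t + int a \<le> int n \<and> 1 \<le> t + int b \<and> t + int b \<le> int n then 1 else 0 :: real))
    = real (n - (b - a))"
proof -
  have "{t \<in> {- int k..int n}. 1 \<le> t + int a \<and> t + int a \<le> int n \<and> 1 \<le> t + int b \<and> t + int b \<le> int n} = {1 - int a..int n - int b}"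
    using that by auto
  then have "(\<Sum>t\<in>{- int k..int n}. (if 1 \<le> t + int a \<and> t + int a \<le> int n \<and> 1 \<le> t + int b \<and> t + int b \<le> int n then 1 else 0 :: real))
    = real (card {1 - int a..int n - int b})"
    by (subst sum.inter_filter[symmetric]) auto
  also have "\<dots> = real (n - (b - a))" using that by (simp add: nat_eq_iff)
  finally show ?thesis .
qed

text \<open>The weighted covariances are positive definite as well, being the autocovariances of the
  process restricted to a window of length \<open>n\<close> whose position is averaged over. The
  coefficients at the times \<open>0, i, i + j\<close> are \<open>1, -y, 1\<close>.\<close>

lemma wcov_triangle:
  assumes n: "1 \<le> n" and y: "0 < y"
  shows "wcov n d i + wcov n d j \<le> y / 2 + 1 / y + wcov n d (i + j) / y"
proof -
  \<comment> \<open>membership of the time \<open>t + a\<close> in the window \<open>{1..n}\<close>\<close>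
  define ind where "ind t a = (if 1 \<le> t + int a \<and> t + int a \<le> int n then 1 else 0 :: real)" for t a
  let ?k = "i + j"
  let ?I = "{- int ?k..int n}"
  have cnt: "(\<Sum>t\<in>?I. ind t a * ind t b) = real (n - (b - a))" if "a \<le> b" "b \<le> ?k" for a b
  proof -
    have "ind t a * ind t b = (if 1 \<le> t + int a \<and> t + int a \<le> int n \<and> 1 \<le> t + int b \<and> t + int b \<le> int n then 1 else 0)" for t
      by (simp add: ind_def)
    then show ?thesis using window_count[OF that, of n] by simp
  qed
  have sq: "(ind t a)\<^sup>2 = ind t a * ind t a" for t a by (simp add: power2_eq_square)
  have "0 \<le> (\<Sum>t\<in>?I. ((ind t 0)\<^sup>2 + (- y * ind t i)\<^sup>2 + (ind t ?k)\<^sup>2) * cov d 0 + 2 * ind t 0 * (- y * ind t i) * cov d (int i)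
      + 2 * (- y * ind t i) * ind t ?k * cov d (int j) + 2 * ind t 0 * ind t ?k * cov d (int i + int j))"
    by (intro sum_nonneg cov_quadratic)
  also have "\<dots> = (\<Sum>t\<in>?I. (ind t 0 * ind t 0) * cov d 0 + (ind t i * ind t i) * (y\<^sup>2 * cov d 0) + (ind t ?k * ind t ?k) * cov d 0
      - (ind t 0 * ind t i) * (2 * y * cov d (int i)) - (ind t i * ind t ?k) * (2 * y * cov d (int j))
      + (ind t 0 * ind t ?k) * (2 * cov d (int i + int j)))"
    by (intro sum.cong refl) (simp add: power2_eq_square algebra_simps)
  also have "\<dots> = (\<Sum>t\<in>?I. ind t 0 * ind t 0) * cov d 0 + (\<Sum>t\<in>?I. ind t i * ind t i) * (y\<^sup>2 * cov d 0) + (\<Sum>t\<in>?I. ind t ?k * ind t ?k) * cov d 0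
      - (\<Sum>t\<in>?I. ind t 0 * ind t i) * (2 * y * cov d (int i)) - (\<Sum>t\<in>?I. ind t i * ind t ?k) * (2 * y * cov d (int j))
      + (\<Sum>t\<in>?I. ind t 0 * ind t ?k) * (2 * cov d (int i + int j))"
    by (simp only: sum.distrib sum_subtractf sum_distrib_right)
  also have "\<dots> = real n * cov d 0 + real n * (y\<^sup>2 * cov d 0) + real n * cov d 0
      - real (n - i) * (2 * y * cov d (int i)) - real (n - j) * (2 * y * cov d (int j))
      + real (n - ?k) * (2 * cov d (int i + int j))"
    using cnt[of 0 0] cnt[of i i] cnt[of ?k ?k] cnt[of 0 i] cnt[of i ?k] cnt[of 0 ?k] by simp
  also have "\<dots> = 2 * y * real n * ((y / 2 + 1 / y) * cov d 0 - wcov n d i - wcov n d j + wcov n d ?k / y)"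
    using n y by (simp add: wcov_def field_simps power2_eq_square)
  finally have "0 \<le> (y / 2 + 1 / y) * cov d 0 - wcov n d i - wcov n d j + wcov n d ?k / y"
    using n y mult_pos_neg[of "2 * y * real n"] by (meson not_less mult_pos_pos of_nat_0_less_iff zero_less_numeral less_le_trans zero_less_one)
  moreover have "(y / 2 + 1 / y) * cov d 0 \<le> (y / 2 + 1 / y) * 1"
    using cov_0_le[of d] y by (intro mult_left_mono) auto
  ultimately show ?thesis by simp
qed

lemma wcov_le_bound:
  assumes "cov d (int j) \<le> b" "0 \<le> b" shows "wcov n d j \<le> b"
proof -
  have w: "0 \<le> real (n - j) / real n" "real (n - j) / real n \<le> 1" by (auto simp: divide_le_eq_1)
  have "wcov n d j \<le> real (n - j) / real n * b" unfolding wcov_def using assms w by (intro mult_left_mono)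
  also have "\<dots> \<le> 1 * b" using assms w by (intro mult_right_mono)
  finally show ?thesis by simp
qed

lemma nonneg: "0 \<le> lo j" "0 \<le> hi j" "0 \<le> D2 j" "0 \<le> pp d" "0 \<le> ss d"
  by (simp_all add: lo_def hi_def D2_def pp_def ss_def nrm2_nonneg)

lemma lag_datum:
  assumes "d \<le> k"
  shows "\<exists>w1 w2 i1 i2 z. lag_data (wcov n (int d) k) (D4 (int k)) (D2 (int k)) (hi (int d)) (pp (int d)) (ss (int d))
     (lo (int k - int d)) (lo (int d)) (hi (int k - int d)) w1 w2 i1 i2 z
     \<and> i1 \<le> D2 (int (k - d)) \<and> (k = d \<longrightarrow> z = 0)"
proof -
  have d: "0 \<le> int d" "int d \<le> int k" using assms by auto
  obtain w1 w2 where w: "0 \<le> w1" "0 \<le> w2" "w1\<^sup>2 + w2\<^sup>2 \<le> 1 - (hi (int d))\<^sup>2 - (lo (int d))\<^sup>2" "w2 \<le> D2 (int k)"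
    "(pp (int d))\<^sup>2 \<le> w1\<^sup>2 + w2\<^sup>2" "pp (int d) \<le> lo (int k - int d) * w1 + sqrt (1 - (lo (int k - int d))\<^sup>2) * w2"
    using pp_bound[OF d] by blast
  obtain i1 i2 z where i: "0 \<le> i1" "0 \<le> i2" "0 \<le> z" "z \<le> hi (int d)" "int k = int d \<longrightarrow> z = 0"
    "cov (int d) (int k) \<le> D4 (int k) + z * (pp (int d) * i1 + ss (int d) * i2)"
    "i1\<^sup>2 + i2\<^sup>2 \<le> 1 - (lo (int k - int d))\<^sup>2 - (hi (int k - int d))\<^sup>2" "i2 \<le> D2 (int k)" "i1 \<le> D2 (int k - int d)"
    using cov_bound[OF d] by blast
  have l: "lag_data (wcov n (int d) k) (D4 (int k)) (D2 (int k)) (hi (int d)) (pp (int d)) (ss (int d))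
     (lo (int k - int d)) (lo (int d)) (hi (int k - int d)) w1 w2 i1 i2 z"
    using w i nonneg D2_le_D4 pp_ss_le[of "int d"] D4_nonneg[of "int k"]
    by unfold_locales (auto intro!: wcov_le_bound cov_le add_nonneg_nonneg mult_nonneg_nonneg)
  have kd: "int (k - d) = int k - int d" using assms by simp
  show ?thesis
    by (intro exI[of _ w1] exI[of _ w2] exI[of _ i1] exI[of _ i2] exI[of _ z] conjI impI l)
      (use i(5) i(9) in \<open>simp_all add: kd\<close>)
qed

lemma wcov_sum:
  assumes k1: "1 \<le> \<kappa>" and d: "d \<le> \<kappa>" and n: "1 \<le> n"
  shows "cov (int d) 0 + 2 * (\<Sum>j=1..<n. wcov n (int d) j)
    \<le> 2 * real \<kappa> - 1 + (\<Sum>j=\<kappa>..<max n (2 * \<kappa>). 2 * sqrt 2 * (D4 (int j) + D2 (int j)))"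
proof -
  define u where "u k = 82/35 * (hi (int d) * pp (int d) * D2 (int k))" for k
  let ?T = "max n (2 * \<kappa>)"
  let ?c = "wcov n (int d)" and ?\<delta> = "\<lambda>j. 2 * sqrt 2 * (D4 (int j) + D2 (int j))"
  have u0: "0 \<le> u k" for k by (simp add: u_def nonneg)
  have "?c 0 + 2 * (\<Sum>j=1..<?T. ?c j) \<le> 2 * real \<kappa> - 1 + (\<Sum>j=\<kappa>..<?T. ?\<delta> j)"
  proof (rule lag_sum[OF k1 d, where u=u and h="hi (int d)"])
    show "?c j \<le> 1" for j by (intro wcov_le_bound cov_le) simp
    show "?c i + ?c j \<le> 3/2 + 1/2 * ?c (i + j)" for i j using wcov_triangle[OF n, of 2 "int d" i j] by simp
    show "?c i + ?c j \<le> 43/30 + 3/5 * ?c (i + j)" for i j using wcov_triangle[OF n, of "5/3" "int d" i j] by simp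
    show "82/35 * ?c k + u k \<le> 34/105 + ?\<delta> k" if k: "\<kappa> \<le> k" "k \<le> 2 * d" for k
    proof -
      have "d \<le> k" using k d by simp
      from lag_datum[OF this, of n] obtain w1 w2 i1 i2 z where "lag_data (wcov n (int d) k) (D4 (int k)) (D2 (int k)) (hi (int d)) (pp (int d)) (ss (int d))
        (lo (int k - int d)) (lo (int d)) (hi (int k - int d)) w1 w2 i1 i2 z" by blast
      moreover have "hi (int d) \<le> hi (int k - int d)" "lo (int k - int d) \<le> lo (int d)"
        using k by (intro hi_antimono lo_mono; simp)+
      ultimately show ?thesis unfolding u_def by (rule lag_data.good)
    qed
    show "82/35 * ?c k + u k \<le> 68/105 + ?\<delta> k" if k: "\<kappa> \<le> k" for k
    proof -
      have "d \<le> k" using k d by simp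
      from lag_datum[OF this, of n] show ?thesis unfolding u_def using lag_data.bad by blast
    qed
    show "\<exists>b. 0 \<le> b \<and> ?c k \<le> b \<and> 82/35 * b + u k \<le> ?\<delta> k + u (k - d)" if k: "\<kappa> + d \<le> k" for k
    proof -
      have "d \<le> k" using k by simp
      from lag_datum[OF this, of n] obtain w1 w2 i1 i2 z where l: "lag_data (wcov n (int d) k) (D4 (int k)) (D2 (int k)) (hi (int d)) (pp (int d)) (ss (int d))
        (lo (int k - int d)) (lo (int d)) (hi (int k - int d)) w1 w2 i1 i2 z" and i1: "i1 \<le> D2 (int (k - d))" by blast
      interpret lag_data "wcov n (int d) k" "D4 (int k)" "D2 (int k)" "hi (int d)" "pp (int d)" "ss (int d)"
        "lo (int k - int d)" "lo (int d)" "hi (int k - int d)" w1 w2 i1 i2 z by (rule l)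
      show ?thesis unfolding u_def
        by (intro exI[of _ "D4 (int k) + hi (int d) * (pp (int d) * i1 + ss (int d) * i2)"] conjI ch tail[OF i1])
          (use nn D4_nonneg in \<open>auto intro!: add_nonneg_nonneg mult_nonneg_nonneg\<close>)
    qed
    show "82/35 * ?c \<kappa> + u \<kappa> \<le> ?\<delta> \<kappa> - 2 * hi (int d)" "2 * ?c \<kappa> + u \<kappa> \<le> ?\<delta> \<kappa>" if "d = \<kappa>"
    proof -
      have "d \<le> \<kappa>" using that by simp
      from lag_datum[OF this, of n] obtain w1 w2 i1 i2 z where l: "lag_data (wcov n (int d) \<kappa>) (D4 (int \<kappa>)) (D2 (int \<kappa>)) (hi (int d)) (pp (int d)) (ss (int d))
        (lo (int \<kappa> - int d)) (lo (int d)) (hi (int \<kappa> - int d)) w1 w2 i1 i2 z" and z': "\<kappa> = d \<longrightarrow> z = 0" by blast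
      then have z: "z = 0" using that by simp
      have hD: "hi (int d) \<le> D2 (int \<kappa>)" using hi_le_D2 that by simp
      show "82/35 * ?c \<kappa> + u \<kappa> \<le> ?\<delta> \<kappa> - 2 * hi (int d)" "2 * ?c \<kappa> + u \<kappa> \<le> ?\<delta> \<kappa>"
        unfolding u_def using lag_data.diagonal[OF l z hD] by simp_all
    qed
    show "2 * ?c (2 * \<kappa> - 1) + u (2 * \<kappa> - 1) \<le> ?\<delta> (2 * \<kappa> - 1) + 2 * hi (int d)" if "d = \<kappa>"
    proof -
      have "d \<le> 2 * \<kappa> - 1" using that k1 by simp
      from lag_datum[OF this, of n] show ?thesis unfolding u_def using lag_data.last_mid by blast
    qed
  qed (use u0 nonneg in auto)
  moreover have "?c 0 = cov (int d) 0" using n by (simp add: wcov_def)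
  moreover have "(\<Sum>j=1..<?T. ?c j) = (\<Sum>j=1..<n. ?c j)"
    by (intro sum.mono_neutral_right) (auto simp: wcov_def)
  ultimately show ?thesis by simp
qed

end

text \<open>Summation along the diagonals of a symmetric Toeplitz matrix.\<close>

lemma toeplitz_sum:
  fixes c :: "nat \<Rightarrow> real"
  shows "(\<Sum>s<n. \<Sum>t<n. c (nat \<bar>int s - int t\<bar>)) = real n * c 0 + 2 * (\<Sum>j=1..<n. real (n - j) * c j)"
proof (induction n)
  case (Suc n)
  have 1: "(\<Sum>t<n. c (nat \<bar>int n - int t\<bar>)) = (\<Sum>j=1..<Suc n. c j)"
    by (rule sum.reindex_bij_witness[of _ "\<lambda>j. n - j" "\<lambda>t. n - t"]) (auto simp: of_nat_diff intro!: arg_cong[where f=c])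
  have 2: "(\<Sum>s<n. c (nat \<bar>int s - int n\<bar>)) = (\<Sum>j=1..<Suc n. c j)"
  proof -
    have "(\<Sum>s<n. c (nat \<bar>int s - int n\<bar>)) = (\<Sum>t<n. c (nat \<bar>int n - int t\<bar>))"
      by (simp only: abs_minus_commute)
    then show ?thesis using 1 by (rule trans)
  qed
  have "(\<Sum>s<Suc n. \<Sum>t<Suc n. c (nat \<bar>int s - int t\<bar>))
      = (\<Sum>s<n. \<Sum>t<n. c (nat \<bar>int s - int t\<bar>)) + 2 * (\<Sum>j=1..<Suc n. c j) + c 0"
    unfolding sum.lessThan_Suc sum.distrib 1 2 by simp
  also have "\<dots> = real (Suc n) * c 0 + 2 * ((\<Sum>j=1..<n. real (n - j) * c j) + (\<Sum>j=1..<Suc n. c j))"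
    by (simp add: Suc.IH algebra_simps)
  also have "(\<Sum>j=1..<n. real (n - j) * c j) = (\<Sum>j=1..<Suc n. real (n - j) * c j)"
    by simp
  also have "(\<Sum>j=1..<Suc n. real (n - j) * c j) + (\<Sum>j=1..<Suc n. c j) = (\<Sum>j=1..<Suc n. real (Suc n - j) * c j)"
    unfolding sum.distrib[symmetric] by (intro sum.cong) (auto simp: Suc_diff_le algebra_simps)
  finally show ?case .
qed simp

context stat_process
begin

lemma PC_sum_variance:
  assumes n: "1 \<le> n"
  shows "(\<Sum>e\<in>E. \<E> x. norm (\<Sum>t<n. PC d e (t0 + int t) x) ^ 2)
    = real n * (cov d 0 + 2 * (\<Sum>j=1..<n. wcov n d j))"
proof -
  note int = L2_inner_integrable[OF PCt_L2 PCt_L2]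
  have "(\<Sum>e\<in>E. \<E> x. norm (\<Sum>t<n. PC d e (t0 + int t) x) ^ 2)
      = (\<Sum>e\<in>E. \<Sum>s<n. \<Sum>t<n. \<E> x. PC d e (t0 + int t) x \<bullet> PC d e (t0 + int s) x)"
    using int by (simp add: power2_norm_eq_inner inner_sum_left inner_sum_right)
  also have "\<dots> = (\<Sum>e\<in>E. \<Sum>s<n. \<Sum>t<n. \<E> x. PC d e (t0 + int s) x \<bullet> PC d e (t0 + int t) x)"
    by (intro sum.cong refl Bochner_Integration.integral_cong inner_commute)
  also have "\<dots> = (\<Sum>s<n. \<Sum>t<n. \<Sum>e\<in>E. \<E> x. PC d e (t0 + int s) x \<bullet> PC d e (t0 + int t) x)"
    by (subst sum.swap, intro sum.cong refl, subst sum.swap) (rule refl)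
  also have "\<dots> = (\<Sum>s<n. \<Sum>t<n. cov d (int (nat \<bar>int s - int t\<bar>)))"
  proof (intro sum.cong refl)
    fix s t :: nat
    show "(\<Sum>e\<in>E. \<E> x. PC d e (t0 + int s) x \<bullet> PC d e (t0 + int t) x) = cov d (int (nat \<bar>int s - int t\<bar>))"
    proof (cases "s \<le> t")
      case True
      then show ?thesis using PC_inner[of d "t0 + int s" "int t - int s"] by simp
    next
      case False
      have "(\<Sum>e\<in>E. \<E> x. PC d e (t0 + int s) x \<bullet> PC d e (t0 + int t) x)
          = (\<Sum>e\<in>E. \<E> x. PC d e (t0 + int t) x \<bullet> PC d e (t0 + int s) x)" by (simp only: inner_commute)
      then show ?thesis using PC_inner[of d "t0 + int t" "int s - int t"] False by simp
    qed
  qed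
  also have "\<dots> = real n * cov d 0 + 2 * (\<Sum>j=1..<n. real (n - j) * cov d (int j))"
    using toeplitz_sum[of "\<lambda>j. cov d (int j)" n] by simp
  also have "\<dots> = real n * (cov d 0 + 2 * (\<Sum>j=1..<n. wcov n d j))"
  proof -
    have "real n * wcov n d j = real (n - j) * cov d (int j)" for j using n by (simp add: wcov_def)
    then have "real n * (\<Sum>j=1..<n. wcov n d j) = (\<Sum>j=1..<n. real (n - j) * cov d (int j))"
      by (simp only: sum_distrib_left)
    then show ?thesis by (simp add: algebra_simps)
  qed
  finally show ?thesis .
qed

end

section \<open>Orthonormal systems\<close>

lemma orthonormal_expansion:
  fixes K :: "'b::real_inner set"
  assumes K: "finite K" "pairwise orthogonal K" "\<And>k. k \<in> K \<Longrightarrow> norm k = 1" and v: "v \<in> span K"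
  shows "v = (\<Sum>k\<in>K. (k \<bullet> v) *\<^sub>R k)"
proof -
  obtain a where a: "v = (\<Sum>k\<in>K. a k *\<^sub>R k)" using v span_finite[OF K(1)] by auto
  have "k \<bullet> v = a k" if "k \<in> K" for k
    unfolding a by (rule orthonormal_inner_sum[OF K that])
  then show ?thesis using a by simp
qed

text \<open>The squared norm of a linear functional on the span of \<open>K\<close> is its sum of squares
  over \<open>K\<close>; Bessel's inequality for the vector \<open>w\<close> that represents it.\<close>

lemma functional_square_sum_le:
  fixes F K :: "'b::real_inner set"
  assumes F: "finite F" "pairwise orthogonal F" "\<And>k. k \<in> F \<Longrightarrow> norm k = 1"
    and K: "finite K" "pairwise orthogonal K" "\<And>k. k \<in> K \<Longrightarrow> norm k = 1"
    and FK: "F \<subseteq> span K" and L: "linear (L :: 'b \<Rightarrow> real)"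
  shows "(\<Sum>e\<in>F. (L e)\<^sup>2) \<le> (\<Sum>k\<in>K. (L k)\<^sup>2)"
proof -
  define w where "w = (\<Sum>k\<in>K. L k *\<^sub>R k)"
  have Le: "L e = e \<bullet> w" if "e \<in> F" for e
  proof -
    have "L e = L (\<Sum>k\<in>K. (k \<bullet> e) *\<^sub>R k)"
      using orthonormal_expansion[OF K, of e] FK that by auto
    also have "\<dots> = (\<Sum>k\<in>K. (k \<bullet> e) * L k)"
      using L by (simp add: linear_sum linear_scale)
    also have "\<dots> = e \<bullet> w" by (simp add: w_def inner_sum_right inner_commute mult.commute)
    finally show ?thesis .
  qed
  have kw: "k \<bullet> w = L k" if "k \<in> K" for k
    unfolding w_def by (rule orthonormal_inner_sum[OF K that])
  have "(\<Sum>e\<in>F. (L e)\<^sup>2) = (\<Sum>e\<in>F. (e \<bullet> w)\<^sup>2)" by (intro sum.cong) (auto simp: Le)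
  also have "\<dots> \<le> norm w ^ 2" by (rule bessel[OF F])
  also have "norm w ^ 2 = (\<Sum>k\<in>K. L k * (k \<bullet> w))"
    by (subst power2_norm_eq_inner, subst (1) w_def) (simp add: inner_sum_left)
  also have "\<dots> = (\<Sum>k\<in>K. (L k)\<^sup>2)" by (intro sum.cong) (auto simp: kw power2_eq_square)
  finally show ?thesis .
qed

lemma orthonormal_spanning:
  fixes F :: "'b::real_inner set"
  assumes "finite F"
  shows "\<exists>K. finite K \<and> pairwise orthogonal K \<and> (\<forall>k\<in>K. norm k = 1) \<and> span F \<subseteq> span K"
proof -
  obtain C where C: "finite C" "span C = span F" "pairwise orthogonal C"
    using basis_orthogonal[OF assms] by blast
  let ?K = "(\<lambda>c. c /\<^sub>R norm c) ` (C - {0})"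
  have "c \<in> span ?K" if "c \<in> C" for c
  proof (cases "c = 0")
    case False
    then have "c /\<^sub>R norm c \<in> span ?K" using that by (intro span_base) auto
    then have "norm c *\<^sub>R (c /\<^sub>R norm c) \<in> span ?K" by (rule span_scale)
    then show ?thesis using False by simp
  qed (simp add: span_zero)
  then have "span C \<subseteq> span ?K" by (intro span_minimal) auto
  moreover have "pairwise orthogonal ?K"
    using C(3) by (auto simp: pairwise_def orthogonal_def)
  ultimately show ?thesis using C by (intro exI[of _ ?K]) auto
qed

text \<open>The balls of radius \<open>1/2\<close> around the elements are disjoint, as their distances
  are \<open>\<surd>2\<close>.\<close>

lemma orthonormal_countable:
  fixes B :: "'b::{real_inner, second_countable_topology} set"
  assumes "pairwise orthogonal B" "\<And>e. e \<in> B \<Longrightarrow> norm e = 1"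
  shows "countable B"
proof -
  have d: "1 < dist e e'" if "e \<in> B" "e' \<in> B" "e \<noteq> e'" for e e'
  proof -
    have o: "e \<bullet> e' = 0" "e' \<bullet> e = 0" using that assms(1) by (auto simp: pairwise_def orthogonal_def)
    have "e \<bullet> e = 1" "e' \<bullet> e' = 1" using that assms(2) by (simp_all add: dot_square_norm)
    then have "norm (e - e') ^ 2 = 2"
      unfolding power2_norm_eq_inner inner_diff_left inner_diff_right o by simp
    then have "1\<^sup>2 < norm (e - e') ^ 2" by simp
    then show ?thesis unfolding dist_norm by (rule power_less_imp_less_base) simp
  qed
  have dis: "disjnt (ball e (1/2)) (ball e' (1/2))" if "e \<in> B" "e' \<in> B" "e \<noteq> e'" for e e'
  proof -
    have False if "x \<in> ball e (1/2)" "x \<in> ball e' (1/2)" for x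
      using d[OF \<open>e \<in> B\<close> \<open>e' \<in> B\<close> \<open>e \<noteq> e'\<close>] dist_triangle[of e e' x] that by (simp add: dist_commute)
    then show ?thesis unfolding disjnt_def by blast
  qed
  have "inj_on (\<lambda>e. ball e (1/2)) B"
  proof (rule inj_onI)
    fix e e' assume "e \<in> B" "e' \<in> B" "ball e (1/2) = ball e' (1/2 :: real)"
    then show "e = e'" using dis[of e e'] by (auto simp: disjnt_def)
  qed
  moreover have "countable ((\<lambda>e. ball e (1/2)) ` B)"
  proof (rule countable_disjoint_open_subsets)
    show "pairwise disjnt ((\<lambda>e. ball e (1/2)) ` B)"
    proof (rule pairwiseI)
      fix S S' assume "S \<in> (\<lambda>e. ball e (1/2)) ` B" "S' \<in> (\<lambda>e. ball e (1/2)) ` B" "S \<noteq> S'"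
      then obtain e e' where "e \<in> B" "e' \<in> B" "S = ball e (1/2)" "S' = ball e' (1/2)" "e \<noteq> e'" by auto
      then show "disjnt S S'" using dis by simp
    qed
  qed auto
  ultimately show ?thesis by (rule countable_image_inj_on[rotated])
qed

text \<open>Normalised Gram-Schmidt orthogonalisation as an increasing sequence of finite sets, so that
  the union over a dense sequence is an orthonormal basis.\<close>

primrec gram_schmidt :: "(nat \<Rightarrow> 'b::real_inner) \<Rightarrow> nat \<Rightarrow> 'b set" where
  "gram_schmidt u 0 = {}"
| "gram_schmidt u (Suc n) =
    (let v = u n - (\<Sum>c\<in>gram_schmidt u n. (c \<bullet> u n) *\<^sub>R c)
     in if v = 0 then gram_schmidt u n else insert (v /\<^sub>R norm v) (gram_schmidt u n))"

lemma gram_schmidt: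
  "finite (gram_schmidt u n) \<and> pairwise orthogonal (gram_schmidt u n) \<and> (\<forall>c\<in>gram_schmidt u n. norm c = 1)
    \<and> (\<forall>i<n. u i \<in> span (gram_schmidt u n))"
proof (induction n)
  case (Suc n)
  let ?C = "gram_schmidt u n"
  let ?p = "\<Sum>c\<in>?C. (c \<bullet> u n) *\<^sub>R c"
  let ?v = "u n - ?p"
  have C: "finite ?C" "pairwise orthogonal ?C" "\<And>c. c \<in> ?C \<Longrightarrow> norm c = 1" using Suc by auto
  have p: "?p \<in> span ?C" by (intro span_sum span_scale span_base)
  have cv: "c \<bullet> ?v = 0" if c: "c \<in> ?C" for c
    using orthonormal_inner_sum[OF C c] by (simp add: inner_diff_right)
  show ?case
  proof (cases "?v = 0")
    case True
    then have "u n = ?p" by simp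
    then have "u n \<in> span ?C" using p by metis
    then show ?thesis using Suc True by (auto simp: less_Suc_eq)
  next
    case False
    define w where "w = ?v /\<^sub>R norm ?v"
    have S: "gram_schmidt u (Suc n) = insert w ?C" using False by (simp add: w_def Let_def)
    have p': "?p \<in> span (insert w ?C)" using p span_mono[of ?C "insert w ?C"] by blast
    have w': "w \<in> span (insert w ?C)" by (rule span_base) simp
    have "norm ?v *\<^sub>R w + ?p \<in> span (insert w ?C)"
      by (rule span_add[OF span_scale[OF w'] p'])
    moreover have "norm ?v *\<^sub>R w + ?p = u n" using False by (simp add: w_def)
    ultimately have un: "u n \<in> span (insert w ?C)" by metis
    have "orthogonal w c" if "c \<in> ?C" for c
      using cv[OF that] by (simp add: w_def orthogonal_def inner_commute)
    then have "pairwise orthogonal (insert w ?C)" by (intro pairwise_orthogonal_insert C)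
    moreover have "norm w = 1" using False by (simp add: w_def)
    moreover have "u i \<in> span (insert w ?C)" if "i < Suc n" for i
    proof (cases "i = n")
      case False
      then have "u i \<in> span ?C" using that Suc by simp
      then show ?thesis using span_mono[of ?C "insert w ?C"] by blast
    qed (simp add: un)
    ultimately show ?thesis unfolding S using C by simp
  qed
qed simp

lemma gram_schmidt_mono: "m \<le> n \<Longrightarrow> gram_schmidt u m \<subseteq> gram_schmidt u n"
  by (rule lift_Suc_mono_le[of "gram_schmidt u"]) (auto simp: Let_def)

text \<open>This makes the choice of a basis in the definition of the Hilbert-Schmidt norm a genuine one.\<close>

lemma ex_orthonormal_basis:
  "\<exists>B :: 'b::{real_inner, second_countable_topology} set. orthonormal_basis B"
proof -
  obtain Dn :: "'b set" where D: "countable Dn" "\<And>X. open X \<Longrightarrow> X \<noteq> {} \<Longrightarrow> \<exists>d\<in>Dn. d \<in> X"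
    using countable_dense_setE by blast
  have "Dn \<noteq> {}" using D(2)[of UNIV] by auto
  define u where "u = from_nat_into Dn"
  have u: "range u = Dn" unfolding u_def using D(1) \<open>Dn \<noteq> {}\<close> by (rule range_from_nat_into[rotated])
  define B where "B = (\<Union>n. gram_schmidt u n)"
  have "pairwise orthogonal B"
  proof (rule pairwiseI)
    fix x y assume "x \<in> B" "y \<in> B" "x \<noteq> y"
    then obtain m n where "x \<in> gram_schmidt u m" "y \<in> gram_schmidt u n" by (auto simp: B_def)
    then have "x \<in> gram_schmidt u (max m n)" "y \<in> gram_schmidt u (max m n)"
      using gram_schmidt_mono[of m "max m n" u] gram_schmidt_mono[of n "max m n" u] by auto
    then show "orthogonal x y" using gram_schmidt[of u "max m n"] \<open>x \<noteq> y\<close> by (auto simp: pairwise_def)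
  qed
  moreover have "\<forall>e\<in>B. norm e = 1" using gram_schmidt[of u] by (auto simp: B_def)
  moreover have "closure (span B) = UNIV"
  proof -
    have "Dn \<subseteq> span B"
    proof
      fix x assume "x \<in> Dn"
      then obtain n where "x = u n" using u by blast
      then have "x \<in> span (gram_schmidt u (Suc n))" using gram_schmidt[of u "Suc n"] by blast
      moreover have "gram_schmidt u (Suc n) \<subseteq> B" unfolding B_def by blast
      ultimately show "x \<in> span B" using span_mono by blast
    qed
    have "x \<in> closure (span B)" for x
    proof (rule ccontr)
      assume "x \<notin> closure (span B)"
      then obtain d where "d \<in> Dn" "d \<in> - closure (span B)"
        using D(2)[of "- closure (span B)"] by auto
      then show False using \<open>Dn \<subseteq> span B\<close> closure_subset[of "span B"] by blast
    qed
    then show ?thesis by blast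
  qed
  ultimately show ?thesis unfolding orthonormal_basis_def by blast
qed

lemma basis_norm_approx:
  fixes v :: "'b::real_inner"
  assumes B: "orthonormal_basis B" and e: "0 < e"
  shows "\<exists>F. finite F \<and> F \<subseteq> B \<and> norm v ^ 2 \<le> (\<Sum>b\<in>F. (b \<bullet> v)\<^sup>2) + e"
proof -
  have "v \<in> closure (span B)" using B by (simp add: orthonormal_basis_def)
  then obtain w where w: "w \<in> span B" "dist w v < sqrt e"
    using e unfolding closure_approachable by (meson real_sqrt_gt_zero)
  obtain F where F: "finite F" "F \<subseteq> B" "w \<in> span F"
  proof -
    obtain t r where t: "finite t" "t \<subseteq> B" "w = (\<Sum>a\<in>t. r a *\<^sub>R a)"
      using w(1) unfolding span_explicit by blast
    have "w \<in> span t" unfolding t(3) by (intro span_sum span_scale span_base)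
    then show ?thesis using that t by blast
  qed
  have oF: "pairwise orthogonal F" "\<And>b. b \<in> F \<Longrightarrow> norm b = 1"
    using B F(2) by (auto simp: orthonormal_basis_def intro: pairwise_subset)
  have "norm (v - w) ^ 2 < e"
  proof -
    have "norm (v - w) ^ 2 < (sqrt e)\<^sup>2" using w(2) by (intro power_strict_mono) (auto simp: dist_norm norm_minus_commute)
    then show ?thesis using e by simp
  qed
  moreover have "norm v ^ 2 - (\<Sum>b\<in>F. (b \<bullet> v)\<^sup>2) \<le> norm (v - w) ^ 2"
  proof -
    have "norm w ^ 2 = (\<Sum>b\<in>F. (b \<bullet> w)\<^sup>2)"
    proof -
      have "w \<bullet> w = (\<Sum>b\<in>F. (b \<bullet> w) *\<^sub>R b) \<bullet> w" using orthonormal_expansion[OF F(1) oF F(3)] by metis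
      then show ?thesis unfolding power2_norm_eq_inner by (simp add: inner_sum_left power2_eq_square)
    qed
    moreover have "w \<bullet> v = (\<Sum>b\<in>F. (b \<bullet> w) * (b \<bullet> v))"
    proof -
      have "w \<bullet> v = (\<Sum>b\<in>F. (b \<bullet> w) *\<^sub>R b) \<bullet> v" using orthonormal_expansion[OF F(1) oF F(3)] by metis
      then show ?thesis by (simp add: inner_sum_left)
    qed
    moreover have "norm (v - w) ^ 2 = norm v ^ 2 + norm w ^ 2 - 2 * (w \<bullet> v)"
      by (simp add: power2_norm_eq_inner inner_diff inner_commute)
    moreover have "0 \<le> (\<Sum>b\<in>F. (b \<bullet> w - b \<bullet> v)\<^sup>2)" by (rule sum_nonneg) simp
    moreover have "(\<Sum>b\<in>F. (b \<bullet> w - b \<bullet> v)\<^sup>2) = (\<Sum>b\<in>F. (b \<bullet> w)\<^sup>2) + (\<Sum>b\<in>F. (b \<bullet> v)\<^sup>2) - 2 * (\<Sum>b\<in>F. (b \<bullet> w) * (b \<bullet> v))"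
      by (simp add: power2_diff sum.distrib sum_subtractf sum_distrib_left mult.assoc)
    ultimately show ?thesis by linarith
  qed
  ultimately show ?thesis using F by (intro exI[of _ F]) auto
qed


section \<open>Bochner integrals of tensor products\<close>

lemma norm_tensor_op_le: "norm (tensor_op a b) \<le> norm a * norm b"
proof (rule norm_blinfun_bound)
  fix z
  have "norm (blinfun_apply (tensor_op a b) z) = \<bar>a \<bullet> z\<bar> * norm b" by (simp add: tensor_op.rep_eq)
  also have "\<dots> \<le> norm a * norm z * norm b" by (intro mult_right_mono Cauchy_Schwarz_ineq2) simp
  finally show "norm (blinfun_apply (tensor_op a b) z) \<le> norm a * norm b * norm z" by (simp add: ac_simps)
qed simp

lemma bounded_bilinear_tensor_op: "bounded_bilinear (tensor_op :: 'a::real_inner \<Rightarrow> 'b::real_normed_vector \<Rightarrow> _)"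
proof
  fix a a' :: 'a and b b' :: 'b and r :: real
  show "tensor_op (a + a') b = tensor_op a b + tensor_op a' b"
    by (rule blinfun_eqI) (simp add: tensor_op.rep_eq blinfun.add_left inner_add_left scaleR_add_left)
  show "tensor_op a (b + b') = tensor_op a b + tensor_op a b'"
    by (rule blinfun_eqI) (simp add: tensor_op.rep_eq blinfun.add_left scaleR_add_right)
  show "tensor_op (r *\<^sub>R a) b = r *\<^sub>R tensor_op a b"
    by (rule blinfun_eqI) (simp add: tensor_op.rep_eq blinfun.scaleR_left)
  show "tensor_op a (r *\<^sub>R b) = r *\<^sub>R tensor_op a b"
    by (rule blinfun_eqI) (simp add: tensor_op.rep_eq blinfun.scaleR_left)
  show "\<exists>K. \<forall>(a::'a) (b::'b). norm (tensor_op a b) \<le> norm a * norm b * K"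
    by (intro exI[of _ 1]) (simp add: norm_tensor_op_le)
qed

text \<open>A difference of measurable functions need not be measurable in a space without countable
  base; for a simple function \<open>s\<close> it is, as \<open>s\<close> takes finitely many
  values.\<close>

lemma norm_diff_simple_measurable:
  fixes F :: "'w \<Rightarrow> 'b::real_normed_vector"
  assumes F: "F \<in> borel_measurable M" and s: "simple_function M s"
  shows "(\<lambda>\<omega>. norm (F \<omega> - s \<omega>)) \<in> borel_measurable M"
proof -
  have fin: "finite (s ` space M)" using s by (simp add: simple_function_def)
  have "(\<lambda>\<omega>. \<Sum>y\<in>s ` space M. indicator (s -` {y} \<inter> space M) \<omega> * norm (F \<omega> - y)) \<in> borel_measurable M"
  proof (rule borel_measurable_sum)
    fix y assume "y \<in> s ` space M"
    then have "s -` {y} \<inter> space M \<in> sets M" using s unfolding simple_function_def by blast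
    moreover have "(\<lambda>\<omega>. norm (F \<omega> - y)) \<in> borel_measurable M"
      by (rule borel_measurable_continuous_on[where f="\<lambda>v. norm (v - y)", OF _ F]) (intro continuous_intros)
    ultimately show "(\<lambda>\<omega>. indicator (s -` {y} \<inter> space M) \<omega> * norm (F \<omega> - y)) \<in> borel_measurable M"
      by (intro borel_measurable_times borel_measurable_indicator)
  qed
  moreover have "(\<Sum>y\<in>s ` space M. indicator (s -` {y} \<inter> space M) \<omega> * norm (F \<omega> - y)) = norm (F \<omega> - s \<omega>)"
    if "\<omega> \<in> space M" for \<omega>
  proof -
    have "(\<Sum>y\<in>s ` space M. indicator (s -` {y} \<inter> space M) \<omega> * norm (F \<omega> - y))
        = (\<Sum>y\<in>s ` space M. if y = s \<omega> then norm (F \<omega> - y) else 0)"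
      using that by (intro sum.cong refl) (auto simp: indicator_def)
    then show ?thesis using fin that by simp
  qed
  ultimately show ?thesis by (subst measurable_cong[OF sym]) auto
qed

text \<open>Evaluation at \<open>e\<close> maps into a second countable space, where the usual Bochner
  integral is available.\<close>

lemma has_Bochner_integral_apply:
  fixes F :: "'w \<Rightarrow> 'a::real_normed_vector \<Rightarrow>\<^sub>L 'b::{banach, second_countable_topology}"
  assumes T: "has_Bochner_integral M F T" and m: "(\<lambda>\<omega>. blinfun_apply (F \<omega>) e) \<in> borel_measurable M"
  shows "blinfun_apply T e = (\<integral>\<omega>. blinfun_apply (F \<omega>) e \<partial>M)"
proof -
  obtain s where F: "F \<in> borel_measurable M"
    and s: "\<And>i. Bochner_Integration.simple_bochner_integrable M (s i)"
    and s0: "(\<lambda>i::nat. \<integral>\<^sup>+\<omega>. ennreal (norm (F \<omega> - s i \<omega>)) \<partial>M) \<longlonglongrightarrow> 0"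
    and sT: "(\<lambda>i. Bochner_Integration.simple_bochner_integral M (s i)) \<longlonglongrightarrow> T"
    using T unfolding has_Bochner_integral_def by blast
  have sf: "simple_function M (s i)" for i using s[of i] by (auto elim: Bochner_Integration.simple_bochner_integrable.cases)
  have "has_bochner_integral M (\<lambda>\<omega>. blinfun_apply (F \<omega>) e) (blinfun_apply T e)"
  proof (rule has_bochner_integral.intros[OF m, of "\<lambda>i \<omega>. blinfun_apply (s i \<omega>) e"])
    show "Bochner_Integration.simple_bochner_integrable M (\<lambda>\<omega>. blinfun_apply (s i \<omega>) e)" for i
      using Bochner_Integration.simple_bochner_integrable_compose2[of "\<lambda>a b. blinfun_apply a e" M "s i" "s i"] s[of i]
      by simp
    have le: "(\<integral>\<^sup>+\<omega>. ennreal (norm (blinfun_apply (F \<omega>) e - blinfun_apply (s i \<omega>) e)) \<partial>M)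
        \<le> ennreal (norm e) * (\<integral>\<^sup>+\<omega>. ennreal (norm (F \<omega> - s i \<omega>)) \<partial>M)" for i
    proof -
      have "(\<integral>\<^sup>+\<omega>. ennreal (norm (blinfun_apply (F \<omega>) e - blinfun_apply (s i \<omega>) e)) \<partial>M)
          \<le> (\<integral>\<^sup>+\<omega>. ennreal (norm e) * ennreal (norm (F \<omega> - s i \<omega>)) \<partial>M)"
      proof (rule nn_integral_mono)
        fix \<omega>
        have "norm (blinfun_apply (F \<omega>) e - blinfun_apply (s i \<omega>) e) \<le> norm e * norm (F \<omega> - s i \<omega>)"
          using norm_blinfun[of "F \<omega> - s i \<omega>" e] by (simp add: blinfun.diff_left mult.commute)
        then show "ennreal (norm (blinfun_apply (F \<omega>) e - blinfun_apply (s i \<omega>) e)) \<le> ennreal (norm e) * ennreal (norm (F \<omega> - s i \<omega>))"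
          by (simp add: ennreal_mult[symmetric] ennreal_leI)
      qed
      also have "\<dots> = ennreal (norm e) * (\<integral>\<^sup>+\<omega>. ennreal (norm (F \<omega> - s i \<omega>)) \<partial>M)"
        by (rule nn_integral_cmult) (use norm_diff_simple_measurable[OF F sf[of i]] in measurable)
      finally show ?thesis .
    qed
    have lim: "(\<lambda>i. ennreal (norm e) * (\<integral>\<^sup>+\<omega>. ennreal (norm (F \<omega> - s i \<omega>)) \<partial>M)) \<longlonglongrightarrow> 0"
      using ennreal_tendsto_cmult[OF _ s0, of "ennreal (norm e)"] by simp
    show "(\<lambda>i. \<integral>\<^sup>+\<omega>. ennreal (norm (blinfun_apply (F \<omega>) e - blinfun_apply (s i \<omega>) e)) \<partial>M) \<longlonglongrightarrow> 0"
      by (rule tendsto_sandwich[OF _ _ tendsto_const lim]) (auto intro!: always_eventually le)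
    have "Bochner_Integration.simple_bochner_integral M (\<lambda>\<omega>. blinfun_apply (s i \<omega>) e)
        = blinfun_apply (Bochner_Integration.simple_bochner_integral M (s i)) e" for i
      by (rule Bochner_Integration.simple_bochner_integral_linear[OF _ s])
        (auto intro!: linearI simp: blinfun.add_left blinfun.scaleR_left)
    then show "(\<lambda>i. Bochner_Integration.simple_bochner_integral M (\<lambda>\<omega>. blinfun_apply (s i \<omega>) e)) \<longlonglongrightarrow> blinfun_apply T e"
      using tendsto_intros(1) by (auto intro!: tendsto_intros sT)
  qed
  then show ?thesis by (simp add: has_bochner_integral_integral_eq)
qed

text \<open>The tensor product of simple approximations of \<open>Y\<close> and \<open>Z\<close>
  approximates their tensor product, by dominated convergence.\<close>

lemma ex_Bochner_integral_tensor:
  fixes Y :: "'w \<Rightarrow> 'a::{real_inner, second_countable_topology}"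
    and Z :: "'w \<Rightarrow> 'b::{banach, second_countable_topology}"
  assumes M: "finite_measure M" and [measurable]: "Y \<in> borel_measurable M" "Z \<in> borel_measurable M"
    and i: "integrable M (\<lambda>\<omega>. norm (Y \<omega>) * norm (Z \<omega>))"
  shows "\<exists>T. has_Bochner_integral M (\<lambda>\<omega>. tensor_op (Y \<omega>) (Z \<omega>)) T"
proof -
  interpret finite_measure M by fact
  let ?F = "\<lambda>\<omega>. tensor_op (Y \<omega>) (Z \<omega>)"
  obtain a where a: "\<And>i. simple_function M (a i)" "\<And>x. x \<in> space M \<Longrightarrow> (\<lambda>i. a i x) \<longlonglongrightarrow> Y x"
    "\<And>i x. x \<in> space M \<Longrightarrow> dist (a i x) 0 \<le> 2 * dist (Y x) 0"
    using borel_measurable_implies_sequence_metric[OF assms(2), of 0] by blast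
  obtain b where b: "\<And>i. simple_function M (b i)" "\<And>x. x \<in> space M \<Longrightarrow> (\<lambda>i. b i x) \<longlonglongrightarrow> Z x"
    "\<And>i x. x \<in> space M \<Longrightarrow> dist (b i x) 0 \<le> 2 * dist (Z x) 0"
    using borel_measurable_implies_sequence_metric[OF assms(3), of 0] by blast
  define s where "s i \<omega> = tensor_op (a i \<omega>) (b i \<omega>)" for i \<omega>
  have sf: "simple_function M (s i)" for i
    unfolding s_def by (rule simple_function_compose2[OF a(1) b(1)])
  have sb: "Bochner_Integration.simple_bochner_integrable M (s i)" for i
    by (rule Bochner_Integration.simple_bochner_integrable.intros[OF sf]) simp
  have F: "?F \<in> borel_measurable M"
    by (rule borel_measurable_continuous_Pair[where H=tensor_op])
      (auto intro!: bounded_bilinear.continuous_on[OF bounded_bilinear_tensor_op] continuous_intros)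
  note mF = norm_diff_simple_measurable[OF F sf]
  have lim: "(\<lambda>i. \<integral>\<^sup>+\<omega>. ennreal (norm (?F \<omega> - s i \<omega>)) \<partial>M) \<longlonglongrightarrow> (\<integral>\<^sup>+\<omega>. 0 \<partial>M)"
  proof (rule nn_integral_dominated_convergence[where w="\<lambda>\<omega>. ennreal (5 * (norm (Y \<omega>) * norm (Z \<omega>)))"])
    show "(\<lambda>\<omega>. ennreal (norm (?F \<omega> - s i \<omega>))) \<in> borel_measurable M" for i using mF by measurable
    show "AE \<omega> in M. ennreal (norm (?F \<omega> - s i \<omega>)) \<le> ennreal (5 * (norm (Y \<omega>) * norm (Z \<omega>)))" for i
    proof (rule AE_I2)
      fix \<omega> assume w: "\<omega> \<in> space M"
      have "norm (s i \<omega>) \<le> norm (a i \<omega>) * norm (b i \<omega>)" unfolding s_def by (rule norm_tensor_op_le)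
      also have "\<dots> \<le> (2 * norm (Y \<omega>)) * (2 * norm (Z \<omega>))"
        using a(3)[OF w, of i] b(3)[OF w, of i] by (intro mult_mono) auto
      finally have "norm (?F \<omega> - s i \<omega>) \<le> 5 * (norm (Y \<omega>) * norm (Z \<omega>))"
        using norm_triangle_ineq4[of "?F \<omega>" "s i \<omega>"] norm_tensor_op_le[of "Y \<omega>" "Z \<omega>"] by linarith
      then show "ennreal (norm (?F \<omega> - s i \<omega>)) \<le> ennreal (5 * (norm (Y \<omega>) * norm (Z \<omega>)))" by (rule ennreal_leI)
    qed
    show "AE \<omega> in M. (\<lambda>i. ennreal (norm (?F \<omega> - s i \<omega>))) \<longlonglongrightarrow> 0"
    proof (rule AE_I2)
      fix \<omega> assume w: "\<omega> \<in> space M"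
      have "(\<lambda>i. s i \<omega>) \<longlonglongrightarrow> ?F \<omega>"
        unfolding s_def by (rule bounded_bilinear.tendsto[OF bounded_bilinear_tensor_op a(2)[OF w] b(2)[OF w]])
      then have "(\<lambda>i. norm (?F \<omega> - s i \<omega>)) \<longlonglongrightarrow> norm (?F \<omega> - ?F \<omega>)"
        by (intro tendsto_intros)
      then show "(\<lambda>i. ennreal (norm (?F \<omega> - s i \<omega>))) \<longlonglongrightarrow> 0"
        using tendsto_ennrealI by fastforce
    qed
    have "(\<integral>\<^sup>+\<omega>. ennreal (5 * (norm (Y \<omega>) * norm (Z \<omega>))) \<partial>M) = ennreal (\<integral>\<omega>. 5 * (norm (Y \<omega>) * norm (Z \<omega>)) \<partial>M)"
      using i by (intro nn_integral_eq_integral) auto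
    then show "(\<integral>\<^sup>+\<omega>. ennreal (5 * (norm (Y \<omega>) * norm (Z \<omega>))) \<partial>M) < \<infinity>" by simp
  qed auto
  then have lim0: "(\<lambda>i. \<integral>\<^sup>+\<omega>. ennreal (norm (?F \<omega> - s i \<omega>)) \<partial>M) \<longlonglongrightarrow> 0" by simp
  let ?S = "\<lambda>i. Bochner_Integration.simple_bochner_integral M (s i)"
  let ?e = "\<lambda>i. \<integral>\<^sup>+\<omega>. ennreal (norm (?F \<omega> - s i \<omega>)) \<partial>M"
  have bnd: "ennreal (norm (?S i - ?S j)) \<le> ?e i + ?e j" for i j
  proof -
    have d: "Bochner_Integration.simple_bochner_integrable M (\<lambda>\<omega>. s i \<omega> - s j \<omega>)"
      using Bochner_Integration.simple_bochner_integrable_compose2[of "(-)" M "s i" "s j"] sb by simp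
    have d': "Bochner_Integration.simple_bochner_integrable M (\<lambda>\<omega>. norm (s i \<omega> - s j \<omega>))"
      using Bochner_Integration.simple_bochner_integrable_compose2[of "\<lambda>x y. norm (x - y)" M "s i" "s j"] sb by simp
    have "?S i - ?S j = Bochner_Integration.simple_bochner_integral M (\<lambda>\<omega>. s i \<omega> - s j \<omega>)"
      by (rule Bochner_Integration.simple_bochner_integral_diff[OF sb sb, symmetric])
    then have "ennreal (norm (?S i - ?S j)) \<le> ennreal (Bochner_Integration.simple_bochner_integral M (\<lambda>\<omega>. norm (s i \<omega> - s j \<omega>)))"
      using Bochner_Integration.simple_bochner_integral_norm_bound[OF d] by (simp add: ennreal_leI)
    also have "\<dots> = (\<integral>\<^sup>+\<omega>. ennreal (norm (s i \<omega> - s j \<omega>)) \<partial>M)"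
      by (rule Bochner_Integration.simple_bochner_integral_eq_nn_integral[OF d']) simp
    also have "\<dots> \<le> (\<integral>\<^sup>+\<omega>. ennreal (norm (?F \<omega> - s i \<omega>)) + ennreal (norm (?F \<omega> - s j \<omega>)) \<partial>M)"
    proof (rule nn_integral_mono)
      fix \<omega>
      have "norm (s i \<omega> - s j \<omega>) \<le> norm (?F \<omega> - s i \<omega>) + norm (?F \<omega> - s j \<omega>)"
        using norm_triangle_ineq4[of "?F \<omega> - s j \<omega>" "?F \<omega> - s i \<omega>"] by simp
      then show "ennreal (norm (s i \<omega> - s j \<omega>)) \<le> ennreal (norm (?F \<omega> - s i \<omega>)) + ennreal (norm (?F \<omega> - s j \<omega>))"
        by (simp add: ennreal_plus[symmetric] del: ennreal_plus)
    qed
    also have "\<dots> = ?e i + ?e j" by (rule nn_integral_add) (use mF in measurable)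
    finally show ?thesis .
  qed
  have "Cauchy ?S"
  proof (rule metric_CauchyI)
    fix r :: real assume r: "0 < r"
    have "\<forall>\<^sub>F i in sequentially. ?e i < ennreal (r / 2)"
      by (rule order_tendstoD(2)[OF lim0]) (use r in simp)
    then obtain n0 where n0: "\<And>i. i \<ge> n0 \<Longrightarrow> ?e i < ennreal (r / 2)" by (auto simp: eventually_sequentially)
    show "\<exists>n. \<forall>i\<ge>n. \<forall>j\<ge>n. dist (?S i) (?S j) < r"
    proof (intro exI allI impI)
      fix i j assume "n0 \<le> i" "n0 \<le> j"
      then have "?e i + ?e j < ennreal (r / 2) + ennreal (r / 2)" using n0 by (intro add_strict_mono)
      also have "\<dots> = ennreal r" using r by (subst ennreal_plus[symmetric]) auto
      finally have "ennreal (norm (?S i - ?S j)) < ennreal r" using bnd[of i j] by (rule le_less_trans[rotated])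
      then show "dist (?S i) (?S j) < r" using r by (simp add: dist_norm ennreal_less_iff)
    qed
  qed
  then obtain T where "?S \<longlonglongrightarrow> T" using Cauchy_convergent_iff[of ?S] by (auto simp: convergent_def)
  then show ?thesis unfolding has_Bochner_integral_def using F sb lim0 by blast
qed

text \<open>The covariance operator is determined by its values, so only the existence of the integral in
  operator norm is an issue.\<close>

lemma Bochner_integral_tensor_apply:
  fixes Y :: "'w \<Rightarrow> 'a::{real_inner, second_countable_topology}"
    and Z :: "'w \<Rightarrow> 'b::{banach, second_countable_topology}"
  assumes M: "finite_measure M" and [measurable]: "Y \<in> borel_measurable M" "Z \<in> borel_measurable M"
    and i: "integrable M (\<lambda>\<omega>. norm (Y \<omega>) * norm (Z \<omega>))"
  shows "blinfun_apply (Bochner_integral M (\<lambda>\<omega>. tensor_op (Y \<omega>) (Z \<omega>))) e = (\<integral>\<omega>. (Y \<omega> \<bullet> e) *\<^sub>R Z \<omega> \<partial>M)"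
proof -
  let ?F = "\<lambda>\<omega>. tensor_op (Y \<omega>) (Z \<omega>)"
  obtain T where T: "has_Bochner_integral M ?F T" using ex_Bochner_integral_tensor[OF assms] by blast
  have ap: "blinfun_apply T' e = (\<integral>\<omega>. (Y \<omega> \<bullet> e) *\<^sub>R Z \<omega> \<partial>M)" if "has_Bochner_integral M ?F T'" for T' e
    using has_Bochner_integral_apply[OF that, of e] by (simp add: tensor_op.rep_eq)
  have "Bochner_integral M ?F = T"
    unfolding Bochner_integral_def
    by (rule the_equality[where P="has_Bochner_integral M ?F", OF T]) (auto intro!: blinfun_eqI simp: ap ap[OF T])
  then show ?thesis using ap[OF T] by simp
qed

section \<open>Hilbert-Schmidt norms of the blocks\<close>

context stat_process
begin

lemma block_bound_aux:
  assumes pq: "p \<le> q" "q - p \<le> int \<kappa>" and k1: "1 \<le> \<kappa>" and n: "1 \<le> n"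
  shows "(\<Sum>e\<in>E. \<Sum>e'\<in>E. \<E> x. (\<Sum>t<n. (e \<bullet> X (t0 + int t + p) x) * (e' \<bullet> X (t0 + int t + q) x)
      - (\<E> x. (e \<bullet> X p x) * (e' \<bullet> X q x)))\<^sup>2)
    \<le> real n * (2 * real \<kappa> - 1 + (\<Sum>j=\<kappa>..<max n (2 * \<kappa>). 2 * sqrt 2 * (D4 (int j) + D2 (int j))))" (is "?L \<le> ?R")
    and "integrable Om (\<lambda>x. (\<Sum>t<n. (e \<bullet> X (t0 + int t + p) x) * (e' \<bullet> X (t0 + int t + q) x)
      - (\<E> x. (e \<bullet> X p x) * (e' \<bullet> X q x)))\<^sup>2)"
proof -
  define d where "d = nat (q - p)"
  have d: "int d = q - p" "d \<le> \<kappa>" using pq by (auto simp: d_def)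
  define S where "S e x = (\<Sum>t<n. PC (int d) e (t0 + p + int t) x)" for e x
  have S_L2: "Lk 2 Om (S e)" for e
    unfolding S_def[abs_def]
  proof (induction n)
    case 0
    then show ?case by (simp add: Lk_const')
  next
    case (Suc n)
    then show ?case by (simp add: L2_add PCt_L2)
  qed
  have mean: "(\<E> x. (e \<bullet> X p x) * (e' \<bullet> X q x)) = e' \<bullet> Cm (int d) e" for e e'
  proof -
    have "(\<E> x. (e \<bullet> X p x) * (e' \<bullet> X q x)) = (\<E> x. (\<lambda>x. e' \<bullet> P (int d) e x) (shift p x))"
      by (simp add: P_def X_shift d)
    also have "\<dots> = (\<E> x. e' \<bullet> P (int d) e x)" by (rule integral_shift(1)) measurable
    also have "\<dots> = e' \<bullet> Cm (int d) e" unfolding Cm_def by (intro integral_inner_right) (simp add: P_integrable)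
    finally show ?thesis .
  qed
  have eq: "(\<Sum>t<n. (e \<bullet> X (t0 + int t + p) x) * (e' \<bullet> X (t0 + int t + q) x)
      - (\<E> x. (e \<bullet> X p x) * (e' \<bullet> X q x))) = e' \<bullet> S e x" for e e' x
  proof -
    have "e' \<bullet> PC (int d) e (t0 + p + int t) x
        = (e \<bullet> X (t0 + int t + p) x) * (e' \<bullet> X (t0 + int t + q) x) - e' \<bullet> Cm (int d) e" for t
    proof -
      have "t0 + p + int t + int d = t0 + int t + q" "t0 + p + int t = t0 + int t + p" using d by auto
      then show ?thesis by (simp only: PC_def inner_diff_right inner_scaleR_right)
    qed
    then show ?thesis
      unfolding mean S_def inner_sum_right by simp
  qed
  have i: "integrable Om (\<lambda>x. (e' \<bullet> S e x)\<^sup>2)" for e e'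
    using Lk_inner[OF S_L2, of e' e] by (simp add: Lk_def)
  then show "integrable Om (\<lambda>x. (\<Sum>t<n. (e \<bullet> X (t0 + int t + p) x) * (e' \<bullet> X (t0 + int t + q) x)
      - (\<E> x. (e \<bullet> X p x) * (e' \<bullet> X q x)))\<^sup>2)"
    unfolding eq .
  have "?L = (\<Sum>e\<in>E. \<E> x. (\<Sum>e'\<in>E. (e' \<bullet> S e x)\<^sup>2))"
    unfolding eq using i by simp
  also have "\<dots> \<le> (\<Sum>e\<in>E. \<E> x. norm (S e x) ^ 2)"
    using i S_L2 by (intro sum_mono integral_mono bessel E) (auto simp: Lk_def)
  also have "\<dots> = real n * (cov (int d) 0 + 2 * (\<Sum>j=1..<n. wcov n (int d) j))"
    unfolding S_def by (rule PC_sum_variance[OF n])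
  also have "\<dots> \<le> ?R"
    by (intro mult_left_mono wcov_sum k1 d n) simp
  finally show "?L \<le> ?R" .
qed

text \<open>If \<open>q < p\<close>, exchanging the two factors is passing to the adjoint, which has the
  same coordinates.\<close>

lemma block_bound:
  assumes pq: "\<bar>q - p\<bar> \<le> int \<kappa>" and k1: "1 \<le> \<kappa>" and n: "1 \<le> n"
  shows "(\<Sum>e\<in>E. \<Sum>e'\<in>E. \<E> x. (\<Sum>t<n. (e \<bullet> X (t0 + int t + p) x) * (e' \<bullet> X (t0 + int t + q) x)
      - (\<E> x. (e \<bullet> X p x) * (e' \<bullet> X q x)))\<^sup>2)
    \<le> real n * (2 * real \<kappa> - 1 + (\<Sum>j=\<kappa>..<max n (2 * \<kappa>). 2 * sqrt 2 * (D4 (int j) + D2 (int j))))" (is "?L \<le> ?R")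
    and "integrable Om (\<lambda>x. (\<Sum>t<n. (e \<bullet> X (t0 + int t + p) x) * (e' \<bullet> X (t0 + int t + q) x)
      - (\<E> x. (e \<bullet> X p x) * (e' \<bullet> X q x)))\<^sup>2)" (is ?I)
proof -
  have "?L \<le> ?R \<and> ?I"
  proof (cases "p \<le> q")
    case True
    have le: "q - p \<le> int \<kappa>" using pq by auto
    show ?thesis
      by (intro conjI block_bound_aux(1)[OF True le k1 n] block_bound_aux(2)[OF True le k1 n])
  next
    case False
    then have le: "q \<le> p" "p - q \<le> int \<kappa>" using pq by auto
    have "?L = (\<Sum>e'\<in>E. \<Sum>e\<in>E. \<E> x. (\<Sum>t<n. (e' \<bullet> X (t0 + int t + q) x) * (e \<bullet> X (t0 + int t + p) x)
      - (\<E> x. (e' \<bullet> X q x) * (e \<bullet> X p x)))\<^sup>2)"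
      by (subst sum.swap) (simp only: mult.commute)
    also have "\<dots> \<le> ?R" by (rule block_bound_aux(1)[OF le k1 n])
    finally have "?L \<le> ?R" .
    moreover have ?I using block_bound_aux(2)[OF le k1 n, of e' t0 e] by (simp only: mult.commute)
    ultimately show ?thesis ..
  qed
  then show "?L \<le> ?R" ?I by auto
qed

end

lemma hs_norm_square:
  "(hs_norm T)\<^sup>2 = (\<Sum>\<^sub>\<infinity>e\<in>(SOME B. orthonormal_basis B). ennreal ((norm (blinfun_apply T e))\<^sup>2))"
proof -
  have "(epowr x (1 / 2))\<^sup>2 = x" for x :: ennreal
  proof (cases "x = \<top>")
    case True
    then show ?thesis by (simp add: epowr_def power2_eq_square ennreal_top_mult)
  next
    case False
    have "(epowr x (1 / 2))\<^sup>2 = ennreal ((enn2real x powr (1 / 2))\<^sup>2)"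
      using False by (simp add: epowr_def ennreal_power)
    also have "(enn2real x powr (1 / 2))\<^sup>2 = enn2real x"
      by (simp add: powr_half_sqrt)
    finally show ?thesis using False by (simp add: less_top)
  qed
  then show ?thesis by (simp add: hs_norm_def)
qed

text \<open>An increasing sequence of finite sets in place of all finite subsets, for monotone
  convergence.\<close>

lemma infsum_countable_SUP:
  fixes g :: "'e \<Rightarrow> ennreal"
  assumes "countable B"
  defines "F \<equiv> (\<lambda>n. {e\<in>B. to_nat_on B e < n})"
  shows "(\<Sum>\<^sub>\<infinity>e\<in>B. g e) = (SUP n. \<Sum>e\<in>F n. g e)"
    and "\<And>n. finite (F n)" and "\<And>n. F n \<subseteq> B" and "\<And>m n. m \<le> n \<Longrightarrow> F m \<subseteq> F n"
    and "\<And>A. finite A \<Longrightarrow> A \<subseteq> B \<Longrightarrow> \<exists>n. A \<subseteq> F n"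
proof -
  show fin: "finite (F n)" for n
  proof -
    have "inj_on (to_nat_on B) (F n)" using inj_on_to_nat_on[OF assms(1)] by (rule inj_on_subset) (auto simp: F_def)
    moreover have "finite (to_nat_on B ` F n)" by (rule finite_subset[of _ "{..<n}"]) (auto simp: F_def)
    ultimately show ?thesis by (rule finite_imageD[rotated])
  qed
  show sub: "F n \<subseteq> B" for n by (auto simp: F_def)
  show "m \<le> n \<Longrightarrow> F m \<subseteq> F n" for m n by (auto simp: F_def)
  show ex: "\<exists>n. A \<subseteq> F n" if A: "finite A" "A \<subseteq> B" for A
  proof -
    have "to_nat_on B e < Suc (Max (to_nat_on B ` A))" if "e \<in> A" for e
      using A that by (intro le_imp_less_Suc Max_ge) auto
    then have "A \<subseteq> F (Suc (Max (to_nat_on B ` A)))" using A(2) by (auto simp: F_def)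
    then show ?thesis by blast
  qed
  have "(\<Sum>\<^sub>\<infinity>e\<in>B. g e) = (SUP A\<in>{A. finite A \<and> A \<subseteq> B}. sum g A)"
    by (rule nonneg_infsum_complete) simp
  also have "\<dots> = (SUP n. \<Sum>e\<in>F n. g e)"
  proof (rule antisym)
    show "(SUP A\<in>{A. finite A \<and> A \<subseteq> B}. sum g A) \<le> (SUP n. \<Sum>e\<in>F n. g e)"
    proof (rule SUP_least)
      fix A assume "A \<in> {A. finite A \<and> A \<subseteq> B}"
      then obtain n where "A \<subseteq> F n" using ex by blast
      then have "sum g A \<le> sum g (F n)" using fin by (intro sum_mono2) auto
      also have "\<dots> \<le> (SUP n. \<Sum>e\<in>F n. g e)" by (rule SUP_upper) simp
      finally show "sum g A \<le> (SUP n. \<Sum>e\<in>F n. g e)" .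
    qed
    show "(SUP n. \<Sum>e\<in>F n. g e) \<le> (SUP A\<in>{A. finite A \<and> A \<subseteq> B}. sum g A)"
      using fin sub by (intro SUP_least SUP_upper) auto
  qed
  finally show "(\<Sum>\<^sub>\<infinity>e\<in>B. g e) = (SUP n. \<Sum>e\<in>F n. g e)" .
qed

text \<open>Both the sum over the basis and the squared norm of each value are suprema of increasing
  sequences of finite sums, so bounds for finite orthonormal sets carry over to the Hilbert-Schmidt
  norm.\<close>

lemma nn_integral_hs_norm_le:
  fixes T :: "'w \<Rightarrow> 'b::{real_inner, second_countable_topology} \<Rightarrow>\<^sub>L 'b"
  assumes m: "\<And>e. (\<lambda>\<omega>. blinfun_apply (T \<omega>) e) \<in> borel_measurable M"
    and bound: "\<And>F G. finite F \<Longrightarrow> pairwise orthogonal F \<Longrightarrow> (\<And>e. e \<in> F \<Longrightarrow> norm e = 1) \<Longrightarrow>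
       finite G \<Longrightarrow> pairwise orthogonal G \<Longrightarrow> (\<And>e. e \<in> G \<Longrightarrow> norm e = 1) \<Longrightarrow>
       (\<integral>\<^sup>+\<omega>. ennreal (\<Sum>e\<in>F. \<Sum>g\<in>G. (g \<bullet> blinfun_apply (T \<omega>) e)\<^sup>2) \<partial>M) \<le> K"
  shows "(\<integral>\<^sup>+\<omega>. (hs_norm (T \<omega>))\<^sup>2 \<partial>M) \<le> K"
proof -
  define B where "B = (SOME B :: 'b set. orthonormal_basis B)"
  have B: "orthonormal_basis B" unfolding B_def using ex_orthonormal_basis by (rule someI_ex)
  have oB: "pairwise orthogonal B" "\<And>e. e \<in> B \<Longrightarrow> norm e = 1" using B by (auto simp: orthonormal_basis_def)
  have cB: "countable B" by (rule orthonormal_countable[OF oB])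
  define F where "F n = {e\<in>B. to_nat_on B e < n}" for n
  note FS = infsum_countable_SUP[OF cB, folded F_def]
  have oF: "finite (F n)" "pairwise orthogonal (F n)" "\<And>e. e \<in> F n \<Longrightarrow> norm e = 1" for n
    using FS(2,3)[of n] oB by (auto intro: pairwise_subset)
  have norm_SUP: "ennreal (norm v ^ 2) = (SUP n. ennreal (\<Sum>g\<in>F n. (g \<bullet> v)\<^sup>2))" for v :: 'b
  proof (rule antisym)
    show "(SUP n. ennreal (\<Sum>g\<in>F n. (g \<bullet> v)\<^sup>2)) \<le> ennreal (norm v ^ 2)"
      by (intro SUP_least ennreal_leI bessel oF)
    show "ennreal (norm v ^ 2) \<le> (SUP n. ennreal (\<Sum>g\<in>F n. (g \<bullet> v)\<^sup>2))"
    proof (rule ennreal_le_epsilon)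
      fix r :: real assume r: "0 < r"
      obtain A where A: "finite A" "A \<subseteq> B" "norm v ^ 2 \<le> (\<Sum>b\<in>A. (b \<bullet> v)\<^sup>2) + r"
        using basis_norm_approx[OF B r, of v] by blast
      obtain n where n: "A \<subseteq> F n" using FS(5)[OF A(1,2)] by blast
      have "(\<Sum>b\<in>A. (b \<bullet> v)\<^sup>2) \<le> (\<Sum>b\<in>F n. (b \<bullet> v)\<^sup>2)" using n oF by (intro sum_mono2) auto
      then have "ennreal (norm v ^ 2) \<le> ennreal ((\<Sum>b\<in>F n. (b \<bullet> v)\<^sup>2) + r)" using A(3) by (intro ennreal_leI) simp
      also have "\<dots> = ennreal (\<Sum>b\<in>F n. (b \<bullet> v)\<^sup>2) + ennreal r" using r by (intro ennreal_plus sum_nonneg) auto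
      also have "\<dots> \<le> (SUP n. ennreal (\<Sum>g\<in>F n. (g \<bullet> v)\<^sup>2)) + ennreal r" by (intro add_right_mono SUP_upper) simp
      finally show "ennreal (norm v ^ 2) \<le> (SUP n. ennreal (\<Sum>g\<in>F n. (g \<bullet> v)\<^sup>2)) + ennreal r" .
    qed
  qed
  have mg: "(\<lambda>\<omega>. g \<bullet> blinfun_apply (T \<omega>) e) \<in> borel_measurable M" for g e using m[of e] by measurable
  have inc: "ennreal (\<Sum>g\<in>F i. (g \<bullet> v)\<^sup>2) \<le> ennreal (\<Sum>g\<in>F j. (g \<bullet> v)\<^sup>2)" if "i \<le> j" for i j v
    using FS(4)[OF that] oF(1) by (intro ennreal_leI sum_mono2) auto
  have "(\<integral>\<^sup>+\<omega>. (hs_norm (T \<omega>))\<^sup>2 \<partial>M) = (\<integral>\<^sup>+\<omega>. (SUP n. \<Sum>e\<in>F n. ennreal ((norm (blinfun_apply (T \<omega>) e))\<^sup>2)) \<partial>M)"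
    by (simp add: hs_norm_square B_def[symmetric] FS(1))
  also have "\<dots> = (SUP n. \<integral>\<^sup>+\<omega>. (\<Sum>e\<in>F n. ennreal ((norm (blinfun_apply (T \<omega>) e))\<^sup>2)) \<partial>M)"
  proof (rule nn_integral_monotone_convergence_SUP)
    show "incseq (\<lambda>n \<omega>. \<Sum>e\<in>F n. ennreal ((norm (blinfun_apply (T \<omega>) e))\<^sup>2))"
      using FS(4) oF(1) by (intro incseq_SucI le_funI sum_mono2) auto
    show "(\<lambda>\<omega>. \<Sum>e\<in>F n. ennreal ((norm (blinfun_apply (T \<omega>) e))\<^sup>2)) \<in> borel_measurable M" for n
      using m by measurable
  qed
  also have "\<dots> \<le> K"
  proof (rule SUP_least)
    fix n
    have "(\<integral>\<^sup>+\<omega>. (\<Sum>e\<in>F n. ennreal ((norm (blinfun_apply (T \<omega>) e))\<^sup>2)) \<partial>M)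
        = (\<integral>\<^sup>+\<omega>. (SUP k. \<Sum>e\<in>F n. ennreal (\<Sum>g\<in>F k. (g \<bullet> blinfun_apply (T \<omega>) e)\<^sup>2)) \<partial>M)"
    proof (intro nn_integral_cong)
      fix \<omega>
      have "(\<Sum>e\<in>F n. ennreal ((norm (blinfun_apply (T \<omega>) e))\<^sup>2))
          = (\<Sum>e\<in>F n. SUP k. ennreal (\<Sum>g\<in>F k. (g \<bullet> blinfun_apply (T \<omega>) e)\<^sup>2))"
        by (simp only: norm_SUP)
      also have "\<dots> = (SUP k. \<Sum>e\<in>F n. ennreal (\<Sum>g\<in>F k. (g \<bullet> blinfun_apply (T \<omega>) e)\<^sup>2))"
        by (rule ennreal_SUP_sum[symmetric]) (auto intro!: incseq_SucI inc)
      finally show "(\<Sum>e\<in>F n. ennreal ((norm (blinfun_apply (T \<omega>) e))\<^sup>2))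
          = (SUP k. \<Sum>e\<in>F n. ennreal (\<Sum>g\<in>F k. (g \<bullet> blinfun_apply (T \<omega>) e)\<^sup>2))" .
    qed
    also have "\<dots> = (SUP k. \<integral>\<^sup>+\<omega>. (\<Sum>e\<in>F n. ennreal (\<Sum>g\<in>F k. (g \<bullet> blinfun_apply (T \<omega>) e)\<^sup>2)) \<partial>M)"
    proof (rule nn_integral_monotone_convergence_SUP)
      show "incseq (\<lambda>k \<omega>. \<Sum>e\<in>F n. ennreal (\<Sum>g\<in>F k. (g \<bullet> blinfun_apply (T \<omega>) e)\<^sup>2))"
        by (intro incseq_SucI le_funI sum_mono inc) simp
      show "(\<lambda>\<omega>. \<Sum>e\<in>F n. ennreal (\<Sum>g\<in>F k. (g \<bullet> blinfun_apply (T \<omega>) e)\<^sup>2)) \<in> borel_measurable M" for k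
        using mg by measurable
    qed
    also have "\<dots> \<le> K"
    proof (rule SUP_least)
      fix k
      have "(\<integral>\<^sup>+\<omega>. (\<Sum>e\<in>F n. ennreal (\<Sum>g\<in>F k. (g \<bullet> blinfun_apply (T \<omega>) e)\<^sup>2)) \<partial>M)
          = (\<integral>\<^sup>+\<omega>. ennreal (\<Sum>e\<in>F n. \<Sum>g\<in>F k. (g \<bullet> blinfun_apply (T \<omega>) e)\<^sup>2) \<partial>M)"
        by (simp add: sum_nonneg)
      also have "\<dots> \<le> K" by (rule bound[OF oF oF])
      finally show "(\<integral>\<^sup>+\<omega>. (\<Sum>e\<in>F n. ennreal (\<Sum>g\<in>F k. (g \<bullet> blinfun_apply (T \<omega>) e)\<^sup>2)) \<partial>M) \<le> K" .
    qed
    finally show "(\<integral>\<^sup>+\<omega>. (\<Sum>e\<in>F n. ennreal ((norm (blinfun_apply (T \<omega>) e))\<^sup>2)) \<partial>M) \<le> K" .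
  qed
  finally show ?thesis .
qed

text \<open>Finite orthonormal sets in \<open>\<H>\<^sup>m\<close> lie in the span of a finite
  orthonormal set \<open>K\<close> of vectors with a single nonzero component, which separates the
  blocks of \<open>T\<close>.\<close>

lemma finite_product_coordinates:
  fixes F G :: "('a::{real_inner}, 'n::finite) vec set"
  assumes F: "finite F" "pairwise orthogonal F" "\<And>e. e \<in> F \<Longrightarrow> norm e = 1"
    and G: "finite G" "pairwise orthogonal G" "\<And>e. e \<in> G \<Longrightarrow> norm e = 1"
  shows "\<exists>E :: 'a set. finite E \<and> pairwise orthogonal E \<and> (\<forall>e\<in>E. norm e = 1) \<and>
    (\<forall>T. (\<Sum>e\<in>F. \<Sum>g\<in>G. (g \<bullet> blinfun_apply T e)\<^sup>2)
       \<le> (\<Sum>i\<in>UNIV. \<Sum>j\<in>UNIV. \<Sum>e\<in>E. \<Sum>e'\<in>E. (axis j e' \<bullet> blinfun_apply T (axis i e))\<^sup>2))"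
proof -
  define V where "V = (\<Union>v\<in>F \<union> G. range (\<lambda>i. v $ i))"
  have "finite V" unfolding V_def using F G by auto
  then obtain E where E: "finite E" "pairwise orthogonal E" "\<forall>e\<in>E. norm e = 1" "span V \<subseteq> span E"
    using orthonormal_spanning by blast
  define K where "K = (\<lambda>(i, e). axis i e :: ('a, 'n) vec) ` (UNIV \<times> E)"
  have K1: "finite K" unfolding K_def using E by auto
  have Kc: "\<exists>i. \<exists>e\<in>E. k = axis i e" if "k \<in> K" for k
  proof -
    obtain x where "x \<in> UNIV \<times> E" "k = (\<lambda>(i, e). axis i e) x" using \<open>k \<in> K\<close> unfolding K_def by blast
    then show ?thesis by (intro exI[of _ "fst x"] bexI[of _ "snd x"]) (auto simp only: case_prod_unfold mem_Times_iff)
  qed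
  have K3: "norm k = 1" if "k \<in> K" for k
  proof -
    obtain i e where "e \<in> E" "k = axis i e" using Kc[OF \<open>k \<in> K\<close>] by blast
    then show ?thesis using E(3) by (simp add: norm_eq_1 inner_axis_axis)
  qed
  have K2: "pairwise orthogonal K"
  proof (rule pairwiseI)
    fix x y assume "x \<in> K" "y \<in> K" and "x \<noteq> y"
    then obtain i e j e' where *: "e \<in> E" "e' \<in> E" "x = axis i e" "y = axis j e'" using Kc[OF \<open>x \<in> K\<close>] Kc[OF \<open>y \<in> K\<close>] by blast
    have "e \<bullet> e' = 0" if "i = j"
    proof -
      have "e \<noteq> e'" using *(3,4) \<open>i = j\<close> \<open>x \<noteq> y\<close> by metis
      then show ?thesis using pairwiseD[OF E(2) *(1,2)] unfolding orthogonal_def by blast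
    qed
    then show "orthogonal x y" by (simp add: orthogonal_def inner_axis_axis *)
  qed
  have inj: "inj_on (\<lambda>(i, e). axis i e :: ('a, 'n) vec) (UNIV \<times> E)"
  proof (rule inj_onI, clarify)
    fix i j e e' assume *: "e \<in> E" "e' \<in> E" "axis i e = (axis j e' :: ('a, 'n) vec)"
    have "e \<noteq> 0" using E(3) * by force
    then show "i = j \<and> e = e'" using *(3) by (simp add: axis_eq_axis)
  qed
  have span: "v \<in> span K" if "v \<in> F \<union> G" for v
  proof -
    have lin: "linear (axis i :: 'a \<Rightarrow> ('a, 'n) vec)" for i
      by (rule linearI) (auto simp: axis_def vec_eq_iff)
    have "axis i (v $ i) \<in> span K" for i
    proof -
      have "v $ i \<in> V" using that by (auto simp: V_def)
      then have "v $ i \<in> span E" using E(4) span_base by blast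
      then have "axis i (v $ i) \<in> axis i ` span E" by blast
      also have "axis i ` span E = span (axis i ` E)" by (rule linear_span_image[OF lin, symmetric])
      also have "\<dots> \<subseteq> span K" by (rule span_mono) (auto simp: K_def)
      finally show ?thesis .
    qed
    then have "(\<Sum>i\<in>UNIV. axis i (v $ i)) \<in> span K" by (rule span_sum)
    moreover have "(\<Sum>i\<in>UNIV. axis i (v $ i)) = v"
      by (simp add: vec_eq_iff axis_def if_distrib[of "\<lambda>x. x $ _"])
    ultimately show ?thesis by simp
  qed
  have "(\<Sum>e\<in>F. \<Sum>g\<in>G. (g \<bullet> blinfun_apply T e)\<^sup>2)
       \<le> (\<Sum>i\<in>UNIV. \<Sum>j\<in>UNIV. \<Sum>e\<in>E. \<Sum>e'\<in>E. (axis j e' \<bullet> blinfun_apply T (axis i e))\<^sup>2)" for T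
  proof -
    have "(\<Sum>e\<in>F. \<Sum>g\<in>G. (g \<bullet> blinfun_apply T e)\<^sup>2) = (\<Sum>g\<in>G. \<Sum>e\<in>F. (g \<bullet> blinfun_apply T e)\<^sup>2)"
      by (rule sum.swap)
    also have "\<dots> \<le> (\<Sum>g\<in>G. \<Sum>k\<in>K. (g \<bullet> blinfun_apply T k)\<^sup>2)"
      using span by (intro sum_mono functional_square_sum_le[OF F K1 K2 K3])
        (auto intro!: linearI simp: blinfun.add_right blinfun.scaleR_right inner_add_right)
    also have "\<dots> = (\<Sum>k\<in>K. \<Sum>g\<in>G. (g \<bullet> blinfun_apply T k)\<^sup>2)" by (rule sum.swap)
    also have "\<dots> \<le> (\<Sum>k\<in>K. \<Sum>l\<in>K. (l \<bullet> blinfun_apply T k)\<^sup>2)"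
      using span by (intro sum_mono functional_square_sum_le[OF G K1 K2 K3])
        (auto intro!: linearI simp: inner_add_left)
    also have "\<dots> = (\<Sum>(i, e)\<in>UNIV \<times> E. \<Sum>(j, e')\<in>UNIV \<times> E. (axis j e' \<bullet> blinfun_apply T (axis i e))\<^sup>2)"
      unfolding K_def sum.reindex[OF inj] by (simp add: case_prod_unfold)
    also have "\<dots> = (\<Sum>i\<in>UNIV. \<Sum>e\<in>E. \<Sum>j\<in>UNIV. \<Sum>e'\<in>E. (axis j e' \<bullet> blinfun_apply T (axis i e))\<^sup>2)"
      by (simp only: sum.cartesian_product[symmetric])
    also have "\<dots> = (\<Sum>i\<in>UNIV. \<Sum>j\<in>UNIV. \<Sum>e\<in>E. \<Sum>e'\<in>E. (axis j e' \<bullet> blinfun_apply T (axis i e))\<^sup>2)"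
      by (intro sum.cong refl, rule sum.swap)
    finally show ?thesis .
  qed
  then show ?thesis using E by (intro exI[of _ E]) auto
qed

section \<open>The process on the space of innovations\<close>

lemma nu_pow4: "nu M 4 Z ^ 4 = (\<integral>\<^sup>+\<omega>. ennreal (norm (Z \<omega>) ^ 4) \<partial>M)"
proof -
  have pow: "(epowr x (1 / 4)) ^ 4 = x" for x :: ennreal
  proof (cases "x = \<top>")
    case True
    then show ?thesis by (simp add: epowr_def power_eq_top_ennreal)
  next
    case False
    have "(enn2real x powr (1 / 4)) ^ 4 = enn2real x"
      by (cases "enn2real x = 0") (simp_all add: powr_powr flip: powr_numeral)
    then show ?thesis using False by (simp add: epowr_def ennreal_power less_top)
  qed
  have "norm (Z \<omega>) powr 4 = norm (Z \<omega>) ^ 4" for \<omega>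
    by (cases "norm (Z \<omega>) = 0") (simp_all flip: powr_numeral)
  then show ?thesis by (simp add: nu_def pow)
qed

lemma in_L4_iff: "in_Lp M 4 Z \<longleftrightarrow> Lk 4 M Z"
  for Z :: "'w \<Rightarrow> 'a::{real_normed_vector, second_countable_topology}"
proof -
  have "nu M 4 Z < \<top> \<longleftrightarrow> nu M 4 Z ^ 4 < \<top>"
    by (simp add: power_less_top_ennreal)
  then show ?thesis
    by (auto simp: in_Lp_def Lk_def nu_pow4 integrable_iff_bounded)
qed

lemma enn2real_nu_pow4: "(enn2real (nu M 4 Z)) ^ 4 = (\<integral>\<omega>. norm (Z \<omega>) ^ 4 \<partial>M)"
  if "Lk 4 M Z"
proof -
  have "(enn2real (nu M 4 Z)) ^ 4 = enn2real (nu M 4 Z ^ 4)"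
    by (cases "nu M 4 Z") (simp_all add: ennreal_power)
  also have "\<dots> = (\<integral>\<omega>. norm (Z \<omega>) ^ 4 \<partial>M)"
    using that by (simp add: nu_pow4 Lk_def nn_integral_eq_integral)
  finally show ?thesis .
qed

locale approximable_process = prob_space M
  for M :: "'w measure" +
  fixes S :: "'s measure" and f :: "(nat \<Rightarrow> 's) \<Rightarrow> 'a::{real_inner, banach, second_countable_topology}"
    and \<epsilon> :: "int \<Rightarrow> 'w \<Rightarrow> 's" and \<epsilon>' :: "nat \<Rightarrow> int \<Rightarrow> 'w \<Rightarrow> 's" and X :: "int \<Rightarrow> 'w \<Rightarrow> 'a"
  assumes approx: "Lp_m_approximable M 4 S f \<epsilon> \<epsilon>' X" and centered: "centered M X"
begin

definition law :: "'s measure" where "law = distr M S (\<epsilon> 0)"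

lemma innovation_measurable [measurable]: "\<epsilon> k \<in> M \<rightarrow>\<^sub>M S"
  using approx by (auto simp: Lp_m_approximable_def iid_process_def indep_vars_def)

sublocale inn: iid_space law
  unfolding law_def by (rule iid_space.intro, rule prob_space_distr) measurable

lemma sets_Om: "sets inn.Om = sets (PiM UNIV (\<lambda>_. S))"
  unfolding inn.Om_def by (intro sets_PiM_cong refl) (simp add: law_def)

text \<open>The innovations and their \<open>l\<close>-th copy as random elements of the product space.\<close>

definition path :: "'w \<Rightarrow> int \<Rightarrow> 's" where "path \<omega> = (\<lambda>k. \<epsilon> k \<omega>)"
definition copy :: "nat \<Rightarrow> 'w \<Rightarrow> int \<Rightarrow> 's" where "copy l \<omega> = (\<lambda>k. \<epsilon>' l k \<omega>)"

lemma path_S: "path \<in> M \<rightarrow>\<^sub>M PiM UNIV (\<lambda>_. S)"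
  unfolding path_def by (rule measurable_PiM_single') (auto simp: space_PiM PiE_iff intro: measurable_space[OF innovation_measurable])

lemma path_measurable [measurable]: "path \<in> M \<rightarrow>\<^sub>M inn.Om"
  using path_S by (simp add: measurable_cong_sets[OF refl sets_Om])

lemma distr_path: "distr M inn.Om path = inn.Om"
proof -
  have i: "indep_vars (\<lambda>_. S) \<epsilon> UNIV" and law: "\<And>k. distr M S (\<epsilon> k) = law"
    using approx by (auto simp: Lp_m_approximable_def iid_process_def law_def)
  have "distr M (PiM UNIV (\<lambda>_. S)) (\<lambda>x. \<lambda>k\<in>UNIV. \<epsilon> k x) = PiM UNIV (\<lambda>k. distr M S (\<epsilon> k))"
    using i by (subst (asm) indep_vars_iff_distr_eq_PiM) auto
  then have "distr M (PiM UNIV (\<lambda>_. S)) path = inn.Om"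
    by (simp add: law inn.Om_def path_def[abs_def] restrict_UNIV)
  then show ?thesis using distr_cong[OF refl sets_Om refl, of M path] by simp
qed

lemma distr_path_copy:
  "(\<lambda>\<omega>. (path \<omega>, copy l \<omega>)) \<in> M \<rightarrow>\<^sub>M inn.Om \<Otimes>\<^sub>M inn.Om"
  "distr M (inn.Om \<Otimes>\<^sub>M inn.Om) (\<lambda>\<omega>. (path \<omega>, copy l \<omega>)) = inn.Om \<Otimes>\<^sub>M inn.Om"
proof -
  let ?P = "PiM UNIV (\<lambda>_::int. S)"
  define Z where "Z i \<omega> = (case i of 0 \<Rightarrow> path \<omega> | Suc l \<Rightarrow> copy l \<omega>)" for i \<omega>
  have "(\<lambda>i \<omega> k. (case i of 0 \<Rightarrow> \<epsilon> | Suc l \<Rightarrow> \<epsilon>' l) k \<omega>) = Z"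
    by (auto simp: Z_def path_def copy_def fun_eq_iff split: nat.split)
  then have Z: "indep_vars (\<lambda>_. ?P) Z UNIV"
    and cl: "distr M ?P (copy l) = distr M ?P path"
    using approx by (simp_all add: Lp_m_approximable_def independent_copies_def copy_def[abs_def] path_def[abs_def])
  have "indep_var ?P ((\<lambda>x. x 0) \<circ> (\<lambda>\<omega>. restrict (\<lambda>i. Z i \<omega>) {0})) ?P ((\<lambda>x. x (Suc l)) \<circ> (\<lambda>\<omega>. restrict (\<lambda>i. Z i \<omega>) {Suc l}))"
    by (intro indep_var_compose[OF indep_var_restrict[OF Z]]) auto
  also have "((\<lambda>x. x 0) \<circ> (\<lambda>\<omega>. restrict (\<lambda>i. Z i \<omega>) {0})) = path"
    by (simp add: fun_eq_iff Z_def)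
  also have "((\<lambda>x. x (Suc l)) \<circ> (\<lambda>\<omega>. restrict (\<lambda>i. Z i \<omega>) {Suc l})) = copy l"
    by (simp add: fun_eq_iff Z_def)
  finally have "indep_var ?P path ?P (copy l)" .
  then have rv: "copy l \<in> M \<rightarrow>\<^sub>M ?P" and d: "distr M ?P path \<Otimes>\<^sub>M distr M ?P (copy l) = distr M (?P \<Otimes>\<^sub>M ?P) (\<lambda>\<omega>. (path \<omega>, copy l \<omega>))"
    unfolding indep_var_distribution_eq by auto
  have s: "sets (inn.Om \<Otimes>\<^sub>M inn.Om) = sets (?P \<Otimes>\<^sub>M ?P)" by (intro sets_pair_measure_cong sets_Om)
  show "(\<lambda>\<omega>. (path \<omega>, copy l \<omega>)) \<in> M \<rightarrow>\<^sub>M inn.Om \<Otimes>\<^sub>M inn.Om"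
    using measurable_Pair[OF path_S rv] by (simp add: measurable_cong_sets[OF refl s])
  have p: "distr M ?P path = inn.Om" using distr_path distr_cong[OF refl sets_Om refl, of M path] by simp
  show "distr M (inn.Om \<Otimes>\<^sub>M inn.Om) (\<lambda>\<omega>. (path \<omega>, copy l \<omega>)) = inn.Om \<Otimes>\<^sub>M inn.Om"
    using d distr_cong[OF refl s refl, of M "\<lambda>\<omega>. (path \<omega>, copy l \<omega>)"] by (simp add: cl p)
qed

text \<open>The function \<open>f\<close> as a function of all innovations, so that
  \<open>X\<^sub>k\<close> is \<open>\<psi>\<close> of the innovations shifted by \<open>k\<close>.\<close>

definition \<psi> :: "(int \<Rightarrow> 's) \<Rightarrow> 'a" where "\<psi> x = f (\<lambda>j. x (- int j))"

lemma psi_measurable [measurable]: "\<psi> \<in> borel_measurable inn.Om"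
proof -
  have "(\<lambda>x j. x (- int j)) \<in> PiM UNIV (\<lambda>_. S) \<rightarrow>\<^sub>M PiM UNIV (\<lambda>_. S)"
    by (rule measurable_PiM_single') (auto simp: space_PiM PiE_iff)
  moreover have "f \<in> borel_measurable (PiM UNIV (\<lambda>_. S))"
    using approx by (simp add: Lp_m_approximable_def)
  ultimately have "(\<lambda>x. f (\<lambda>j. x (- int j))) \<in> borel_measurable (PiM UNIV (\<lambda>_. S))"
    by (rule measurable_compose)
  then show ?thesis unfolding \<psi>_def by (simp add: measurable_cong_sets[OF sets_Om refl])
qed

lemma psi_dep: "dep_on {..0} \<psi>"
  by (simp add: dep_on_def \<psi>_def splice_def)

lemma AE_X: "AE \<omega> in M. \<forall>k. X k \<omega> = \<psi> (inn.shift k (path \<omega>))"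
proof -
  have "AE \<omega> in M. X k \<omega> = \<psi> (inn.shift k (path \<omega>))" for k
  proof -
    have "AE \<omega> in M. X k \<omega> = f (\<lambda>j. \<epsilon> (k - int j) \<omega>)"
      using approx by (simp add: Lp_m_approximable_def)
    then show ?thesis by (simp add: \<psi>_def inn.shift_def path_def add.commute)
  qed
  then show ?thesis by (simp add: AE_all_countable)
qed

lemma coupled_eq: "coupled f \<epsilon> \<epsilon>' (int l) l \<omega> =
    \<psi> (splice {- int l<..} (inn.shift (int l) (path \<omega>)) (inn.shift (int l) (copy l \<omega>)))"
proof -
  have "(int j < int l) = (j < l)" for j by simp
  then show ?thesis
    unfolding coupled_def \<psi>_def splice_def inn.shift_def path_def copy_def
    by (intro arg_cong[where f=f]) (auto simp: fun_eq_iff)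
qed

lemma X_L4: "Lk 4 M (X k)"
  using approx by (simp add: Lp_m_approximable_def flip: in_L4_iff)

lemma X_measurable [measurable]: "X k \<in> borel_measurable M"
  using X_L4 by (simp add: Lk_def)

lemma integral_path:
  fixes F :: "(int \<Rightarrow> 's) \<Rightarrow> 'b::{banach, second_countable_topology}"
  assumes "F \<in> borel_measurable inn.Om"
  shows "(\<integral>\<omega>. F (path \<omega>) \<partial>M) = integral\<^sup>L inn.Om F"
    and "integrable M (\<lambda>\<omega>. F (path \<omega>)) \<longleftrightarrow> integrable inn.Om F"
  using integral_distr[OF path_measurable assms] integrable_distr_eq[OF path_measurable assms]
  by (simp_all only: distr_path)

lemma integral_X:
  fixes F :: "(int \<Rightarrow> 'a) \<Rightarrow> 'b::{banach, second_countable_topology}"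
  assumes "(\<lambda>x. F (\<lambda>k. \<psi> (inn.shift k x))) \<in> borel_measurable inn.Om"
    and "(\<lambda>\<omega>. F (\<lambda>k. X k \<omega>)) \<in> borel_measurable M"
  shows "(\<integral>\<omega>. F (\<lambda>k. X k \<omega>) \<partial>M) = (\<integral>x. F (\<lambda>k. \<psi> (inn.shift k x)) \<partial>inn.Om)"
    and "integrable M (\<lambda>\<omega>. F (\<lambda>k. X k \<omega>)) \<longleftrightarrow> integrable inn.Om (\<lambda>x. F (\<lambda>k. \<psi> (inn.shift k x)))"
proof -
  have m: "(\<lambda>\<omega>. F (\<lambda>k. \<psi> (inn.shift k (path \<omega>)))) \<in> borel_measurable M"
    using measurable_compose[OF path_measurable assms(1)] .
  have ae: "AE \<omega> in M. F (\<lambda>k. X k \<omega>) = F (\<lambda>k. \<psi> (inn.shift k (path \<omega>)))"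
    using AE_X by eventually_elim simp
  show "(\<integral>\<omega>. F (\<lambda>k. X k \<omega>) \<partial>M) = (\<integral>x. F (\<lambda>k. \<psi> (inn.shift k x)) \<partial>inn.Om)"
    unfolding integral_cong_AE[OF assms(2) m ae] by (rule integral_path(1)[OF assms(1)])
  show "integrable M (\<lambda>\<omega>. F (\<lambda>k. X k \<omega>)) \<longleftrightarrow> integrable inn.Om (\<lambda>x. F (\<lambda>k. \<psi> (inn.shift k x)))"
    unfolding integrable_cong_AE[OF assms(2) m ae] by (rule integral_path(2)[OF assms(1)])
qed

lemma psi_L4: "Lk 4 inn.Om \<psi>" and psi_nu: "(\<integral>x. norm (\<psi> x) ^ 4 \<partial>inn.Om) = (enn2real (nu M 4 (X 1))) ^ 4"
  and psi_mean: "integral\<^sup>L inn.Om \<psi> = 0"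
proof -
  have "integrable M (\<lambda>\<omega>. norm (X 1 \<omega>) ^ 4)" using X_L4[of 1] by (simp add: Lk_def)
  then have "integrable inn.Om (\<lambda>x. (\<lambda>x. norm (\<psi> x) ^ 4) (inn.shift 1 x))"
    using integral_X(2)[of "\<lambda>Y. norm (Y 1) ^ 4"] by simp
  then show "Lk 4 inn.Om \<psi>"
    by (subst (asm) inn.integral_shift(2)) (auto simp: Lk_def)
  have "(\<integral>x. norm (\<psi> x) ^ 4 \<partial>inn.Om) = (\<integral>x. norm (\<psi> (inn.shift 1 x)) ^ 4 \<partial>inn.Om)"
    using inn.integral_shift(1)[of "\<lambda>x. norm (\<psi> x) ^ 4" 1] by simp
  also have "\<dots> = (\<integral>\<omega>. norm (X 1 \<omega>) ^ 4 \<partial>M)"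
    using integral_X(1)[of "\<lambda>Y. norm (Y 1) ^ 4"] by simp
  finally show "(\<integral>x. norm (\<psi> x) ^ 4 \<partial>inn.Om) = (enn2real (nu M 4 (X 1))) ^ 4"
    using X_L4[of 1] by (simp add: enn2real_nu_pow4)
  have "integral\<^sup>L inn.Om \<psi> = (\<integral>x. \<psi> (inn.shift 1 x) \<partial>inn.Om)"
    using inn.integral_shift(1)[of \<psi> 1] by simp
  also have "\<dots> = integral\<^sup>L M (X 1)"
    using integral_X(1)[of "\<lambda>Y. Y 1"] by simp
  finally show "integral\<^sup>L inn.Om \<psi> = 0" using centered by (simp add: centered_def)
qed

definition \<delta> :: "nat \<Rightarrow> real" where
  "\<delta> l = enn2real (nu M 4 (\<lambda>\<omega>. X (int l) \<omega> - coupled f \<epsilon> \<epsilon>' (int l) l \<omega>))"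

text \<open>The coupling distance is an integral over two independent copies of the innovations, as
  \<open>(path, copy l)\<close> has the product law; stationarity moves the time \<open>l\<close> to
  \<open>0\<close>.\<close>

lemma delta_pow4:
  "nu M 4 (\<lambda>\<omega>. X (int l) \<omega> - coupled f \<epsilon> \<epsilon>' (int l) l \<omega>) = ennreal (\<delta> l)"
  "(\<delta> l) ^ 4 = (\<integral>p. norm (\<psi> (fst p) - \<psi> (splice {- int l<..} (fst p) (snd p))) ^ 4 \<partial>(inn.Om \<Otimes>\<^sub>M inn.Om))"
proof -
  let ?Z = "\<lambda>\<omega>. X (int l) \<omega> - coupled f \<epsilon> \<epsilon>' (int l) l \<omega>"
  let ?OO = "inn.Om \<Otimes>\<^sub>M inn.Om"
  define G where "G p = norm (\<psi> (fst p) - \<psi> (splice {- int l<..} (fst p) (snd p))) ^ 4" for p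
  let ?s = "\<lambda>p. (inn.shift (int l) (fst p), inn.shift (int l) (snd p))"
  have G [measurable]: "G \<in> borel_measurable ?OO" unfolding G_def by measurable
  have dist: "distr ?OO ?OO ?s = ?OO"
  proof -
    have "sigma_finite_measure (distr inn.Om inn.Om (inn.shift (int l)))"
      unfolding inn.distr_shift by unfold_locales
    then have "distr inn.Om inn.Om (inn.shift (int l)) \<Otimes>\<^sub>M distr inn.Om inn.Om (inn.shift (int l)) = distr ?OO ?OO (\<lambda>(x, y). (inn.shift (int l) x, inn.shift (int l) y))"
      by (intro pair_measure_distr) auto
    then show ?thesis by (simp add: inn.distr_shift case_prod_unfold)
  qed
  have iG: "integrable ?OO G"
  proof -
    have 1: "Lk 4 ?OO (\<lambda>p. \<psi> (splice UNIV (fst p) (snd p)))" "Lk 4 ?OO (\<lambda>p. \<psi> (splice {- int l<..} (fst p) (snd p)))"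
      using psi_L4 inn.integrable_splice(1)[of "\<lambda>x. norm (\<psi> x) ^ 4"] by (auto simp: Lk_def)
    from L4_diff[OF 1] show ?thesis by (simp add: Lk_def G_def[abs_def] splice_def)
  qed
  have c: "(\<lambda>\<omega>. coupled f \<epsilon> \<epsilon>' (int l) l \<omega>) \<in> borel_measurable M"
  proof -
    have "(\<lambda>p. \<psi> (splice {- int l<..} (fst (?s p)) (snd (?s p)))) \<in> borel_measurable ?OO"
      by measurable
    from measurable_compose[OF distr_path_copy(1) this] show ?thesis
      by (simp add: coupled_eq)
  qed
  have "nu M 4 ?Z ^ 4 = (\<integral>\<^sup>+\<omega>. ennreal (G (?s (path \<omega>, copy l \<omega>))) \<partial>M)"
    unfolding nu_pow4 by (intro nn_integral_cong_AE, use AE_X in eventually_elim) (simp add: G_def coupled_eq)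
  also have "\<dots> = (\<integral>\<^sup>+p. ennreal (G (?s p)) \<partial>distr M ?OO (\<lambda>\<omega>. (path \<omega>, copy l \<omega>)))"
    by (subst nn_integral_distr[OF distr_path_copy(1)]) simp_all
  also have "\<dots> = (\<integral>\<^sup>+p. ennreal (G p) \<partial>distr ?OO ?OO ?s)"
    unfolding distr_path_copy(2) by (subst nn_integral_distr) auto
  also have "\<dots> = ennreal (integral\<^sup>L ?OO G)"
    unfolding dist by (rule nn_integral_eq_integral[OF iG]) (simp add: G_def)
  finally have eq: "nu M 4 ?Z ^ 4 = ennreal (integral\<^sup>L ?OO G)" .
  then have "nu M 4 ?Z ^ 4 < \<top>" by simp
  have d0: "0 \<le> \<delta> l" by (simp add: \<delta>_def)
  from \<open>nu M 4 ?Z ^ 4 < \<top>\<close> have fin: "nu M 4 ?Z < \<top>" by (simp add: power_less_top_ennreal)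
  then show "nu M 4 ?Z = ennreal (\<delta> l)" by (simp add: \<delta>_def)
  then show "(\<delta> l) ^ 4 = (\<integral>p. norm (\<psi> (fst p) - \<psi> (splice {- int l<..} (fst p) (snd p))) ^ 4 \<partial>?OO)"
    using eq d0 by (simp add: ennreal_power G_def[abs_def])
qed

end

section \<open>The estimation error\<close>

lemma norm_axis': "norm (axis i v :: ('a::real_inner, 'n::finite) vec) = norm v"
  by (simp add: norm_eq_sqrt_inner inner_axis_axis)

lemma bounded_linear_axis: "bounded_linear (axis i :: 'a::real_inner \<Rightarrow> ('a, 'n::finite) vec)"
proof (rule bounded_linear_intro[where K=1])
  show "norm (axis i x :: ('a, 'n) vec) \<le> norm x * 1" for x :: 'a by (simp add: norm_axis')
qed (auto simp: axis_def vec_eq_iff)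

lemma stacked_eq_sum: "(stacked X k \<omega> :: ('a::real_inner, 'n::{finite, linorder}) vec)
    = (\<Sum>i\<in>UNIV. axis i (X (k - int (card {j. j < i})) \<omega>))"
  by (simp add: stacked_def vec_eq_iff axis_def if_distrib[of "\<lambda>x. x $ _"] cong: if_cong)

context approximable_process
begin

text \<open>The scale \<open>r\<close> may exceed \<open>\<nu>\<^sub>4(X\<^sub>1)\<close>, which is
  allowed to be zero. From \<open>D4\<^sup>4 + D2\<^sup>4 \<le> (\<delta>/r)\<^sup>4 / 2\<close> and
  \<open>(x + y)\<^sup>4 \<le> 8 (x\<^sup>4 + y\<^sup>4)\<close> it follows that \<open>2 \<surd>2
  (D4 + D2) \<le> 4 \<delta>/r\<close>.\<close>

lemma coordinate_bound:
  fixes t0 :: int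
  assumes r: "0 < r" "enn2real (nu M 4 (X 1)) \<le> r"
    and E: "finite E" "pairwise orthogonal E" "\<And>e. e \<in> E \<Longrightarrow> norm e = 1"
    and pq: "\<bar>q - p\<bar> \<le> int \<kappa>" and k1: "1 \<le> \<kappa>" and n: "1 \<le> n"
  defines "B \<equiv> \<lambda>e e' \<omega>. (\<Sum>t<n. (e \<bullet> X (t0 + int t + p) \<omega>) * (e' \<bullet> X (t0 + int t + q) \<omega>)
      - (\<integral>\<omega>. (e \<bullet> X p \<omega>) * (e' \<bullet> X q \<omega>) \<partial>M))\<^sup>2"
  shows "(\<Sum>e\<in>E. \<Sum>e'\<in>E. \<integral>\<omega>. B e e' \<omega> \<partial>M)
    \<le> real n * (r ^ 4 * (2 * real \<kappa> - 1) + 4 * r ^ 3 * (\<Sum>j=\<kappa>..<max n (2 * \<kappa>). \<delta> j))"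
    and "integrable M (B e e')"
proof -
  define \<phi> where "\<phi> x = (1 / r) *\<^sub>R \<psi> x" for x
  have n4: "norm (\<phi> x) ^ 4 = norm (\<psi> x) ^ 4 / r ^ 4" for x
    using r by (simp add: \<phi>_def power_divide)
  interpret sp: stat_process law \<phi> E
  proof
    show "Lk 4 inn.Om \<phi>" using psi_L4 unfolding Lk_def n4 by (auto simp: \<phi>_def[abs_def])
    show "dep_on {..0} \<phi>" unfolding \<phi>_def by (rule dep_on_comp[OF psi_dep])
    show "integral\<^sup>L inn.Om \<phi> = 0" using psi_mean by (simp add: \<phi>_def[abs_def])
    have "(enn2real (nu M 4 (X 1))) ^ 4 \<le> r ^ 4" using r by (intro power_mono) auto
    then show "(\<integral>x. norm (\<phi> x) ^ 4 \<partial>inn.Om) \<le> 1"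
      unfolding n4 using r by (simp add: psi_nu)
  qed (use E in auto)
  have psi: "\<psi> (inn.shift k x) = r *\<^sub>R sp.X k x" for k x
    using r by (simp add: sp.X_def \<phi>_def)
  have mean: "(\<integral>\<omega>. (e \<bullet> X p \<omega>) * (e' \<bullet> X q \<omega>) \<partial>M) = r\<^sup>2 * (\<integral>x. (e \<bullet> sp.X p x) * (e' \<bullet> sp.X q x) \<partial>inn.Om)" for e e'
  proof -
    have "(\<integral>\<omega>. (e \<bullet> X p \<omega>) * (e' \<bullet> X q \<omega>) \<partial>M)
        = (\<integral>x. (e \<bullet> \<psi> (inn.shift p x)) * (e' \<bullet> \<psi> (inn.shift q x)) \<partial>inn.Om)"
      using integral_X(1)[of "\<lambda>Y. (e \<bullet> Y p) * (e' \<bullet> Y q)"] by simp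
    also have "\<dots> = (\<integral>x. r\<^sup>2 * ((e \<bullet> sp.X p x) * (e' \<bullet> sp.X q x)) \<partial>inn.Om)"
      by (simp add: psi power2_eq_square ac_simps)
    finally show ?thesis by simp
  qed
  define C where "C e e' x = (\<Sum>t<n. (e \<bullet> sp.X (t0 + int t + p) x) * (e' \<bullet> sp.X (t0 + int t + q) x)
      - (\<integral>x. (e \<bullet> sp.X p x) * (e' \<bullet> sp.X q x) \<partial>inn.Om))\<^sup>2" for e e' x
  have Cint: "integrable inn.Om (C e e')" for e e'
    unfolding C_def by (rule sp.block_bound(2)[OF pq k1 n])
  have eq: "(\<Sum>t<n. (e \<bullet> \<psi> (inn.shift (t0 + int t + p) x)) * (e' \<bullet> \<psi> (inn.shift (t0 + int t + q) x))
      - (\<integral>\<omega>. (e \<bullet> X p \<omega>) * (e' \<bullet> X q \<omega>) \<partial>M))\<^sup>2 = r ^ 4 * C e e' x" for e e' x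
  proof -
    have "(\<Sum>t<n. (e \<bullet> \<psi> (inn.shift (t0 + int t + p) x)) * (e' \<bullet> \<psi> (inn.shift (t0 + int t + q) x))
      - (\<integral>\<omega>. (e \<bullet> X p \<omega>) * (e' \<bullet> X q \<omega>) \<partial>M))
      = r\<^sup>2 * (\<Sum>t<n. (e \<bullet> sp.X (t0 + int t + p) x) * (e' \<bullet> sp.X (t0 + int t + q) x)
      - (\<integral>x. (e \<bullet> sp.X p x) * (e' \<bullet> sp.X q x) \<partial>inn.Om))"
      unfolding mean psi sum_distrib_left
      by (intro sum.cong refl) (simp add: power2_eq_square algebra_simps)
    then show ?thesis by (simp add: C_def power_mult_distrib flip: power_mult)
  qed
  have I: "(\<integral>\<omega>. B e e' \<omega> \<partial>M) = r ^ 4 * (\<integral>x. C e e' x \<partial>inn.Om)" "integrable M (B e e')" for e e'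
  proof -
    let ?F = "\<lambda>Y. (\<Sum>t<n. (e \<bullet> Y (t0 + int t + p)) * (e' \<bullet> Y (t0 + int t + q))
      - (\<integral>\<omega>. (e \<bullet> X p \<omega>) * (e' \<bullet> X q \<omega>) \<partial>M))\<^sup>2 :: real"
    have m: "(\<lambda>x. ?F (\<lambda>k. \<psi> (inn.shift k x))) \<in> borel_measurable inn.Om"
      "(\<lambda>\<omega>. ?F (\<lambda>k. X k \<omega>)) \<in> borel_measurable M"
      by measurable
    from integral_X[OF m] show "(\<integral>\<omega>. B e e' \<omega> \<partial>M) = r ^ 4 * (\<integral>x. C e e' x \<partial>inn.Om)" "integrable M (B e e')"
      using Cint[of e e'] by (simp_all add: eq B_def[abs_def])
  qed
  then show "integrable M (B e e')" by simp
  have D: "2 * sqrt 2 * (sp.D4 (int j) + sp.D2 (int j)) \<le> 4 * \<delta> j / r" for j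
  proof -
    let ?a = "sp.D4 (int j)" and ?b = "sp.D2 (int j)"
    have a0: "0 \<le> ?a" "0 \<le> ?b" by (simp_all add: sp.D4_def sp.D2_def nrm2_nonneg)
    have d0: "0 \<le> \<delta> j" by (simp add: \<delta>_def)
    have n4': "norm (\<phi> x - \<phi> y) ^ 4 = norm (\<psi> x - \<psi> y) ^ 4 / r ^ 4" for x y
      using r by (simp add: \<phi>_def power_divide flip: scaleR_diff_right)
    define y where "y = (\<delta> j) ^ 4 / r ^ 4"
    have "?a ^ 4 + ?b ^ 4 \<le> y / 2"
      using sp.D4_D2_delta[of "int j"] n4' by (simp add: delta_pow4(2) y_def)
    moreover have "(?a + ?b) ^ 4 \<le> 8 * ?a ^ 4 + 8 * ?b ^ 4"
      using norm_add_pow4[of ?a ?b] a0 by simp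
    ultimately have "(?a + ?b) ^ 4 \<le> 4 * y" by linarith
    also have "\<dots> = (sqrt 2 * (\<delta> j / r)) ^ 4"
    proof -
      have "(sqrt 2) ^ 4 = ((sqrt 2)\<^sup>2)\<^sup>2" by (simp only: power_mult[symmetric]) simp
      then show ?thesis by (simp add: y_def power_mult_distrib power_divide)
    qed
    finally have "?a + ?b \<le> sqrt 2 * (\<delta> j / r)"
      by (rule power_le_imp_le_base[where n=3, simplified, OF _ ]) (use d0 r in auto)
    then have "2 * sqrt 2 * (?a + ?b) \<le> 2 * sqrt 2 * (sqrt 2 * (\<delta> j / r))"
      by (intro mult_left_mono) auto
    also have "\<dots> = 2 * (sqrt 2 * sqrt 2) * (\<delta> j / r)" by (simp only: ac_simps)
    finally show ?thesis by simp
  qed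
  have "(\<Sum>e\<in>E. \<Sum>e'\<in>E. \<integral>\<omega>. B e e' \<omega> \<partial>M) = r ^ 4 * (\<Sum>e\<in>E. \<Sum>e'\<in>E. \<integral>x. C e e' x \<partial>inn.Om)"
    by (simp add: I sum_distrib_left)
  also have "\<dots> \<le> r ^ 4 * (real n * (2 * real \<kappa> - 1 + (\<Sum>j=\<kappa>..<max n (2 * \<kappa>). 2 * sqrt 2 * (sp.D4 (int j) + sp.D2 (int j)))))"
    unfolding C_def using sp.block_bound(1)[OF pq k1 n, of t0] r by (intro mult_left_mono) auto
  also have "\<dots> \<le> r ^ 4 * (real n * (2 * real \<kappa> - 1 + (\<Sum>j=\<kappa>..<max n (2 * \<kappa>). 4 * \<delta> j / r)))"
    using r D by (intro mult_left_mono add_left_mono sum_mono) auto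
  also have "(\<Sum>j=\<kappa>..<max n (2 * \<kappa>). 4 * \<delta> j / r) = 4 * (\<Sum>j=\<kappa>..<max n (2 * \<kappa>). \<delta> j) / r"
    by (simp add: sum_distrib_left sum_divide_distrib)
  also have "r ^ 4 * (real n * (2 * real \<kappa> - 1 + 4 * (\<Sum>j=\<kappa>..<max n (2 * \<kappa>). \<delta> j) / r))
      = real n * (r ^ 4 * (2 * real \<kappa> - 1) + 4 * r ^ 3 * (\<Sum>j=\<kappa>..<max n (2 * \<kappa>). \<delta> j))"
    using r by (simp add: field_simps power4_eq_xxxx power3_eq_cube)
  finally show "(\<Sum>e\<in>E. \<Sum>e'\<in>E. \<integral>\<omega>. B e e' \<omega> \<partial>M)
    \<le> real n * (r ^ 4 * (2 * real \<kappa> - 1) + 4 * r ^ 3 * (\<Sum>j=\<kappa>..<max n (2 * \<kappa>). \<delta> j))" .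
qed

lemma X_L2: "Lk 2 M (X k)"
  using L4_L2[OF _ X_L4] finite_measure_axioms by blast

lemma stacked_L2: "Lk 2 M (stacked X k :: 'w \<Rightarrow> ('a, 'n::{finite, linorder}) vec)"
  and stacked_mean: "integral\<^sup>L M (stacked X k :: 'w \<Rightarrow> ('a, 'n) vec) = 0"
proof -
  define Y where "Y i \<omega> = (axis i (X (k - int (card {j. j < i})) \<omega>) :: ('a, 'n) vec)" for i \<omega>
  have ax: "(axis i :: 'a \<Rightarrow> ('a, 'n) vec) \<in> borel_measurable borel" for i :: 'n
    by (intro borel_measurable_continuous_onI bounded_linear.continuous_on[OF bounded_linear_axis] continuous_on_id)
  have Y: "Lk 2 M (Y i)" for i
    using X_L2[of "k - int (card {j. j < i})"] measurable_compose[OF X_measurable ax]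
    by (simp add: Lk_def Y_def[abs_def] norm_axis')
  have eq: "stacked X k = (\<lambda>\<omega>. \<Sum>i\<in>UNIV. Y i \<omega>)"
    by (simp add: fun_eq_iff stacked_eq_sum Y_def)
  have "Lk 2 M (\<lambda>\<omega>. \<Sum>i\<in>I. Y i \<omega>)" if "finite I" for I
    using that by (induction I rule: finite_induct) (simp_all add: L2_add Y Lk_const finite_measure_axioms)
  then show "Lk 2 M (stacked X k :: 'w \<Rightarrow> ('a, 'n) vec)" unfolding eq by simp
  have c: "integrable M (X j)" "integral\<^sup>L M (X j) = 0" for j using centered by (auto simp: centered_def)
  have "integral\<^sup>L M (Y i) = 0" for i
    unfolding Y_def[abs_def] using c by (subst integral_bounded_linear[OF bounded_linear_axis]) (simp_all add: axis_def vec_eq_iff)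
  moreover have "integrable M (Y i)" for i
    using L2_integrable[OF _ Y] finite_measure_axioms by blast
  ultimately show "integral\<^sup>L M (stacked X k :: 'w \<Rightarrow> ('a, 'n) vec) = 0" unfolding eq by simp
qed

lemma lag_cov_coordinate:
  "axis b e' \<bullet> blinfun_apply (lag_cov M X h :: ('a, 'n::{finite, linorder}) vec \<Rightarrow>\<^sub>L ('a, 'n) vec) (axis i e)
    = (\<integral>\<omega>. (e \<bullet> X (- int (card {j. j < i})) \<omega>) * (e' \<bullet> X (h - int (card {j. j < b})) \<omega>) \<partial>M)"
proof -
  define Y Z :: "'w \<Rightarrow> ('a, 'n) vec" where "Y = stacked X 0" and "Z = stacked X h"
  have Y: "Lk 2 M Y" and Z: "Lk 2 M Z" by (simp_all add: Y_def Z_def stacked_L2)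
  then have [measurable]: "Y \<in> borel_measurable M" "Z \<in> borel_measurable M" by (simp_all add: Lk_def)
  have nn: "integrable M (\<lambda>\<omega>. norm (Y \<omega>) * norm (Z \<omega>))"
    by (intro L2_mult_integrable Lk_norm Y Z)
  have i: "integrable M (\<lambda>\<omega>. (Y \<omega> \<bullet> axis i e) *\<^sub>R Z \<omega>)"
  proof (rule Bochner_Integration.integrable_bound)
    show "integrable M (\<lambda>\<omega>. norm e * (norm (Y \<omega>) * norm (Z \<omega>)))" using nn by simp
    have "norm ((Y \<omega> \<bullet> axis i e) *\<^sub>R Z \<omega>) \<le> norm e * (norm (Y \<omega>) * norm (Z \<omega>))" for \<omega>
    proof -
      have "abs (Y \<omega> \<bullet> axis i e) \<le> norm (Y \<omega>) * norm e"
        using Cauchy_Schwarz_ineq2[of "Y \<omega>" "axis i e"] by (simp add: norm_axis')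
      then have "abs (Y \<omega> \<bullet> axis i e) * norm (Z \<omega>) \<le> norm (Y \<omega>) * norm e * norm (Z \<omega>)"
        by (rule mult_right_mono) simp
      then show ?thesis by (simp add: ac_simps)
    qed
    then show "AE \<omega> in M. norm ((Y \<omega> \<bullet> axis i e) *\<^sub>R Z \<omega>) \<le> norm (norm e * (norm (Y \<omega>) * norm (Z \<omega>)))"
      by (simp add: abs_mult)
  qed measurable
  have "lag_cov M X h = Bochner_integral M (\<lambda>\<omega>. tensor_op (Y \<omega>) (Z \<omega>))"
    unfolding lag_cov_def cross_cov_def stacked_mean by (simp add: Y_def Z_def)
  then have "blinfun_apply (lag_cov M X h) (axis i e) = (\<integral>\<omega>. (Y \<omega> \<bullet> axis i e) *\<^sub>R Z \<omega> \<partial>M)"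
    using Bochner_integral_tensor_apply[OF finite_measure_axioms, of Y Z "axis i e"] nn by simp
  then have "axis b e' \<bullet> blinfun_apply (lag_cov M X h) (axis i e) = (\<integral>\<omega>. axis b e' \<bullet> ((Y \<omega> \<bullet> axis i e) *\<^sub>R Z \<omega>) \<partial>M)"
    using i by (simp del: inner_scaleR_right)
  also have "\<dots> = (\<integral>\<omega>. (e \<bullet> X (- int (card {j. j < i})) \<omega>) * (e' \<bullet> X (h - int (card {j. j < b})) \<omega>) \<partial>M)"
    by (simp add: Y_def Z_def inner_axis inner_axis' stacked_def inner_commute)
  finally show ?thesis .
qed

text \<open>The block at the positions \<open>(i, b)\<close> pairs \<open>X\<close> at times that differ
  by \<open>h - pos b + pos i\<close>, and \<open>|h - pos b + pos i| \<le> |h| + m - 1 \<le>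
  \<kappa>\<close>.\<close>

lemma estimator_moment:
  fixes h :: int and m N :: nat
  assumes m: "m = CARD('n::{finite, linorder})" and hN: "\<bar>h\<bar> \<le> int N - int m"
    and r: "0 < r" "enn2real (nu M 4 (X 1)) \<le> r"
  defines "n \<equiv> nat (int N - \<bar>h\<bar> - int m + 1)" and "\<kappa> \<equiv> kappa' h m"
  shows "(\<integral>\<^sup>+\<omega>. (hs_norm (lag_cov_est X N h \<omega> -
               (lag_cov M X h :: ('a, 'n) vec \<Rightarrow>\<^sub>L ('a, 'n) vec)))\<^sup>2 \<partial>M)
    \<le> ennreal ((real m)\<^sup>2 / real n * (r ^ 4 * (2 * real \<kappa> - 1) + 4 * r ^ 3 * (\<Sum>j=\<kappa>..<max n (2 * \<kappa>). \<delta> j)))"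
    (is "_ \<le> ennreal ((real m)\<^sup>2 / real n * ?K)")
proof -
  have n: "1 \<le> n" "real_of_int (int N - \<bar>h\<bar> - int m + 1) = real n" and k1: "1 \<le> \<kappa>"
    using hN by (auto simp: n_def \<kappa>_def kappa'_def)
  define t0 where "t0 = max (int m) (int m - h)"
  define pos where "pos i = int (card {j. j < i})" for i :: 'n
  have pos: "0 \<le> pos i" "pos i \<le> int m - 1" for i
  proof -
    have "{j. j < i} \<subset> UNIV" by auto
    then have "card {j. j < i} < CARD('n)" by (intro psubset_card_mono) auto
    then show "0 \<le> pos i" "pos i \<le> int m - 1" by (auto simp: pos_def m)
  qed
  define T where "T \<omega> = lag_cov_est X N h \<omega> - (lag_cov M X h :: ('a, 'n) vec \<Rightarrow>\<^sub>L ('a, 'n) vec)" for \<omega>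
  define B where "B i b e e' \<omega> = (\<Sum>t<n. (e \<bullet> X (t0 + int t + - pos i) \<omega>) * (e' \<bullet> X (t0 + int t + (h - pos b)) \<omega>)
      - (\<integral>\<omega>. (e \<bullet> X (- pos i) \<omega>) * (e' \<bullet> X (h - pos b) \<omega>) \<partial>M))" for i b e e' \<omega>
  have est: "lag_cov_est X N h \<omega> = (1 / real n) *\<^sub>R
      (\<Sum>t<n. tensor_op (stacked X (t0 + int t) \<omega>) (stacked X (t0 + int t + h) \<omega> :: ('a, 'n) vec))" for \<omega>
  proof -
    have "(\<Sum>k\<in>{max (int m) (int m - h)..min (int N) (int N - h)}. g k) = (\<Sum>t<n. g (t0 + int t))" for g :: "int \<Rightarrow> ('a, 'n) vec \<Rightarrow>\<^sub>L ('a, 'n) vec"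
      by (rule sum.reindex_bij_witness[of _ "\<lambda>t. t0 + int t" "\<lambda>k. nat (k - t0)"])
        (auto simp: t0_def n_def)
    then show ?thesis using n(2) by (simp add: lag_cov_est_def Let_def m)
  qed
  have coord: "axis b e' \<bullet> blinfun_apply (T \<omega>) (axis i e) = 1 / real n * B i b e e' \<omega>" for i b e e' \<omega>
  proof -
    have "axis b e' \<bullet> blinfun_apply (T \<omega>) (axis i e)
      = 1 / real n * (\<Sum>t<n. (e \<bullet> X (t0 + int t + - pos i) \<omega>) * (e' \<bullet> X (t0 + int t + (h - pos b)) \<omega>))
      - (\<integral>\<omega>. (e \<bullet> X (- pos i) \<omega>) * (e' \<bullet> X (h - pos b) \<omega>) \<partial>M)"
      unfolding T_def blinfun.diff_left inner_diff_right lag_cov_coordinate est blinfun.scaleR_left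
        blinfun.sum_left inner_scaleR_right inner_sum_right tensor_op.rep_eq
      by (simp add: inner_axis inner_axis' stacked_def pos_def inner_commute algebra_simps)
    also have "\<dots> = 1 / real n * B i b e e' \<omega>"
      using n by (simp add: B_def sum_subtractf field_simps)
    finally show ?thesis .
  qed
  have [measurable]: "(stacked X k :: 'w \<Rightarrow> ('a, 'n) vec) \<in> borel_measurable M" for k
    using stacked_L2[where 'n='n, of k] by (simp add: Lk_def)
  have Tm: "(\<lambda>\<omega>. blinfun_apply (T \<omega>) v) \<in> borel_measurable M" for v
    unfolding T_def blinfun.diff_left est blinfun.scaleR_left blinfun.sum_left tensor_op.rep_eq by measurable
  have "(\<integral>\<^sup>+\<omega>. (hs_norm (T \<omega>))\<^sup>2 \<partial>M) \<le> ennreal ((real m)\<^sup>2 / real n * ?K)"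
  proof (rule nn_integral_hs_norm_le[OF Tm])
    fix F G :: "('a, 'n) vec set"
    assume FG: "finite F" "pairwise orthogonal F" "\<And>e. e \<in> F \<Longrightarrow> norm e = 1"
       "finite G" "pairwise orthogonal G" "\<And>e. e \<in> G \<Longrightarrow> norm e = 1"
    obtain E :: "'a set" where E: "finite E" "pairwise orthogonal E" "\<forall>e\<in>E. norm e = 1"
      and le: "\<And>T. (\<Sum>e\<in>F. \<Sum>g\<in>G. (g \<bullet> blinfun_apply T e)\<^sup>2)
       \<le> (\<Sum>i\<in>UNIV. \<Sum>j\<in>UNIV. \<Sum>e\<in>E. \<Sum>e'\<in>E. (axis j e' \<bullet> blinfun_apply T (axis i e))\<^sup>2)"
      using finite_product_coordinates[OF FG] by blast
    have E1: "norm e = 1" if "e \<in> E" for e using E(3) that by blast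
    have kap: "\<bar>(h - pos b) - (- pos i)\<bar> \<le> int \<kappa>" for i b
      using pos[of i] pos[of b] by (auto simp: \<kappa>_def kappa'_def)
    note cb = coordinate_bound[where ?t0.0 = t0, OF r E(1,2) E1 kap k1 n(1), folded B_def]
    have "(\<integral>\<^sup>+\<omega>. ennreal (\<Sum>e\<in>F. \<Sum>g\<in>G. (g \<bullet> blinfun_apply (T \<omega>) e)\<^sup>2) \<partial>M)
        \<le> (\<integral>\<^sup>+\<omega>. ennreal (\<Sum>i\<in>UNIV. \<Sum>b\<in>UNIV. \<Sum>e\<in>E. \<Sum>e'\<in>E. (1 / real n)\<^sup>2 * (B i b e e' \<omega>)\<^sup>2) \<partial>M)"
      using le[of "T _"] unfolding coord power_mult_distrib by (intro nn_integral_mono ennreal_leI)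
    also have "\<dots> = ennreal (\<integral>\<omega>. (\<Sum>i\<in>UNIV. \<Sum>b\<in>UNIV. \<Sum>e\<in>E. \<Sum>e'\<in>E. (1 / real n)\<^sup>2 * (B i b e e' \<omega>)\<^sup>2) \<partial>M)"
      by (intro nn_integral_eq_integral Bochner_Integration.integrable_sum integrable_mult_right cb(2) AE_I2 sum_nonneg
          mult_nonneg_nonneg zero_le_power2) simp_all
    also have "(\<integral>\<omega>. (\<Sum>i\<in>UNIV. \<Sum>b\<in>UNIV. \<Sum>e\<in>E. \<Sum>e'\<in>E. (1 / real n)\<^sup>2 * (B i b e e' \<omega>)\<^sup>2) \<partial>M)
        = (\<Sum>i\<in>UNIV. \<Sum>b\<in>UNIV. (1 / real n)\<^sup>2 * (\<Sum>e\<in>E. \<Sum>e'\<in>E. \<integral>\<omega>. (B i b e e' \<omega>)\<^sup>2 \<partial>M))"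
      using cb(2) by (simp add: sum_distrib_left)
    also have "\<dots> \<le> (\<Sum>i\<in>(UNIV :: 'n set). \<Sum>b\<in>(UNIV :: 'n set). (1 / real n)\<^sup>2 * (real n * ?K))"
      using cb(1) by (intro sum_mono mult_left_mono) simp_all
    also have "\<dots> = (real m)\<^sup>2 / real n * ?K"
      using n(1) by (simp add: m[symmetric] power2_eq_square field_simps)
    finally show "(\<integral>\<^sup>+\<omega>. ennreal (\<Sum>e\<in>F. \<Sum>g\<in>G. (g \<bullet> blinfun_apply (T \<omega>) e)\<^sup>2) \<partial>M)
        \<le> ennreal ((real m)\<^sup>2 / real n * ?K)"
      by (simp add: ennreal_leI)
  qed
  then show ?thesis by (simp add: T_def)
qed

lemma tau_eq:
  fixes h :: int and m :: nat
  defines "s \<equiv> enn2real (\<Sum>\<^sub>\<infinity>k\<in>{kappa' h m..}. nu M 4 (\<lambda>\<omega>. X (int k) \<omega> - coupled f \<epsilon> \<epsilon>' (int k) k \<omega>))"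
  defines "c \<equiv> enn2real (nu M 4 (X 1))"
  shows "tau M f \<epsilon> \<epsilon>' X h m = ennreal (c ^ 4 + 4 / (2 * real (kappa' h m) - 1) * c ^ 3 * s)"
    and "(\<Sum>k=kappa' h m..<T. \<delta> k) \<le> s"
proof -
  define \<kappa> where "\<kappa> = kappa' h m"
  have k1: "1 \<le> \<kappa>" by (simp add: \<kappa>_def kappa'_def)
  define g where "g k = ennreal (\<delta> k)" for k
  have g: "nu M 4 (\<lambda>\<omega>. X (int k) \<omega> - coupled f \<epsilon> \<epsilon>' (int k) k \<omega>) = g k" for k
    by (simp add: g_def delta_pow4(1))
  have d0: "0 \<le> \<delta> k" for k by (simp add: \<delta>_def)
  have sup: "(\<Sum>\<^sub>\<infinity>k\<in>A. g k) = (SUP F\<in>{F. finite F \<and> F \<subseteq> A}. sum g F)" for A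
    by (rule nonneg_infsum_complete) simp
  have "(\<Sum>\<^sub>\<infinity>k\<in>{\<kappa>..}. g k) \<le> (\<Sum>\<^sub>\<infinity>k\<in>{1..}. g k)"
    unfolding sup using k1 by (intro SUP_subset_mono) auto
  also have "\<dots> < \<top>" using approx by (simp add: Lp_m_approximable_def g)
  finally have s: "(\<Sum>\<^sub>\<infinity>k\<in>{\<kappa>..}. g k) = ennreal s" by (simp add: s_def g \<kappa>_def)
  have s0: "0 \<le> s" by (simp add: s_def)
  have "ennreal (\<Sum>k=\<kappa>..<T. \<delta> k) = sum g {\<kappa>..<T}" by (simp add: g_def d0)
  also have "\<dots> \<le> (\<Sum>\<^sub>\<infinity>k\<in>{\<kappa>..}. g k)" unfolding sup by (intro SUP_upper) auto
  finally show "(\<Sum>k=kappa' h m..<T. \<delta> k) \<le> s"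
    unfolding s using s0 by (simp add: \<kappa>_def)
  have "nu M 4 (X 1) < \<top>" using approx by (simp add: Lp_m_approximable_def in_Lp_def)
  then have c: "nu M 4 (X 1) = ennreal c" by (simp add: c_def)
  have c0: "0 \<le> c" by (simp add: c_def)
  have "tau M f \<epsilon> \<epsilon>' X h m = ennreal c ^ 4 + ennreal (4 / (2 * real \<kappa> - 1)) * ennreal c ^ 3 * ennreal s"
    unfolding tau_def g c s[unfolded \<kappa>_def] by (simp add: \<kappa>_def)
  also have "\<dots> = ennreal (c ^ 4 + 4 / (2 * real \<kappa> - 1) * c ^ 3 * s)"
  proof -
    have q: "0 \<le> 4 / (2 * real \<kappa> - 1)" using k1 by simp
    have "ennreal (4 / (2 * real \<kappa> - 1)) * ennreal c ^ 3 * ennreal s = ennreal (4 / (2 * real \<kappa> - 1) * c ^ 3 * s)"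
      using q c0 s0 by (simp only: ennreal_power ennreal_mult[symmetric] zero_le_power mult_nonneg_nonneg)
    moreover have "0 \<le> 4 / (2 * real \<kappa> - 1) * c ^ 3 * s" using q c0 s0 by (intro mult_nonneg_nonneg zero_le_power)
    ultimately show ?thesis using c0 by (simp add: ennreal_power ennreal_plus)
  qed
  finally show "tau M f \<epsilon> \<epsilon>' X h m = ennreal (c ^ 4 + 4 / (2 * real (kappa' h m) - 1) * c ^ 3 * s)"
    by (simp add: \<kappa>_def)
qed

end

theorem corollary3p1:
  fixes M :: "'w measure" and S :: "'s measure"
    and f :: "(nat \<Rightarrow> 's) \<Rightarrow> 'a::{real_inner, banach, second_countable_topology}"
    and \<epsilon> :: "int \<Rightarrow> 'w \<Rightarrow> 's" and \<epsilon>' :: "nat \<Rightarrow> int \<Rightarrow> 'w \<Rightarrow> 's"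
    and X :: "int \<Rightarrow> 'w \<Rightarrow> 'a"
    and h :: int and m N :: nat
  assumes "prob_space M"
    and "centered M X"
    and "Lp_m_approximable M 4 S f \<epsilon> \<epsilon>' X"
    and "m = CARD('n::{finite, linorder})"
    and "\<bar>h\<bar> \<le> int N - int m"
  shows "ennreal (real_of_int (int N - \<bar>h\<bar> - int m + 1) /
              ((real m)\<^sup>2 * (2 * real (kappa' h m) - 1))) *
           (\<integral>\<^sup>+\<omega>. (hs_norm (lag_cov_est X N h \<omega> -
               (lag_cov M X h :: ('a, 'n) vec \<Rightarrow>\<^sub>L ('a, 'n) vec)))\<^sup>2 \<partial>M)
         \<le> tau M f \<epsilon> \<epsilon>' X h m
       \<and> 0 \<le> tau M f \<epsilon> \<epsilon>' X h m \<and> tau M f \<epsilon> \<epsilon>' X h m < \<top>"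
proof -
  interpret approximable_process M S f \<epsilon> \<epsilon>' X
    using assms(1-3) by (intro approximable_process.intro approximable_process_axioms.intro)
  define \<kappa> where "\<kappa> = kappa' h m"
  define n where "n = nat (int N - \<bar>h\<bar> - int m + 1)"
  have n: "1 \<le> n" "real_of_int (int N - \<bar>h\<bar> - int m + 1) = real n" and k1: "1 \<le> \<kappa>" and m1: "1 \<le> m"
    using assms(4,5) by (auto simp: n_def \<kappa>_def kappa'_def Suc_le_eq)
  define s where "s = enn2real (\<Sum>\<^sub>\<infinity>k\<in>{\<kappa>..}. nu M 4 (\<lambda>\<omega>. X (int k) \<omega> - coupled f \<epsilon> \<epsilon>' (int k) k \<omega>))"
  define c where "c = enn2real (nu M 4 (X 1))"
  define b where "b r = r ^ 4 + 4 / (2 * real \<kappa> - 1) * r ^ 3 * s" for r :: real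
  note tau = tau_eq[of h m, folded \<kappa>_def, folded s_def c_def]
  let ?I = "\<integral>\<^sup>+\<omega>. (hs_norm (lag_cov_est X N h \<omega> -
               (lag_cov M X h :: ('a, 'n) vec \<Rightarrow>\<^sub>L ('a, 'n) vec)))\<^sup>2 \<partial>M"
  let ?w = "real n / ((real m)\<^sup>2 * (2 * real \<kappa> - 1))"
  have c0: "0 \<le> c" by (simp add: c_def)
  have bound: "ennreal ?w * ?I \<le> ennreal (b r)" if "c < r" for r
  proof -
    have r: "0 < r" "c \<le> r" using that c0 by auto
    define D where "D = (\<Sum>j=\<kappa>..<max n (2 * \<kappa>). \<delta> j)"
    have "ennreal ?w * ?I \<le> ennreal ?w * ennreal ((real m)\<^sup>2 / real n * (r ^ 4 * (2 * real \<kappa> - 1) + 4 * r ^ 3 * D))"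
      unfolding D_def \<kappa>_def n_def
      by (intro mult_left_mono estimator_moment assms(4,5) r(1) r(2)[unfolded c_def]) simp
    also have "\<dots> = ennreal (?w * ((real m)\<^sup>2 / real n * (r ^ 4 * (2 * real \<kappa> - 1) + 4 * r ^ 3 * D)))"
      using k1 by (intro ennreal_mult'[symmetric]) simp
    also have "?w * ((real m)\<^sup>2 / real n * (r ^ 4 * (2 * real \<kappa> - 1) + 4 * r ^ 3 * D))
        = r ^ 4 + 4 / (2 * real \<kappa> - 1) * r ^ 3 * D"
    proof -
      have "2 * real \<kappa> - 1 \<noteq> 0" "real n \<noteq> 0" "real m \<noteq> 0" using k1 n(1) m1 by auto
      then show ?thesis by (simp add: field_simps)
    qed
    also have "\<dots> \<le> b r"
      unfolding b_def D_def using tau(2) k1 r(1) by (intro add_left_mono mult_left_mono) auto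
    finally show ?thesis by (simp add: ennreal_leI)
  qed
  \<comment> \<open>the process may vanish, so the scale \<open>r = c\<close> is reached as a limit only\<close>
  have "((\<lambda>r. ennreal (b r)) \<longlongrightarrow> ennreal (b c)) (at_right c)"
    unfolding b_def by (intro tendsto_ennrealI tendsto_intros)
  moreover have "eventually (\<lambda>r. ennreal ?w * ?I \<le> ennreal (b r)) (at_right c)"
    using bound by (auto simp: eventually_at_filter)
  ultimately have "ennreal ?w * ?I \<le> ennreal (b c)"
    by (rule tendsto_lowerbound) simp
  then show ?thesis
    using tau(1) n(2) by (simp add: b_def \<kappa>_def)
qed

end
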